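(* Let $X$ be a locally compact, path-connected Hausdorff space, let $K$ be a base of $X$ consisting of relatively compact open subsets, ordered under inclusion, and let $(\mathcal{A},\jmath)_K$ be a net of $\mathrm{C}^*$-algebras over $K$. Let $\mathscr{A}$ be the associated $C_0(X)$-algebra and $\tau:(\mathcal{A},\jmath)_K\nrightarrow\mathscr{A}$ the canonical heteromorphism. Then $\mathscr{A}$ fulfils the following universal property: for any heteromorphism $\phi:(\mathcal{A},\jmath)_K\nrightarrow\mathscr{B}$ into a $C_0(X)$-algebra $\mathscr{B}$, there is a unique $C_0(X)$-morphism $\bar\phi:\mathscr{A}\to\mathscr{B}$ such that $\phi=\bar\phi^{\,s}\circ\tau$, i.e. $\phi_Y=\bar\phi^{\,s,Y}\circ\tau_Y$ for all $Y\in K$.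
   Context: Nets. A net of $\mathrm{C}^*$-algebras $(\mathcal{A},\jmath)_K$ over a poset $K$ is a family of unital $\mathrm{C}^*$-algebras $\mathcal{A}_Y$, $Y\in K$, with unital $*$-monomorphisms $\jmath_{Y'Y}:\mathcal{A}_Y\to\mathcal{A}_{Y'}$ for $Y\subseteq Y'$ such that $\jmath_{Y''Y'}\circ\jmath_{Y'Y}=\jmath_{Y''Y}$ for $Y\subseteq Y'\subseteq Y''$. A morphism from $(\mathcal{A},\jmath)_K$ into a $\mathrm{C}^*$-algebra $B$ is a family of $*$-morphisms $\phi_Y:\mathcal{A}_Y\to B$ with $\phi_{Y'}\circ\jmath_{Y'Y}=\phi_Y$ for $Y\subseteq Y'$. The universal $\mathrm{C}^*$-algebra of a net is the $\mathrm{C}^*$-algebra $\vec A$ endowed with a canonical morphism $\epsilon:(\mathcal{A},\jmath)_K\to\vec A$ such that every morphism $\phi$ of the net into a $\mathrm{C}^*$-algebra $B$ factors as $\phi=\phi^{\uparrow}\circ\epsilon$ for a unique $*$-morphism $\phi^\uparrow:\vec A\to B$. $C_0(X)$-algebras. A $C_0(X)$-algebra is a $\mathrm{C}^*$-algebra $\mathscr{B}$ with a nondegenerate $*$-morphism from $C_0(X)$ to the centre of the multiplier algebra $M\mathscr{B}$; a $C_0(X)$-morphism is a $*$-morphism $\eta$ between $C_0(X)$-algebras with $\eta(fT)=f\eta(T)$ for $f\in C_0(X)$. For $U\subset X$ open, $C_0(U)\mathscr{B}$ is the closed ideal generated by the elements $fv$, $f\in C_0(U)$, $v\in\mathscr{B}$.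 For $Y\in K$ put $S_Y\mathscr{B}:=\mathscr{B}/C_0(X-\overline{Y})\mathscr{B}$ with quotient map $r_Y:\mathscr{B}\to S_Y\mathscr{B}$; for $Y\subseteq Y'$ let $r_{YY'}:S_{Y'}\mathscr{B}\to S_Y\mathscr{B}$ be the $*$-morphism with $r_{YY'}\circ r_{Y'}=r_Y$. A $C_0(X)$-morphism $\psi:\mathscr{B}\to\mathscr{B}'$ induces $*$-morphisms $\psi^{s,Y}:S_Y\mathscr{B}\to S_Y\mathscr{B}'$, $Y\in K$, by $\psi^{s,Y}\circ r_Y:=r'_Y\circ\psi$; the family is denoted $\psi^s$. Heteromorphisms. A heteromorphism $\phi:(\mathcal{A},\jmath)_K\nrightarrow\mathscr{B}$ is a family of $*$-morphisms $\phi_Y:\mathcal{A}_Y\to S_Y\mathscr{B}$, $Y\in K$, such that $r_{YY'}\circ\phi_{Y'}\circ\jmath_{Y'Y}=\phi_Y$ for all $Y\subseteq Y'$. The algebra $\mathscr{A}$. For $x\in X$ let $\omega_x:=\{Y\in K: x\in Y\}$ and let $\mathcal{A}_x$ be the universal $\mathrm{C}^*$-algebra of the restricted net $(\mathcal{A},\jmath)_{\omega_x}$, with canonical morphism $\epsilon^x=\{\epsilon^x_Y:\mathcal{A}_Y\to\mathcal{A}_x\}_{Y\in\omega_x}$. For $Y\in K$, $t\in\mathcal{A}_Y$ define $\widehat{\epsilon}_Y(t)\in\mathcal{A}^X:=\prod_{x\in X}\mathcal{A}_x$ (bounded fields, sup-norm) by $\widehat{\epsilon}_Y(t)_x:=\epsilon^x_Y(t)$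 if $x\in Y$ and $0$ otherwise. $\mathcal{A}_*$ is the $*$-subalgebra of $\mathcal{A}^X$ generated by the fields $f\,\widehat{\epsilon}_Y(t)$, $Y\in K$, $f\in C_0(Y)$, $t\in\mathcal{A}_Y$, and $\mathscr{A}$ is its norm closure; it is a $C_0(X)$-algebra under pointwise multiplication. The canonical heteromorphism $\tau:(\mathcal{A},\jmath)_K\nrightarrow\mathscr{A}$ is $\tau_Y(t):=r_Y(g\,\widehat{\epsilon}_U(\jmath_{UY}(t)))$, $t\in\mathcal{A}_Y$, where $U\in K$ satisfies $\overline{Y}\subset U$ and $g\in C_0(U)$ satisfies $g=1$ on $Y$; it does not depend on the choice of $U$ and $g$. *)

theory Defs
  imports "HOL-Analysis.Analysis"
begin

section \<open>C*-algebras with explicit carrier\<close>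

record 'a cstar =
  cs_carrier :: "'a set"
  cs_zero :: 'a  (\<open>\<zero>\<index>\<close>)
  cs_add :: "'a \<Rightarrow> 'a \<Rightarrow> 'a"  (infixl \<open>\<oplus>\<index>\<close> 65)
  cs_scale :: "complex \<Rightarrow> 'a \<Rightarrow> 'a"  (infixr \<open>\<odot>\<index>\<close> 75)
  cs_mult :: "'a \<Rightarrow> 'a \<Rightarrow> 'a"  (infixl \<open>\<otimes>\<index>\<close> 70)
  cs_star :: "'a \<Rightarrow> 'a"
  cs_norm :: "'a \<Rightarrow> real"

definition cs_diff :: "'a cstar \<Rightarrow> 'a \<Rightarrow> 'a \<Rightarrow> 'a"  (infixl \<open>\<ominus>\<index>\<close> 65)
  where "cs_diff A a b = a \<oplus>\<^bsub>A\<^esub> ((-1) \<odot>\<^bsub>A\<^esub> b)"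

locale cstar_algebra =
  fixes A :: "'a cstar" (structure)
  assumes zero_closed: "\<zero> \<in> cs_carrier A"
    and add_closed: "\<lbrakk>a \<in> cs_carrier A; b \<in> cs_carrier A\<rbrakk> \<Longrightarrow> a \<oplus> b \<in> cs_carrier A"
    and scale_closed: "a \<in> cs_carrier A \<Longrightarrow> c \<odot> a \<in> cs_carrier A"
    and mult_closed: "\<lbrakk>a \<in> cs_carrier A; b \<in> cs_carrier A\<rbrakk> \<Longrightarrow> a \<otimes> b \<in> cs_carrier A"
    and star_closed: "a \<in> cs_carrier A \<Longrightarrow> cs_star A a \<in> cs_carrier A"
    and add_assoc: "\<lbrakk>a \<in> cs_carrier A; b \<in> cs_carrier A; d \<in> cs_carrier A\<rbrakk>
          \<Longrightarrow> (a \<oplus> b) \<oplus> d = a \<oplus> (b \<oplus> d)"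
    and add_commute: "\<lbrakk>a \<in> cs_carrier A; b \<in> cs_carrier A\<rbrakk> \<Longrightarrow> a \<oplus> b = b \<oplus> a"
    and add_zero: "a \<in> cs_carrier A \<Longrightarrow> a \<oplus> \<zero> = a"
    and add_minus: "a \<in> cs_carrier A \<Longrightarrow> a \<oplus> ((-1) \<odot> a) = \<zero>"
    and scale_add_right: "\<lbrakk>a \<in> cs_carrier A; b \<in> cs_carrier A\<rbrakk>
          \<Longrightarrow> c \<odot> (a \<oplus> b) = (c \<odot> a) \<oplus> (c \<odot> b)"
    and scale_add_left: "a \<in> cs_carrier A \<Longrightarrow> (c + c') \<odot> a = (c \<odot> a) \<oplus> (c' \<odot> a)"
    and scale_scale: "a \<in> cs_carrier A \<Longrightarrow> c \<odot> (c' \<odot> a) = (c * c') \<odot> a"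
    and scale_one: "a \<in> cs_carrier A \<Longrightarrow> 1 \<odot> a = a"
    and mult_assoc: "\<lbrakk>a \<in> cs_carrier A; b \<in> cs_carrier A; d \<in> cs_carrier A\<rbrakk>
          \<Longrightarrow> (a \<otimes> b) \<otimes> d = a \<otimes> (b \<otimes> d)"
    and mult_add_left: "\<lbrakk>a \<in> cs_carrier A; b \<in> cs_carrier A; d \<in> cs_carrier A\<rbrakk>
          \<Longrightarrow> (a \<oplus> b) \<otimes> d = (a \<otimes> d) \<oplus> (b \<otimes> d)"
    and mult_add_right: "\<lbrakk>a \<in> cs_carrier A; b \<in> cs_carrier A; d \<in> cs_carrier A\<rbrakk>
          \<Longrightarrow> a \<otimes> (b \<oplus> d) = (a \<otimes> b) \<oplus> (a \<otimes> d)"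
    and mult_scale_left: "\<lbrakk>a \<in> cs_carrier A; b \<in> cs_carrier A\<rbrakk>
          \<Longrightarrow> (c \<odot> a) \<otimes> b = c \<odot> (a \<otimes> b)"
    and mult_scale_right: "\<lbrakk>a \<in> cs_carrier A; b \<in> cs_carrier A\<rbrakk>
          \<Longrightarrow> a \<otimes> (c \<odot> b) = c \<odot> (a \<otimes> b)"
    and star_star: "a \<in> cs_carrier A \<Longrightarrow> cs_star A (cs_star A a) = a"
    and star_add: "\<lbrakk>a \<in> cs_carrier A; b \<in> cs_carrier A\<rbrakk>
          \<Longrightarrow> cs_star A (a \<oplus> b) = cs_star A a \<oplus> cs_star A b"
    and star_scale: "a \<in> cs_carrier A \<Longrightarrow> cs_star A (c \<odot> a) = cnj c \<odot> cs_star A a"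
    and star_mult: "\<lbrakk>a \<in> cs_carrier A; b \<in> cs_carrier A\<rbrakk>
          \<Longrightarrow> cs_star A (a \<otimes> b) = cs_star A b \<otimes> cs_star A a"
    and norm_eq_zero: "a \<in> cs_carrier A \<Longrightarrow> cs_norm A a = 0 \<longleftrightarrow> a = \<zero>"
    and norm_triangle: "\<lbrakk>a \<in> cs_carrier A; b \<in> cs_carrier A\<rbrakk>
          \<Longrightarrow> cs_norm A (a \<oplus> b) \<le> cs_norm A a + cs_norm A b"
    and norm_scale: "a \<in> cs_carrier A \<Longrightarrow> cs_norm A (c \<odot> a) = cmod c * cs_norm A a"
    and norm_mult: "\<lbrakk>a \<in> cs_carrier A; b \<in> cs_carrier A\<rbrakk>
          \<Longrightarrow> cs_norm A (a \<otimes> b) \<le> cs_norm A a * cs_norm A b"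
    and norm_cstar: "a \<in> cs_carrier A \<Longrightarrow> cs_norm A (cs_star A a \<otimes> a) = (cs_norm A a)\<^sup>2"
    and complete: "\<lbrakk>\<And>n::nat. s n \<in> cs_carrier A;
          \<And>e. e > 0 \<Longrightarrow> \<exists>N. \<forall>m\<ge>N. \<forall>n\<ge>N. cs_norm A (s m \<ominus> s n) < e\<rbrakk>
          \<Longrightarrow> \<exists>l\<in>cs_carrier A. (\<lambda>n. cs_norm A (s n \<ominus> l)) \<longlonglongrightarrow> 0"

definition is_unit_of :: "'a cstar \<Rightarrow> 'a \<Rightarrow> bool" where
  "is_unit_of A e \<longleftrightarrow> e \<in> cs_carrier A \<and>
     (\<forall>a\<in>cs_carrier A. e \<otimes>\<^bsub>A\<^esub> a = a \<and> a \<otimes>\<^bsub>A\<^esub> e = a)"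

definition unital_cstar_algebra :: "'a cstar \<Rightarrow> bool" where
  "unital_cstar_algebra A \<longleftrightarrow> cstar_algebra A \<and> (\<exists>e. is_unit_of A e)"

definition star_morphism :: "'a cstar \<Rightarrow> 'b cstar \<Rightarrow> ('a \<Rightarrow> 'b) \<Rightarrow> bool" where
  "star_morphism A B f \<longleftrightarrow>
     f \<in> cs_carrier A \<rightarrow> cs_carrier B \<and>
     (\<forall>a\<in>cs_carrier A. \<forall>b\<in>cs_carrier A. f (a \<oplus>\<^bsub>A\<^esub> b) = f a \<oplus>\<^bsub>B\<^esub> f b) \<and>
     (\<forall>a\<in>cs_carrier A. \<forall>c. f (c \<odot>\<^bsub>A\<^esub> a) = c \<odot>\<^bsub>B\<^esub> f a) \<and>
     (\<forall>a\<in>cs_carrier A. \<forall>b\<in>cs_carrier A. f (a \<otimes>\<^bsub>A\<^esub> b) = f a \<otimes>\<^bsub>B\<^esub> f b) \<and>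
     (\<forall>a\<in>cs_carrier A. f (cs_star A a) = cs_star B (f a))"

definition unital_star_monomorphism :: "'a cstar \<Rightarrow> 'b cstar \<Rightarrow> ('a \<Rightarrow> 'b) \<Rightarrow> bool" where
  "unital_star_monomorphism A B f \<longleftrightarrow>
     star_morphism A B f \<and> inj_on f (cs_carrier A) \<and>
     (\<forall>e. is_unit_of A e \<longrightarrow> is_unit_of B (f e))"


section \<open>Subspaces, subalgebras, ideals, quotients\<close>

definition norm_closure :: "'a cstar \<Rightarrow> 'a set \<Rightarrow> 'a set" where
  "norm_closure A S = {a \<in> cs_carrier A. \<forall>e>0. \<exists>s\<in>S. cs_norm A (a \<ominus>\<^bsub>A\<^esub> s) < e}"

definition linear_subspace :: "'a cstar \<Rightarrow> 'a set \<Rightarrow> bool" where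
  "linear_subspace A S \<longleftrightarrow> S \<subseteq> cs_carrier A \<and> \<zero>\<^bsub>A\<^esub> \<in> S \<and>
     (\<forall>a\<in>S. \<forall>b\<in>S. a \<oplus>\<^bsub>A\<^esub> b \<in> S) \<and> (\<forall>c. \<forall>a\<in>S. c \<odot>\<^bsub>A\<^esub> a \<in> S)"

definition linear_hull :: "'a cstar \<Rightarrow> 'a set \<Rightarrow> 'a set" where
  "linear_hull A G = \<Inter>{S. linear_subspace A S \<and> G \<subseteq> S}"

definition star_subalgebra :: "'a cstar \<Rightarrow> 'a set \<Rightarrow> bool" where
  "star_subalgebra A S \<longleftrightarrow> linear_subspace A S \<and>
     (\<forall>a\<in>S. \<forall>b\<in>S. a \<otimes>\<^bsub>A\<^esub> b \<in> S) \<and> (\<forall>a\<in>S. cs_star A a \<in> S)"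

definition generated_star_subalgebra :: "'a cstar \<Rightarrow> 'a set \<Rightarrow> 'a set" where
  "generated_star_subalgebra A G = \<Inter>{S. star_subalgebra A S \<and> G \<subseteq> S}"

definition closed_ideal :: "'a cstar \<Rightarrow> 'a set \<Rightarrow> bool" where
  "closed_ideal A I \<longleftrightarrow> linear_subspace A I \<and>
     (\<forall>i\<in>I. \<forall>a\<in>cs_carrier A. a \<otimes>\<^bsub>A\<^esub> i \<in> I \<and> i \<otimes>\<^bsub>A\<^esub> a \<in> I) \<and>
     norm_closure A I \<subseteq> I"

definition generated_closed_ideal :: "'a cstar \<Rightarrow> 'a set \<Rightarrow> 'a set" where
  "generated_closed_ideal A G = \<Inter>{I. closed_ideal A I \<and> G \<subseteq> I}"

definition cs_coset :: "'a cstar \<Rightarrow> 'a set \<Rightarrow> 'a \<Rightarrow> 'a set" where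
  "cs_coset A I a = {a \<oplus>\<^bsub>A\<^esub> i | i. i \<in> I}"

text \<open>The operations are written setwise; on cosets of a closed ideal they are the usual
  ones on representatives (\<open>coset_ops\<close> below), and the norm is the quotient norm.\<close>

definition cs_quotient :: "'a cstar \<Rightarrow> 'a set \<Rightarrow> 'a set cstar" where
  "cs_quotient A I = \<lparr>
     cs_carrier = cs_coset A I ` cs_carrier A,
     cs_zero = cs_coset A I \<zero>\<^bsub>A\<^esub>,
     cs_add = (\<lambda>P Q. {p \<oplus>\<^bsub>A\<^esub> q | p q. p \<in> P \<and> q \<in> Q}),
     cs_scale = (\<lambda>c P. {(c \<odot>\<^bsub>A\<^esub> p) \<oplus>\<^bsub>A\<^esub> i | p i. p \<in> P \<and> i \<in> I}),
     cs_mult = (\<lambda>P Q. {(p \<otimes>\<^bsub>A\<^esub> q) \<oplus>\<^bsub>A\<^esub> i | p q i. p \<in> P \<and> q \<in> Q \<and> i \<in> I}),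
     cs_star = (\<lambda>P. {cs_star A p \<oplus>\<^bsub>A\<^esub> i | p i. p \<in> P \<and> i \<in> I}),
     cs_norm = (\<lambda>P. Inf (cs_norm A ` P)) \<rparr>"

text \<open>The map of quotients \<open>A/I \<rightarrow> B/J\<close> induced by \<open>f : A \<rightarrow> B\<close> with \<open>f(I) \<subseteq> J\<close>;
  see \<open>induced_coset\<close> below for the equation that determines it.\<close>

definition induced_map :: "'b cstar \<Rightarrow> 'b set \<Rightarrow> ('a \<Rightarrow> 'b) \<Rightarrow> 'a set \<Rightarrow> 'b set" where
  "induced_map B J f P = {f p \<oplus>\<^bsub>B\<^esub> i | p i. p \<in> P \<and> i \<in> J}"


section \<open>Multiplier algebra\<close>

definition bounded_operator :: "'a cstar \<Rightarrow> ('a \<Rightarrow> 'a) \<Rightarrow> bool" where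
  "bounded_operator B L \<longleftrightarrow>
     L \<in> cs_carrier B \<rightarrow>\<^sub>E cs_carrier B \<and>
     (\<forall>a\<in>cs_carrier B. \<forall>b\<in>cs_carrier B. L (a \<oplus>\<^bsub>B\<^esub> b) = L a \<oplus>\<^bsub>B\<^esub> L b) \<and>
     (\<forall>a\<in>cs_carrier B. \<forall>c. L (c \<odot>\<^bsub>B\<^esub> a) = c \<odot>\<^bsub>B\<^esub> L a) \<and>
     (\<exists>c. \<forall>b\<in>cs_carrier B. cs_norm B (L b) \<le> c * cs_norm B b)"

text \<open>Double centralizers \<open>(L, R)\<close>: a multiplier \<open>m\<close> is encoded by \<open>L b = m b\<close>, \<open>R b = b m\<close>.\<close>

definition multiplier_algebra :: "'a cstar \<Rightarrow> (('a \<Rightarrow> 'a) \<times> ('a \<Rightarrow> 'a)) cstar" where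
  "multiplier_algebra B = (let C = cs_carrier B in \<lparr>
     cs_carrier = {(L, R). bounded_operator B L \<and> bounded_operator B R \<and>
        (\<forall>a\<in>C. \<forall>b\<in>C. L (a \<otimes>\<^bsub>B\<^esub> b) = L a \<otimes>\<^bsub>B\<^esub> b \<and>
                         R (a \<otimes>\<^bsub>B\<^esub> b) = a \<otimes>\<^bsub>B\<^esub> R b \<and>
                         R a \<otimes>\<^bsub>B\<^esub> b = a \<otimes>\<^bsub>B\<^esub> L b)},
     cs_zero = ((\<lambda>b\<in>C. \<zero>\<^bsub>B\<^esub>), (\<lambda>b\<in>C. \<zero>\<^bsub>B\<^esub>)),
     cs_add = (\<lambda>(L, R) (L', R'). ((\<lambda>b\<in>C. L b \<oplus>\<^bsub>B\<^esub> L' b), (\<lambda>b\<in>C. R b \<oplus>\<^bsub>B\<^esub> R' b))),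
     cs_scale = (\<lambda>c (L, R). ((\<lambda>b\<in>C. c \<odot>\<^bsub>B\<^esub> L b), (\<lambda>b\<in>C. c \<odot>\<^bsub>B\<^esub> R b))),
     cs_mult = (\<lambda>(L, R) (L', R'). ((\<lambda>b\<in>C. L (L' b)), (\<lambda>b\<in>C. R' (R b)))),
     cs_star = (\<lambda>(L, R). ((\<lambda>b\<in>C. cs_star B (R (cs_star B b))),
                          (\<lambda>b\<in>C. cs_star B (L (cs_star B b))))),
     cs_norm = (\<lambda>(L, R). Sup {cs_norm B (L b) | b. b \<in> C \<and> cs_norm B b \<le> 1}) \<rparr>)"

definition cs_centre :: "'a cstar \<Rightarrow> 'a cstar" where
  "cs_centre A = A\<lparr>cs_carrier :=
     {z \<in> cs_carrier A. \<forall>a\<in>cs_carrier A. z \<otimes>\<^bsub>A\<^esub> a = a \<otimes>\<^bsub>A\<^esub> z}\<rparr>"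


section \<open>\<open>C\<^sub>0(X)\<close>-algebras\<close>

text \<open>Functions take the value \<open>0\<close> outside the space. Hence, for \<open>U\<close> open in a locally compact
  Hausdorff space \<open>X\<close>, extension by zero from \<open>C\<^sub>0(U)\<close> to \<open>C\<^sub>0(X)\<close> is an inclusion.\<close>

definition C0_functions :: "'x topology \<Rightarrow> ('x \<Rightarrow> complex) set" where
  "C0_functions X = {f. continuous_map X euclidean f \<and>
     (\<forall>e>0. compactin X {x \<in> topspace X. e \<le> cmod (f x)}) \<and>
     (\<forall>x. x \<notin> topspace X \<longrightarrow> f x = 0)}"

abbreviation C0_on :: "'x topology \<Rightarrow> 'x set \<Rightarrow> ('x \<Rightarrow> complex) set" where
  "C0_on X U \<equiv> C0_functions (subtopology X U)"

definition C0_algebra :: "'x topology \<Rightarrow> ('x \<Rightarrow> complex) cstar" where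
  "C0_algebra X = \<lparr>
     cs_carrier = C0_functions X,
     cs_zero = (\<lambda>x. 0),
     cs_add = (\<lambda>f g x. f x + g x),
     cs_scale = (\<lambda>c f x. c * f x),
     cs_mult = (\<lambda>f g x. f x * g x),
     cs_star = (\<lambda>f x. cnj (f x)),
     cs_norm = (\<lambda>f. Sup (insert 0 ((\<lambda>x. cmod (f x)) ` topspace X))) \<rparr>"

type_synonym ('x, 'b) C0_structure = "('x \<Rightarrow> complex) \<Rightarrow> ('b \<Rightarrow> 'b) \<times> ('b \<Rightarrow> 'b)"

abbreviation C0_act :: "('x, 'b) C0_structure \<Rightarrow> ('x \<Rightarrow> complex) \<Rightarrow> 'b \<Rightarrow> 'b" where
  "C0_act \<theta> f b \<equiv> fst (\<theta> f) b"

definition is_C0_algebra ::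
    "'x topology \<Rightarrow> 'b cstar \<Rightarrow> ('x, 'b) C0_structure \<Rightarrow> bool" where
  "is_C0_algebra X B \<theta> \<longleftrightarrow>
     cstar_algebra B \<and>
     star_morphism (C0_algebra X) (cs_centre (multiplier_algebra B)) \<theta> \<and>
     norm_closure B (linear_hull B
       {C0_act \<theta> f b | f b. f \<in> C0_functions X \<and> b \<in> cs_carrier B}) = cs_carrier B"

definition C0_morphism ::
    "'x topology \<Rightarrow> 'a cstar \<Rightarrow> ('x, 'a) C0_structure \<Rightarrow> 'b cstar \<Rightarrow> ('x, 'b) C0_structure
      \<Rightarrow> ('a \<Rightarrow> 'b) \<Rightarrow> bool" where
  "C0_morphism X A \<theta> B \<theta>' \<eta> \<longleftrightarrow>
     star_morphism A B \<eta> \<and>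
     (\<forall>f\<in>C0_functions X. \<forall>a\<in>cs_carrier A. \<eta> (C0_act \<theta> f a) = C0_act \<theta>' f (\<eta> a))"

definition C0_ideal ::
    "'x topology \<Rightarrow> 'b cstar \<Rightarrow> ('x, 'b) C0_structure \<Rightarrow> 'x set \<Rightarrow> 'b set" where
  "C0_ideal X B \<theta> U =
     generated_closed_ideal B {C0_act \<theta> f v | f v. f \<in> C0_on X U \<and> v \<in> cs_carrier B}"

definition restriction_ideal ::
    "'x topology \<Rightarrow> 'b cstar \<Rightarrow> ('x, 'b) C0_structure \<Rightarrow> 'x set \<Rightarrow> 'b set" where
  "restriction_ideal X B \<theta> Y = C0_ideal X B \<theta> (topspace X - X closure_of Y)"

definition S_algebra ::
    "'x topology \<Rightarrow> 'b cstar \<Rightarrow> ('x, 'b) C0_structure \<Rightarrow> 'x set \<Rightarrow> 'b set cstar" where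
  "S_algebra X B \<theta> Y = cs_quotient B (restriction_ideal X B \<theta> Y)"

definition r_map ::
    "'x topology \<Rightarrow> 'b cstar \<Rightarrow> ('x, 'b) C0_structure \<Rightarrow> 'x set \<Rightarrow> 'b \<Rightarrow> 'b set" where
  "r_map X B \<theta> Y = cs_coset B (restriction_ideal X B \<theta> Y)"

text \<open>\<open>r\<^bsub>Y Y'\<^esub> : S\<^bsub>Y'\<^esub> B \<rightarrow> S\<^bsub>Y\<^esub> B\<close> for \<open>Y \<subseteq> Y'\<close>. As in the usual notation, the index of the
  domain does not occur on the right-hand side: the map adds the larger ideal to a coset.\<close>

definition r_restrict ::
    "'x topology \<Rightarrow> 'b cstar \<Rightarrow> ('x, 'b) C0_structure \<Rightarrow> 'x set \<Rightarrow> 'x set \<Rightarrow> 'b set \<Rightarrow> 'b set"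
    where
  "r_restrict X B \<theta> Y Y' = induced_map B (restriction_ideal X B \<theta> Y) (\<lambda>b. b)"

definition S_morphism ::
    "'x topology \<Rightarrow> 'b cstar \<Rightarrow> ('x, 'b) C0_structure \<Rightarrow> ('a \<Rightarrow> 'b) \<Rightarrow> 'x set
      \<Rightarrow> 'a set \<Rightarrow> 'b set" where
  "S_morphism X B \<theta> \<psi> Y = induced_map B (restriction_ideal X B \<theta> Y) \<psi>"


section \<open>Nets and their universal C*-algebras\<close>

definition cstar_net ::
    "'i::order set \<Rightarrow> ('i \<Rightarrow> 'a cstar) \<Rightarrow> ('i \<Rightarrow> 'i \<Rightarrow> 'a \<Rightarrow> 'a) \<Rightarrow> bool" where
  "cstar_net K A j \<longleftrightarrow>
     (\<forall>Y\<in>K. unital_cstar_algebra (A Y)) \<and>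
     (\<forall>Y\<in>K. \<forall>Y'\<in>K. Y \<le> Y' \<longrightarrow> unital_star_monomorphism (A Y) (A Y') (j Y' Y)) \<and>
     (\<forall>Y\<in>K. \<forall>Y'\<in>K. \<forall>Y''\<in>K. Y \<le> Y' \<longrightarrow> Y' \<le> Y'' \<longrightarrow>
        (\<forall>t\<in>cs_carrier (A Y). j Y'' Y' (j Y' Y t) = j Y'' Y t))"

definition net_morphism ::
    "'i::order set \<Rightarrow> ('i \<Rightarrow> 'a cstar) \<Rightarrow> ('i \<Rightarrow> 'i \<Rightarrow> 'a \<Rightarrow> 'a) \<Rightarrow> 'b cstar
      \<Rightarrow> ('i \<Rightarrow> 'a \<Rightarrow> 'b) \<Rightarrow> bool" where
  "net_morphism K A j B \<phi> \<longleftrightarrow>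
     (\<forall>Y\<in>K. star_morphism (A Y) B (\<phi> Y)) \<and>
     (\<forall>Y\<in>K. \<forall>Y'\<in>K. Y \<le> Y' \<longrightarrow> (\<forall>t\<in>cs_carrier (A Y). \<phi> Y' (j Y' Y t) = \<phi> Y t))"

text \<open>HOL cannot quantify over the carrier type of the target \<open>B\<close> inside a definition, so the
  universal property is required for all C*-algebras carried by subsets of one type that is
  large enough for all of them. Every element of the C*-subalgebra generated by the image of a
  net morphism is the limit of a sequence of finite sums of products of letters \<open>(i, a)\<close>, so
  this subalgebra can be transported to the right summand (see \<open>universal_factorization\<close>, which
  gives the factorization for a target on an arbitrary type). The left summand, the carrier type
  of \<open>U\<close> itself, makes \<open>U\<close> generated by the image of its canonical morphism
  (\<open>universal_generated\<close>); since *-morphisms of C*-algebras are continuous, the factorization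
  is then unique for targets on an arbitrary type, too.\<close>

type_synonym ('u, 'i, 'a) test_carrier = "'u + (nat \<Rightarrow> ('i \<times> 'a) list list)"

definition is_universal_algebra ::
    "'i::order set \<Rightarrow> ('i \<Rightarrow> 'a cstar) \<Rightarrow> ('i \<Rightarrow> 'i \<Rightarrow> 'a \<Rightarrow> 'a) \<Rightarrow> 'u cstar
      \<Rightarrow> ('i \<Rightarrow> 'a \<Rightarrow> 'u) \<Rightarrow> bool" where
  "is_universal_algebra K A j U \<epsilon> \<longleftrightarrow>
     cstar_algebra U \<and> net_morphism K A j U \<epsilon> \<and>
     (\<forall>(B :: ('u, 'i, 'a) test_carrier cstar) \<phi>.
        cstar_algebra B \<and> net_morphism K A j B \<phi> \<longrightarrow>
        (\<exists>!\<psi>. \<psi> \<in> extensional (cs_carrier U) \<and> star_morphism U B \<psi> \<and>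
               (\<forall>Y\<in>K. \<forall>t\<in>cs_carrier (A Y). \<phi> Y t = \<psi> (\<epsilon> Y t))))"


section \<open>The \<open>C\<^sub>0(X)\<close>-algebra of a net\<close>

definition bounded_fields :: "'x set \<Rightarrow> ('x \<Rightarrow> 'u cstar) \<Rightarrow> ('x \<Rightarrow> 'u) cstar" where
  "bounded_fields S F = \<lparr>
     cs_carrier = {a \<in> (\<Pi>\<^sub>E x\<in>S. cs_carrier (F x)). \<exists>c. \<forall>x\<in>S. cs_norm (F x) (a x) \<le> c},
     cs_zero = (\<lambda>x\<in>S. \<zero>\<^bsub>F x\<^esub>),
     cs_add = (\<lambda>a b. \<lambda>x\<in>S. a x \<oplus>\<^bsub>F x\<^esub> b x),
     cs_scale = (\<lambda>c a. \<lambda>x\<in>S. c \<odot>\<^bsub>F x\<^esub> a x),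
     cs_mult = (\<lambda>a b. \<lambda>x\<in>S. a x \<otimes>\<^bsub>F x\<^esub> b x),
     cs_star = (\<lambda>a. \<lambda>x\<in>S. cs_star (F x) (a x)),
     cs_norm = (\<lambda>a. Sup (insert 0 ((\<lambda>x. cs_norm (F x) (a x)) ` S))) \<rparr>"

definition field_mult ::
    "'x topology \<Rightarrow> ('x \<Rightarrow> 'u cstar) \<Rightarrow> ('x \<Rightarrow> complex) \<Rightarrow> ('x \<Rightarrow> 'u) \<Rightarrow> 'x \<Rightarrow> 'u" where
  "field_mult X F f a = (\<lambda>x\<in>topspace X. f x \<odot>\<^bsub>F x\<^esub> a x)"

definition eps_hat ::
    "'x topology \<Rightarrow> ('x \<Rightarrow> 'u cstar) \<Rightarrow> ('x \<Rightarrow> 'x set \<Rightarrow> 'a \<Rightarrow> 'u) \<Rightarrow> 'x set \<Rightarrow> 'a \<Rightarrow> 'x \<Rightarrow> 'u"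
    where
  "eps_hat X F \<epsilon> Y t = (\<lambda>x\<in>topspace X. if x \<in> Y then \<epsilon> x Y t else \<zero>\<^bsub>F x\<^esub>)"

definition fibre_index :: "'x set set \<Rightarrow> 'x \<Rightarrow> 'x set set" where
  "fibre_index K x = {Y \<in> K. x \<in> Y}"

definition net_C0_algebra ::
    "'x topology \<Rightarrow> 'x set set \<Rightarrow> ('x set \<Rightarrow> 'a cstar) \<Rightarrow> ('x \<Rightarrow> 'u cstar)
      \<Rightarrow> ('x \<Rightarrow> 'x set \<Rightarrow> 'a \<Rightarrow> 'u) \<Rightarrow> ('x \<Rightarrow> 'u) cstar" where
  "net_C0_algebra X K A F \<epsilon> = (let P = bounded_fields (topspace X) F in
     P\<lparr>cs_carrier := norm_closure P (generated_star_subalgebra P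
        {field_mult X F f (eps_hat X F \<epsilon> Y t) | Y f t.
           Y \<in> K \<and> f \<in> C0_on X Y \<and> t \<in> cs_carrier (A Y)})\<rparr>)"

definition net_C0_structure ::
    "'x topology \<Rightarrow> 'x set set \<Rightarrow> ('x set \<Rightarrow> 'a cstar) \<Rightarrow> ('x \<Rightarrow> 'u cstar)
      \<Rightarrow> ('x \<Rightarrow> 'x set \<Rightarrow> 'a \<Rightarrow> 'u) \<Rightarrow> ('x, 'x \<Rightarrow> 'u) C0_structure" where
  "net_C0_structure X K A F \<epsilon> f =
     (restrict (field_mult X F f) (cs_carrier (net_C0_algebra X K A F \<epsilon>)),
      restrict (field_mult X F f) (cs_carrier (net_C0_algebra X K A F \<epsilon>)))"


section \<open>Heteromorphisms\<close>

definition heteromorphism ::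
    "'x topology \<Rightarrow> 'x set set \<Rightarrow> ('x set \<Rightarrow> 'a cstar) \<Rightarrow> ('x set \<Rightarrow> 'x set \<Rightarrow> 'a \<Rightarrow> 'a)
      \<Rightarrow> 'b cstar \<Rightarrow> ('x, 'b) C0_structure \<Rightarrow> ('x set \<Rightarrow> 'a \<Rightarrow> 'b set) \<Rightarrow> bool" where
  "heteromorphism X K A j B \<theta> \<phi> \<longleftrightarrow>
     (\<forall>Y\<in>K. star_morphism (A Y) (S_algebra X B \<theta> Y) (\<phi> Y)) \<and>
     (\<forall>Y\<in>K. \<forall>Y'\<in>K. Y \<subseteq> Y' \<longrightarrow>
        (\<forall>t\<in>cs_carrier (A Y). r_restrict X B \<theta> Y Y' (\<phi> Y' (j Y' Y t)) = \<phi> Y t))"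

text \<open>\<open>\<tau>\<close> is given by the defining formula of the canonical heteromorphism, for some admissible
  \<open>U\<close> and \<open>g\<close> for each \<open>Y\<close>; in particular such a \<open>U\<close> exists in \<open>K\<close>. Since nothing is assumed about
  the choice, a statement about all such \<open>\<tau>\<close> covers every choice.\<close>

definition canonical_heteromorphism ::
    "'x topology \<Rightarrow> 'x set set \<Rightarrow> ('x set \<Rightarrow> 'a cstar) \<Rightarrow> ('x set \<Rightarrow> 'x set \<Rightarrow> 'a \<Rightarrow> 'a)
      \<Rightarrow> ('x \<Rightarrow> 'u cstar) \<Rightarrow> ('x \<Rightarrow> 'x set \<Rightarrow> 'a \<Rightarrow> 'u)
      \<Rightarrow> ('x set \<Rightarrow> 'a \<Rightarrow> ('x \<Rightarrow> 'u) set) \<Rightarrow> bool" where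
  "canonical_heteromorphism X K A j F \<epsilon> \<tau> \<longleftrightarrow>
     (\<forall>Y\<in>K. \<exists>U\<in>K. \<exists>g\<in>C0_on X U. X closure_of Y \<subseteq> U \<and> (\<forall>x\<in>Y. g x = 1) \<and>
        (\<forall>t\<in>cs_carrier (A Y).
           \<tau> Y t = r_map X (net_C0_algebra X K A F \<epsilon>) (net_C0_structure X K A F \<epsilon>) Y
                     (field_mult X F g (eps_hat X F \<epsilon> U (j U Y t)))))"

section \<open>Adequacy of the definitions\<close>


context cstar_algebra
begin

lemma neg_closed: "a \<in> cs_carrier A \<Longrightarrow> (-1) \<odot> a \<in> cs_carrier A"
  by (rule scale_closed)

lemma diff_closed: "\<lbrakk>a \<in> cs_carrier A; b \<in> cs_carrier A\<rbrakk> \<Longrightarrow> a \<ominus> b \<in> cs_carrier A"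
  by (simp add: cs_diff_def add_closed scale_closed)

lemmas closed = zero_closed add_closed scale_closed mult_closed star_closed diff_closed

lemma add_left_commute:
  "\<lbrakk>a \<in> cs_carrier A; b \<in> cs_carrier A; d \<in> cs_carrier A\<rbrakk> \<Longrightarrow> a \<oplus> (b \<oplus> d) = b \<oplus> (a \<oplus> d)"
  by (metis add_assoc add_commute)

lemmas add_ac = add_assoc add_commute add_left_commute

lemma zero_add: "a \<in> cs_carrier A \<Longrightarrow> \<zero> \<oplus> a = a"
  by (metis add_commute add_zero zero_closed)

lemma add_cancel:
  "\<lbrakk>a \<in> cs_carrier A; b \<in> cs_carrier A; d \<in> cs_carrier A; a \<oplus> b = a \<oplus> d\<rbrakk> \<Longrightarrow> b = d"
  by (metis add_assoc add_commute add_minus add_zero neg_closed)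

lemma scale_zero_left: "a \<in> cs_carrier A \<Longrightarrow> 0 \<odot> a = \<zero>"
  by (metis add.right_inverse add_minus scale_add_left scale_one)

lemma scale_zero_right: "c \<odot> \<zero> = \<zero>"
  by (metis mult_zero_right scale_scale scale_zero_left zero_closed)

lemma mult_zero_l: "a \<in> cs_carrier A \<Longrightarrow> \<zero> \<otimes> a = \<zero>"
  by (metis mult_scale_left mult_closed scale_zero_left zero_closed)

lemma mult_zero_r: "a \<in> cs_carrier A \<Longrightarrow> a \<otimes> \<zero> = \<zero>"
  by (metis mult_scale_right mult_closed scale_zero_left zero_closed)

lemma star_zero: "cs_star A \<zero> = \<zero>"
  by (metis complex_cnj_zero scale_zero_left star_closed star_scale zero_closed)

lemma norm_zero: "cs_norm A \<zero> = 0"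
  using norm_eq_zero zero_closed by blast

lemma norm_neg: "a \<in> cs_carrier A \<Longrightarrow> cs_norm A ((-1) \<odot> a) = cs_norm A a"
  by (simp add: norm_scale)

lemma norm_nonneg: "a \<in> cs_carrier A \<Longrightarrow> 0 \<le> cs_norm A a"
proof -
  assume a: "a \<in> cs_carrier A"
  have "cs_norm A (a \<oplus> ((-1) \<odot> a)) \<le> cs_norm A a + cs_norm A ((-1) \<odot> a)"
    by (rule norm_triangle[OF a neg_closed[OF a]])
  then show ?thesis using a by (simp add: add_minus norm_zero norm_neg)
qed

lemma norm_star: "a \<in> cs_carrier A \<Longrightarrow> cs_norm A (cs_star A a) = cs_norm A a"
proof -
  have le: "cs_norm A b \<le> cs_norm A (cs_star A b)" if b: "b \<in> cs_carrier A" for b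
  proof (cases "cs_norm A b = 0")
    case True
    then show ?thesis using norm_nonneg[OF star_closed[OF b]] by simp
  next
    case False
    then have pos: "cs_norm A b > 0" using norm_nonneg[OF b] by simp
    have "(cs_norm A b)\<^sup>2 \<le> cs_norm A (cs_star A b) * cs_norm A b"
      using norm_mult[OF star_closed[OF b] b] norm_cstar[OF b] by simp
    then show ?thesis using pos by (simp add: power2_eq_square)
  qed
  assume "a \<in> cs_carrier A"
  then show ?thesis using le[of a] le[OF star_closed[of a]] by (simp add: star_star)
qed

lemma add_diff_add:
  assumes "a \<in> cs_carrier A" "b \<in> cs_carrier A" "c \<in> cs_carrier A" "d \<in> cs_carrier A"
  shows "(a \<oplus> b) \<ominus> (c \<oplus> d) = (a \<ominus> c) \<oplus> (b \<ominus> d)"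
  using assms by (simp add: cs_diff_def scale_add_right add_ac closed)

lemma diff_trans:
  assumes "a \<in> cs_carrier A" "b \<in> cs_carrier A" "c \<in> cs_carrier A"
  shows "(a \<ominus> b) \<oplus> (b \<ominus> c) = a \<ominus> c"
proof -
  have "(a \<ominus> b) \<oplus> (b \<ominus> c) = (a \<oplus> (b \<oplus> (-1) \<odot> b)) \<oplus> (-1) \<odot> c"
    using assms by (simp add: cs_diff_def add_ac closed)
  then show ?thesis using assms by (simp add: add_minus add_zero cs_diff_def)
qed

lemma diff_swap:
  assumes "a \<in> cs_carrier A" "b \<in> cs_carrier A"
  shows "a \<ominus> b = (-1) \<odot> (b \<ominus> a)"
  using assms by (simp add: cs_diff_def scale_add_right scale_scale scale_one closed add_commute)

lemma diff_self: "a \<in> cs_carrier A \<Longrightarrow> a \<ominus> a = \<zero>"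
  by (simp add: cs_diff_def add_minus)

lemma diff_eq_zero: "\<lbrakk>a \<in> cs_carrier A; b \<in> cs_carrier A; a \<ominus> b = \<zero>\<rbrakk> \<Longrightarrow> a = b"
  by (metis add_cancel add_commute add_minus cs_diff_def neg_closed)

lemma diff_add_cancel:
  assumes "a \<in> cs_carrier A" "b \<in> cs_carrier A"
  shows "(a \<ominus> b) \<oplus> b = a"
proof -
  have "((-1) \<odot> b) \<oplus> b = \<zero>"
    using assms add_commute[of "(-1) \<odot> b" b] by (simp add: add_minus closed)
  then show ?thesis using assms by (simp add: cs_diff_def add_assoc closed add_zero)
qed

lemma norm_diff_commute:
  assumes "a \<in> cs_carrier A" "b \<in> cs_carrier A"
  shows "cs_norm A (a \<ominus> b) = cs_norm A (b \<ominus> a)"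
  by (metis assms diff_closed diff_swap norm_neg)

lemma norm_diff_triangle:
  assumes "a \<in> cs_carrier A" "b \<in> cs_carrier A" "c \<in> cs_carrier A"
  shows "cs_norm A (a \<ominus> c) \<le> cs_norm A (a \<ominus> b) + cs_norm A (b \<ominus> c)"
  by (metis assms diff_closed diff_trans norm_triangle)

lemma mult_diff:
  assumes "a \<in> cs_carrier A" "b \<in> cs_carrier A" "c \<in> cs_carrier A" "d \<in> cs_carrier A"
  shows "(a \<otimes> b) \<ominus> (c \<otimes> d) = (a \<otimes> (b \<ominus> d)) \<oplus> ((a \<ominus> c) \<otimes> d)"
proof -
  have "a \<otimes> (b \<ominus> d) = (a \<otimes> b) \<ominus> (a \<otimes> d)" "(a \<ominus> c) \<otimes> d = (a \<otimes> d) \<ominus> (c \<otimes> d)"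
    using assms by (simp_all add: cs_diff_def mult_add_right mult_add_left mult_scale_left
        mult_scale_right closed)
  then show ?thesis using assms by (simp add: diff_trans closed)
qed

lemma limit_unique:
  assumes "\<And>n. s n \<in> cs_carrier A" "l \<in> cs_carrier A" "l' \<in> cs_carrier A"
    and "(\<lambda>n. cs_norm A (s n \<ominus> l)) \<longlonglongrightarrow> 0" "(\<lambda>n. cs_norm A (s n \<ominus> l')) \<longlonglongrightarrow> 0"
  shows "l = l'"
proof -
  have "cs_norm A (l \<ominus> l') \<le> cs_norm A (s n \<ominus> l) + cs_norm A (s n \<ominus> l')" for n
    using norm_diff_triangle[of l "s n" l'] norm_diff_commute[of "s n" l] assms by simp
  moreover have "(\<lambda>n. cs_norm A (s n \<ominus> l) + cs_norm A (s n \<ominus> l')) \<longlonglongrightarrow> 0"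
    using tendsto_add[OF assms(4,5)] by simp
  ultimately have "cs_norm A (l \<ominus> l') \<le> 0"
    by (meson LIMSEQ_le_const)
  then show ?thesis
    using diff_eq_zero[OF assms(2,3)] norm_eq_zero[OF diff_closed[OF assms(2,3)]]
      norm_nonneg[OF diff_closed[OF assms(2,3)]] by simp
qed

lemma closure_memD:
  assumes "a \<in> norm_closure A S" "S \<subseteq> cs_carrier A"
  obtains s where "\<And>n::nat. s n \<in> S" "(\<lambda>n. cs_norm A (s n \<ominus> a)) \<longlonglongrightarrow> 0"
proof -
  have "\<exists>t\<in>S. cs_norm A (a \<ominus> t) < inverse (real (Suc n))" for n
    using assms(1) unfolding norm_closure_def by simp
  then obtain s where s: "\<And>n. s n \<in> S" "\<And>n. cs_norm A (a \<ominus> s n) < inverse (real (Suc n))"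
    by metis
  have a: "a \<in> cs_carrier A" using assms(1) by (simp add: norm_closure_def)
  have "(\<lambda>n. cs_norm A (s n \<ominus> a)) \<longlonglongrightarrow> 0"
  proof (rule tendsto_sandwich[OF _ _ tendsto_const LIMSEQ_inverse_real_of_nat])
    show "\<forall>\<^sub>F n in sequentially. 0 \<le> cs_norm A (s n \<ominus> a)"
      using s(1) a assms(2) by (auto intro!: always_eventually norm_nonneg diff_closed)
    show "\<forall>\<^sub>F n in sequentially. cs_norm A (s n \<ominus> a) \<le> inverse (real (Suc n))"
    proof (intro always_eventually allI)
      fix n
      have "s n \<in> cs_carrier A" using s(1) assms(2) by blast
      then show "cs_norm A (s n \<ominus> a) \<le> inverse (real (Suc n))"
        using s(2)[of n] norm_diff_commute[of "s n" a] a by simp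
    qed
  qed
  then show ?thesis using s(1) that by blast
qed

lemma closure_memI:
  assumes "\<And>n::nat. s n \<in> S" "(\<lambda>n. cs_norm A (s n \<ominus> a)) \<longlonglongrightarrow> 0"
    "a \<in> cs_carrier A" "S \<subseteq> cs_carrier A"
  shows "a \<in> norm_closure A S"
proof -
  have "\<exists>t\<in>S. cs_norm A (a \<ominus> t) < e" if "e > 0" for e
  proof -
    have "\<forall>\<^sub>F n in sequentially. cs_norm A (s n \<ominus> a) < e"
      using order_tendstoD(2)[OF assms(2) that] .
    then obtain n where "cs_norm A (s n \<ominus> a) < e"
      using eventually_sequentially by auto
    moreover have "s n \<in> cs_carrier A" using assms(1,4) by blast
    ultimately show ?thesis using assms(1)[of n] norm_diff_commute[of "s n" a] assms(3) by auto
  qed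
  then show ?thesis using assms(3) by (simp add: norm_closure_def)
qed

lemma subset_closure: "S \<subseteq> cs_carrier A \<Longrightarrow> S \<subseteq> norm_closure A S"
proof
  fix a assume S: "S \<subseteq> cs_carrier A" and a: "a \<in> S"
  then have "a \<ominus> a = \<zero>" by (auto intro: diff_self)
  then have "\<exists>s\<in>S. cs_norm A (a \<ominus> s) < e" if "e > 0" for e
    using a that by (intro bexI[of _ a]) (simp_all add: norm_zero)
  then show "a \<in> norm_closure A S" using S a by (auto simp: norm_closure_def)
qed

lemma closure_closure:
  assumes "S \<subseteq> cs_carrier A"
  shows "norm_closure A (norm_closure A S) \<subseteq> norm_closure A S"
proof
  fix a assume a: "a \<in> norm_closure A (norm_closure A S)"
  have "\<exists>t\<in>S. cs_norm A (a \<ominus> t) < e" if e: "e > 0" for e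
  proof -
    have aA: "a \<in> cs_carrier A" using a by (simp add: norm_closure_def)
    obtain b where b: "b \<in> norm_closure A S" "cs_norm A (a \<ominus> b) < e/2"
      using a e unfolding norm_closure_def by (smt (verit) half_gt_zero mem_Collect_eq)
    then obtain t where t: "t \<in> S" "cs_norm A (b \<ominus> t) < e/2"
      using e unfolding norm_closure_def by (smt (verit) half_gt_zero mem_Collect_eq)
    have "cs_norm A (a \<ominus> t) \<le> cs_norm A (a \<ominus> b) + cs_norm A (b \<ominus> t)"
      using norm_diff_triangle aA b t assms by (auto simp: norm_closure_def)
    then show ?thesis using b t by (intro bexI[of _ t]) auto
  qed
  then show "a \<in> norm_closure A S" using a by (simp add: norm_closure_def)
qed

lemma star_subalgebra_closure:
  assumes S: "star_subalgebra A S"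
  shows "star_subalgebra A (norm_closure A S)"
proof -
  have sub: "S \<subseteq> cs_carrier A" and S0: "\<zero> \<in> S"
    and ops: "\<And>a b. a \<in> S \<Longrightarrow> b \<in> S \<Longrightarrow> a \<oplus> b \<in> S" "\<And>c a. a \<in> S \<Longrightarrow> c \<odot> a \<in> S"
      "\<And>a b. a \<in> S \<Longrightarrow> b \<in> S \<Longrightarrow> a \<otimes> b \<in> S" "\<And>a. a \<in> S \<Longrightarrow> cs_star A a \<in> S"
    using S by (auto simp: star_subalgebra_def linear_subspace_def)
  note sq = tendsto_sandwich[OF _ _ tendsto_const]
  have cl: "a \<in> cs_carrier A" if "a \<in> norm_closure A S" for a
    using that by (simp add: norm_closure_def)
  have add: "a \<oplus> b \<in> norm_closure A S" if ab: "a \<in> norm_closure A S" "b \<in> norm_closure A S" for a b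
  proof -
    obtain s where s: "\<And>n::nat. s n \<in> S" "(\<lambda>n. cs_norm A (s n \<ominus> a)) \<longlonglongrightarrow> 0"
      using closure_memD[OF ab(1) sub] by blast
    obtain t where t: "\<And>n::nat. t n \<in> S" "(\<lambda>n. cs_norm A (t n \<ominus> b)) \<longlonglongrightarrow> 0"
      using closure_memD[OF ab(2) sub] by blast
    have le: "cs_norm A ((s n \<oplus> t n) \<ominus> (a \<oplus> b)) \<le> cs_norm A (s n \<ominus> a) + cs_norm A (t n \<ominus> b)" for n
      using s(1)[of n] t(1)[of n] sub cl[OF ab(1)] cl[OF ab(2)]
      by (subst add_diff_add) (auto intro!: norm_triangle diff_closed)
    have "(\<lambda>n. cs_norm A ((s n \<oplus> t n) \<ominus> (a \<oplus> b))) \<longlonglongrightarrow> 0"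
    proof (rule sq)
      show "(\<lambda>n. cs_norm A (s n \<ominus> a) + cs_norm A (t n \<ominus> b)) \<longlonglongrightarrow> 0"
        using tendsto_add[OF s(2) t(2)] by simp
      show "\<forall>\<^sub>F n in sequentially. 0 \<le> cs_norm A ((s n \<oplus> t n) \<ominus> (a \<oplus> b))"
        using s(1) t(1) sub cl ab by (intro always_eventually allI norm_nonneg closed) auto
    qed (use le in auto)
    then show ?thesis
      using s(1) t(1) ops(1) ab cl sub by (intro closure_memI[of "\<lambda>n. s n \<oplus> t n"]) (auto intro: closed)
  qed
  have scale: "c \<odot> a \<in> norm_closure A S" if a: "a \<in> norm_closure A S" for a c
  proof -
    obtain s where s: "\<And>n::nat. s n \<in> S" "(\<lambda>n. cs_norm A (s n \<ominus> a)) \<longlonglongrightarrow> 0"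
      using closure_memD[OF a sub] by blast
    have "(c \<odot> s n) \<ominus> (c \<odot> a) = c \<odot> (s n \<ominus> a)" for n
      using s(1)[of n] sub cl[OF a] by (auto simp: cs_diff_def scale_add_right scale_scale closed subset_iff)
    then have "cs_norm A ((c \<odot> s n) \<ominus> (c \<odot> a)) = cmod c * cs_norm A (s n \<ominus> a)" for n
      using s(1)[of n] sub cl[OF a] by (auto intro!: norm_scale diff_closed)
    then have "(\<lambda>n. cs_norm A ((c \<odot> s n) \<ominus> (c \<odot> a))) \<longlonglongrightarrow> 0"
      using tendsto_mult_right_zero[OF s(2)] by simp
    then show ?thesis
      using s(1) ops(2) a cl sub by (intro closure_memI[of "\<lambda>n. c \<odot> s n"]) (auto intro: closed)
  qed
  have star: "cs_star A a \<in> norm_closure A S" if a: "a \<in> norm_closure A S" for a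
  proof -
    obtain s where s: "\<And>n::nat. s n \<in> S" "(\<lambda>n. cs_norm A (s n \<ominus> a)) \<longlonglongrightarrow> 0"
      using closure_memD[OF a sub] by blast
    have "cs_star A (s n) \<ominus> cs_star A a = cs_star A (s n \<ominus> a)" for n
      using s(1)[of n] sub cl[OF a] by (auto simp: cs_diff_def star_add star_scale closed subset_iff)
    then have "cs_norm A (cs_star A (s n) \<ominus> cs_star A a) = cs_norm A (s n \<ominus> a)" for n
      using s(1)[of n] sub cl[OF a] by (auto intro!: norm_star diff_closed)
    then have "(\<lambda>n. cs_norm A (cs_star A (s n) \<ominus> cs_star A a)) \<longlonglongrightarrow> 0"
      using s(2) by simp
    then show ?thesis
      using s(1) ops(4) a cl sub by (intro closure_memI[of "\<lambda>n. cs_star A (s n)"]) (auto intro: closed)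
  qed
  have mult: "a \<otimes> b \<in> norm_closure A S" if ab: "a \<in> norm_closure A S" "b \<in> norm_closure A S" for a b
  proof -
    obtain s where s: "\<And>n::nat. s n \<in> S" "(\<lambda>n. cs_norm A (s n \<ominus> a)) \<longlonglongrightarrow> 0"
      using closure_memD[OF ab(1) sub] by blast
    obtain t where t: "\<And>n::nat. t n \<in> S" "(\<lambda>n. cs_norm A (t n \<ominus> b)) \<longlonglongrightarrow> 0"
      using closure_memD[OF ab(2) sub] by blast
    let ?u = "\<lambda>n. (cs_norm A (s n \<ominus> a) + cs_norm A a) * cs_norm A (t n \<ominus> b)
                 + cs_norm A (s n \<ominus> a) * cs_norm A b"
    have le: "cs_norm A ((s n \<otimes> t n) \<ominus> (a \<otimes> b)) \<le> ?u n" for n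
    proof -
      have c: "s n \<in> cs_carrier A" "t n \<in> cs_carrier A" "a \<in> cs_carrier A" "b \<in> cs_carrier A"
        using s(1) t(1) sub cl ab by auto
      have "s n = (s n \<ominus> a) \<oplus> a"
        using c by (simp add: diff_add_cancel)
      then have sn: "cs_norm A (s n) \<le> cs_norm A (s n \<ominus> a) + cs_norm A a"
        using norm_triangle[OF diff_closed[OF c(1,3)] c(3)] by simp
      have "cs_norm A ((s n \<otimes> t n) \<ominus> (a \<otimes> b))
            \<le> cs_norm A (s n \<otimes> (t n \<ominus> b)) + cs_norm A ((s n \<ominus> a) \<otimes> b)"
        using c by (simp add: mult_diff norm_triangle closed)
      also have "\<dots> \<le> cs_norm A (s n) * cs_norm A (t n \<ominus> b) + cs_norm A (s n \<ominus> a) * cs_norm A b"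
        using c by (intro add_mono norm_mult closed)
      also have "\<dots> \<le> ?u n"
        using c sn by (intro add_mono mult_right_mono norm_nonneg closed) auto
      finally show ?thesis .
    qed
    have "?u \<longlonglongrightarrow> (0 + cs_norm A a) * 0 + 0 * cs_norm A b"
      using s(2) t(2) by (intro tendsto_intros)
    then have u: "?u \<longlonglongrightarrow> 0" by simp
    have "(\<lambda>n. cs_norm A ((s n \<otimes> t n) \<ominus> (a \<otimes> b))) \<longlonglongrightarrow> 0"
    proof (rule sq[OF _ _ u])
      show "\<forall>\<^sub>F n in sequentially. 0 \<le> cs_norm A ((s n \<otimes> t n) \<ominus> (a \<otimes> b))"
        using s(1) t(1) sub cl ab by (intro always_eventually allI norm_nonneg closed) auto
    qed (use le in auto)
    then show ?thesis
      using s(1) t(1) ops(3) ab cl sub by (intro closure_memI[of "\<lambda>n. s n \<otimes> t n"]) (auto intro: closed)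
  qed
  have "\<zero> \<in> norm_closure A S" using subset_closure[OF sub] S0 by blast
  then show ?thesis
    using add scale star mult cl by (auto simp: star_subalgebra_def linear_subspace_def)
qed

lemma subalgebra_cstar:
  assumes S: "star_subalgebra A S" and cl: "norm_closure A S \<subseteq> S"
  shows "cstar_algebra (A\<lparr>cs_carrier := S\<rparr>)"
proof -
  let ?B = "A\<lparr>cs_carrier := S\<rparr>"
  have sub: "S \<subseteq> cs_carrier A" and S0: "\<zero> \<in> S"
    and ops: "\<And>a b. a \<in> S \<Longrightarrow> b \<in> S \<Longrightarrow> a \<oplus> b \<in> S" "\<And>c a. a \<in> S \<Longrightarrow> c \<odot> a \<in> S"
      "\<And>a b. a \<in> S \<Longrightarrow> b \<in> S \<Longrightarrow> a \<otimes> b \<in> S" "\<And>a. a \<in> S \<Longrightarrow> cs_star A a \<in> S"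
    using S by (auto simp: star_subalgebra_def linear_subspace_def)
  have d: "cs_diff ?B = cs_diff A" by (auto simp: cs_diff_def fun_eq_iff)
  have compl: "\<exists>l\<in>S. (\<lambda>n. cs_norm A (s n \<ominus> l)) \<longlonglongrightarrow> 0"
    if "\<And>n::nat. s n \<in> S" "\<And>e. e > 0 \<Longrightarrow> \<exists>N. \<forall>m\<ge>N. \<forall>n\<ge>N. cs_norm A (s m \<ominus> s n) < e" for s
    using complete[of s] that sub closure_memI[of s S] cl by (metis subsetD)
  have sub': "a \<in> cs_carrier A" if "a \<in> S" for a using sub that by blast
  show ?thesis
  proof (unfold_locales, goal_cases)
    case (28 s)
    then show ?case using compl[of s] by (simp add: d)
  qed (simp_all add: S0 ops sub' add_ac add_zero add_minus scale_add_right scale_add_left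
        scale_scale scale_one mult_assoc mult_add_left mult_add_right mult_scale_left
        mult_scale_right star_star star_add star_scale star_mult norm_eq_zero norm_triangle
        norm_scale norm_mult norm_cstar)
qed

end

definition transport :: "('a \<Rightarrow> 'b) \<Rightarrow> 'a cstar \<Rightarrow> 'b cstar" where
  "transport h A = (let g = inv_into (cs_carrier A) h in \<lparr>
     cs_carrier = h ` cs_carrier A,
     cs_zero = h \<zero>\<^bsub>A\<^esub>,
     cs_add = (\<lambda>a b. h (g a \<oplus>\<^bsub>A\<^esub> g b)),
     cs_scale = (\<lambda>c a. h (c \<odot>\<^bsub>A\<^esub> g a)),
     cs_mult = (\<lambda>a b. h (g a \<otimes>\<^bsub>A\<^esub> g b)),
     cs_star = (\<lambda>a. h (cs_star A (g a))),
     cs_norm = (\<lambda>a. cs_norm A (g a)) \<rparr>)"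

lemma (in cstar_algebra) transport_cstar:
  assumes h: "inj_on h (cs_carrier A)"
  shows "cstar_algebra (transport h A)"
    and "star_morphism A (transport h A) h"
    and "star_morphism (transport h A) A (inv_into (cs_carrier A) h)"
proof -
  let ?T = "transport h A" and ?g = "inv_into (cs_carrier A) h"
  have g: "?g (h a) = a" if "a \<in> cs_carrier A" for a using h that by simp
  have gc: "?g b \<in> cs_carrier A" if "b \<in> cs_carrier ?T" for b
    using that by (auto simp: transport_def Let_def g)
  have hd: "cs_diff ?T (h a) (h b) = h (a \<ominus> b)" if "a \<in> cs_carrier A" "b \<in> cs_carrier A" for a b
    using that by (simp add: cs_diff_def transport_def Let_def g closed)
  have compl: "\<exists>l\<in>cs_carrier ?T. (\<lambda>n. cs_norm ?T (cs_diff ?T (s n) l)) \<longlonglongrightarrow> 0"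
    if s: "\<And>n::nat. s n \<in> cs_carrier ?T"
      and C: "\<And>e. e > 0 \<Longrightarrow> \<exists>N. \<forall>m\<ge>N. \<forall>n\<ge>N. cs_norm ?T (cs_diff ?T (s m) (s n)) < e" for s
  proof -
    have "\<forall>n. \<exists>a. a \<in> cs_carrier A \<and> s n = h a" using s by (auto simp: transport_def Let_def)
    then obtain t where t: "\<And>n. t n \<in> cs_carrier A" "\<And>n. s n = h (t n)" by metis
    have nrm: "cs_norm ?T (h a) = cs_norm A a" if "a \<in> cs_carrier A" for a
      using that by (simp add: transport_def Let_def g)
    have C': "\<exists>N. \<forall>m\<ge>N. \<forall>n\<ge>N. cs_norm A (t m \<ominus> t n) < e" if "e > 0" for e
      using C[OF that] by (simp add: t hd nrm closed)
    obtain l where l: "l \<in> cs_carrier A" "(\<lambda>n. cs_norm A (t n \<ominus> l)) \<longlonglongrightarrow> 0"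
      using complete[OF t(1) C'] by blast
    then show ?thesis
      by (intro bexI[of _ "h l"]) (simp_all add: t hd nrm closed, simp add: transport_def Let_def)
  qed
  show "cstar_algebra ?T"
  proof (unfold_locales, goal_cases)
    case (28 s)
    then show ?case by (rule compl)
  next
    case (23 a)
    then show ?case
      by (auto simp: transport_def Let_def g zero_closed norm_eq_zero)
  qed (auto simp: transport_def Let_def g closed add_ac add_zero add_minus
        scale_add_right scale_add_left scale_scale scale_one mult_assoc mult_add_left
        mult_add_right mult_scale_left mult_scale_right star_star star_add star_scale star_mult
        norm_triangle norm_scale norm_mult norm_cstar)
  show "star_morphism A ?T h" "star_morphism ?T A ?g"
    by (auto simp: star_morphism_def transport_def Let_def g closed)
qed

lemma star_morphism_comp:
  "\<lbrakk>star_morphism A B f; star_morphism B C g\<rbrakk> \<Longrightarrow> star_morphism A C (\<lambda>a. g (f a))"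
  by (auto simp: star_morphism_def Pi_iff)

lemma star_morphism_restrict:
  "\<lbrakk>cstar_algebra A; star_morphism A B f\<rbrakk> \<Longrightarrow> star_morphism A B (restrict f (cs_carrier A))"
  using cstar_algebra.add_closed[of A] cstar_algebra.scale_closed[of A]
    cstar_algebra.mult_closed[of A] cstar_algebra.star_closed[of A]
  by (auto simp: star_morphism_def Pi_iff)

lemma net_morphism_comp:
  "\<lbrakk>net_morphism K A j B \<phi>; star_morphism B C g\<rbrakk> \<Longrightarrow> net_morphism K A j C (\<lambda>Y t. g (\<phi> Y t))"
  by (auto simp: net_morphism_def intro: star_morphism_comp)

lemma net_morphism_closed:
  "\<lbrakk>net_morphism K A j B \<phi>; Y \<in> K; t \<in> cs_carrier (A Y)\<rbrakk> \<Longrightarrow> \<phi> Y t \<in> cs_carrier B"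
  by (auto simp: net_morphism_def star_morphism_def)

lemma net_morphism_subalgebra:
  assumes "net_morphism K A j B \<phi>" "\<And>Y t. Y \<in> K \<Longrightarrow> t \<in> cs_carrier (A Y) \<Longrightarrow> \<phi> Y t \<in> D"
  shows "net_morphism K A j (B\<lparr>cs_carrier := D\<rparr>) \<phi>"
  using assms by (auto simp: net_morphism_def star_morphism_def)

lemma star_morphism_subalgebra:
  "\<lbrakk>star_morphism A (B\<lparr>cs_carrier := D\<rparr>) f; D \<subseteq> cs_carrier B\<rbrakk> \<Longrightarrow> star_morphism A B f"
  by (auto simp: star_morphism_def)

lemma (in cstar_algebra) star_subalgebra_generated:
  assumes "G \<subseteq> cs_carrier A"
  shows "star_subalgebra A (generated_star_subalgebra A G)" "G \<subseteq> generated_star_subalgebra A G"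
proof -
  have "star_subalgebra A (cs_carrier A)"
    by (simp add: star_subalgebra_def linear_subspace_def closed)
  then have sub: "generated_star_subalgebra A G \<subseteq> cs_carrier A"
    using assms unfolding generated_star_subalgebra_def by blast
  show "star_subalgebra A (generated_star_subalgebra A G)"
    using sub by (simp add: generated_star_subalgebra_def star_subalgebra_def linear_subspace_def)
  show "G \<subseteq> generated_star_subalgebra A G"
    unfolding generated_star_subalgebra_def by blast
qed

lemma universal_ex1:
  fixes B :: "('u, 'i::order, 'a) test_carrier cstar" and U :: "'u cstar"
    and A :: "'i \<Rightarrow> 'a cstar"
  assumes "is_universal_algebra K A j U \<epsilon>" "cstar_algebra B" "net_morphism K A j B \<phi>"
  shows "\<exists>!\<psi>. \<psi> \<in> extensional (cs_carrier U) \<and> star_morphism U B \<psi> \<and>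
           (\<forall>Y\<in>K. \<forall>t\<in>cs_carrier (A Y). \<phi> Y t = \<psi> (\<epsilon> Y t))"
  using assms(1)[unfolded is_universal_algebra_def, THEN conjunct2, THEN conjunct2,
      THEN spec, THEN spec, THEN mp, OF conjI, OF assms(2,3)] .

theorem universal_generated:
  fixes K :: "'i::order set" and A :: "'i \<Rightarrow> 'a cstar" and U :: "'u cstar"
  assumes U: "is_universal_algebra K A j U \<epsilon>"
  shows "norm_closure U (generated_star_subalgebra U
           {\<epsilon> Y t | Y t. Y \<in> K \<and> t \<in> cs_carrier (A Y)}) = cs_carrier U"
proof -
  interpret U: cstar_algebra U using U by (simp add: is_universal_algebra_def)
  have eps: "net_morphism K A j U \<epsilon>" using U by (simp add: is_universal_algebra_def)
  define S where "S = generated_star_subalgebra U {\<epsilon> Y t | Y t. Y \<in> K \<and> t \<in> cs_carrier (A Y)}"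
  define D where "D = norm_closure U S"
  have "{\<epsilon> Y t | Y t. Y \<in> K \<and> t \<in> cs_carrier (A Y)} \<subseteq> cs_carrier U"
    using net_morphism_closed[OF eps] by blast
  then have S: "star_subalgebra U S" and gS: "\<And>Y t. Y \<in> K \<Longrightarrow> t \<in> cs_carrier (A Y) \<Longrightarrow> \<epsilon> Y t \<in> S"
    using U.star_subalgebra_generated unfolding S_def by blast+
  have Ssub: "S \<subseteq> cs_carrier U" using S by (simp add: star_subalgebra_def linear_subspace_def)
  have Dsub: "D \<subseteq> cs_carrier U" by (auto simp: D_def norm_closure_def)
  let ?UD = "U\<lparr>cs_carrier := D\<rparr>"
  interpret D: cstar_algebra ?UD
    using U.subalgebra_cstar U.star_subalgebra_closure[OF S] U.closure_closure[OF Ssub]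
    unfolding D_def by blast
  let ?h = "Inl :: 'u \<Rightarrow> ('u, 'i, 'a) test_carrier"
  have epsD: "net_morphism K A j ?UD \<epsilon>"
    using net_morphism_subalgebra[OF eps] gS U.subset_closure[OF Ssub] unfolding D_def by blast
  have inj: "inj_on ?h X" for X :: "'u set" by simp
  note T = D.transport_cstar[OF inj] and TU = U.transport_cstar[OF inj]
  obtain \<psi> where psi: "star_morphism U (transport ?h ?UD) \<psi>"
      "\<And>Y t. Y \<in> K \<Longrightarrow> t \<in> cs_carrier (A Y) \<Longrightarrow> ?h (\<epsilon> Y t) = \<psi> (\<epsilon> Y t)"
    using universal_ex1[OF U T(1) net_morphism_comp[OF epsD T(2)]] by blast
  define k where "k = (\<lambda>u. inv_into D ?h (\<psi> u))"
  have chi: "star_morphism U ?UD k"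
    using star_morphism_comp[OF psi(1) T(3)] by (simp add: k_def)
  have chi_eps: "k (\<epsilon> Y t) = \<epsilon> Y t" if "Y \<in> K" "t \<in> cs_carrier (A Y)" for Y t
    using psi(2)[OF that] gS[OF that] U.subset_closure[OF Ssub]
    unfolding k_def D_def by (metis inj inv_into_f_f subsetD)
  let ?C = "cs_carrier U"
  have m1: "star_morphism U (transport ?h U) (restrict ?h ?C)"
    by (rule star_morphism_restrict[OF U.cstar_algebra_axioms TU(2)])
  have m2: "star_morphism U (transport ?h U) (restrict (\<lambda>u. ?h (k u)) ?C)"
    by (rule star_morphism_restrict[OF U.cstar_algebra_axioms
          star_morphism_comp[OF star_morphism_subalgebra[OF chi Dsub] TU(2)]])
  have "\<exists>!\<psi>. \<psi> \<in> extensional ?C \<and> star_morphism U (transport ?h U) \<psi> \<and>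
           (\<forall>Y\<in>K. \<forall>t\<in>cs_carrier (A Y). ?h (\<epsilon> Y t) = \<psi> (\<epsilon> Y t))"
    using universal_ex1[OF U TU(1) net_morphism_comp[OF eps TU(2)]] .
  then have "restrict ?h ?C = restrict (\<lambda>u. ?h (k u)) ?C"
  proof (rule ex1E, goal_cases)
    case (1 \<psi>')
    have "restrict ?h ?C = \<psi>'" "restrict (\<lambda>u. ?h (k u)) ?C = \<psi>'"
      using 1(2) m1 m2 chi_eps net_morphism_closed[OF eps] by auto
    then show ?case by simp
  qed
  then have "k u = u" if "u \<in> ?C" for u
    using that by (metis (no_types, lifting) restrict_apply' sum.inject(1))
  then have "?C \<subseteq> D" using chi by (force simp: star_morphism_def)
  then show ?thesis using Dsub unfolding D_def S_def by blast
qed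

fun eval_word :: "'b cstar \<Rightarrow> ('i \<Rightarrow> 'a \<Rightarrow> 'b) \<Rightarrow> ('i \<times> 'a) list \<Rightarrow> 'b" where
  "eval_word B \<phi> [] = \<zero>\<^bsub>B\<^esub>"
| "eval_word B \<phi> [l] = \<phi> (fst l) (snd l)"
| "eval_word B \<phi> (l # m # w) = \<phi> (fst l) (snd l) \<otimes>\<^bsub>B\<^esub> eval_word B \<phi> (m # w)"

fun eval_poly :: "'b cstar \<Rightarrow> ('i \<Rightarrow> 'a \<Rightarrow> 'b) \<Rightarrow> ('i \<times> 'a) list list \<Rightarrow> 'b" where
  "eval_poly B \<phi> [] = \<zero>\<^bsub>B\<^esub>"
| "eval_poly B \<phi> (w # p) = eval_word B \<phi> w \<oplus>\<^bsub>B\<^esub> eval_poly B \<phi> p"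

definition net_words :: "'i set \<Rightarrow> ('i \<Rightarrow> 'a cstar) \<Rightarrow> ('i \<times> 'a) list set" where
  "net_words K A = {w. w \<noteq> [] \<and> set w \<subseteq> (SIGMA Y:K. cs_carrier (A Y))}"

lemma star_subalgebra_polys:
  assumes B: "cstar_algebra B" and phi: "net_morphism K A j B \<phi>"
    and A: "\<And>Y. Y \<in> K \<Longrightarrow> cstar_algebra (A Y)"
  shows "star_subalgebra B (eval_poly B \<phi> ` lists (net_words K A))" (is "star_subalgebra B ?P")
    and "Y \<in> K \<Longrightarrow> t \<in> cs_carrier (A Y) \<Longrightarrow> \<phi> Y t \<in> eval_poly B \<phi> ` lists (net_words K A)"
proof -
  interpret B: cstar_algebra B by fact
  let ?N = "net_words K A" and ?w = "eval_word B \<phi>" and ?p = "eval_poly B \<phi>"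
  define W where "W = ?w ` ?N"
  have phic: "\<phi> Y t \<in> cs_carrier B" if "Y \<in> K" "t \<in> cs_carrier (A Y)" for Y t
    using net_morphism_closed[OF phi that] .
  have sing: "\<phi> Y t \<in> W" if "Y \<in> K" "t \<in> cs_carrier (A Y)" for Y t
    using that unfolding W_def by (intro image_eqI[of _ _ "[(Y, t)]"]) (auto simp: net_words_def)
  have lcons: "\<phi> Y t \<otimes>\<^bsub>B\<^esub> x \<in> W" if asm: "Y \<in> K" "t \<in> cs_carrier (A Y)" "x \<in> W" for Y t x
  proof -
    obtain w where w: "w \<in> ?N" "x = ?w w" using asm(3) by (auto simp: W_def)
    then obtain m v where mv: "w = m # v" by (cases w) (auto simp: net_words_def)
    show ?thesis unfolding W_def using asm w mv
      by (intro image_eqI[of _ _ "(Y, t) # m # v"]) (auto simp: net_words_def)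
  qed
  have Wind [consumes 1, case_names single cons]: "Q x"
    if x: "x \<in> W"
      and 1: "\<And>Y t. Y \<in> K \<Longrightarrow> t \<in> cs_carrier (A Y) \<Longrightarrow> Q (\<phi> Y t)"
      and 2: "\<And>Y t y. Y \<in> K \<Longrightarrow> t \<in> cs_carrier (A Y) \<Longrightarrow> y \<in> W \<Longrightarrow> Q y \<Longrightarrow> Q (\<phi> Y t \<otimes>\<^bsub>B\<^esub> y)"
    for Q x
  proof -
    have "Q (?w w)" if "w \<in> ?N" for w
      using that
    proof (induction w)
      case Nil
      then show ?case by (simp add: net_words_def)
    next
      case (Cons l w)
      then show ?case
      proof (cases w)
        case Nil
        then show ?thesis using Cons.prems 1 by (auto simp: net_words_def)
      next
        case (Cons m v)
        then have "w \<in> ?N" using Cons.prems by (auto simp: net_words_def)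
        then show ?thesis using Cons.prems Cons.IH 2[of "fst l" "snd l" "?w w"] Cons
          by (auto simp: net_words_def W_def)
      qed
    qed
    then show ?thesis using x by (auto simp: W_def)
  qed
  have Wc: "W \<subseteq> cs_carrier B"
  proof
    fix x assume "x \<in> W"
    then show "x \<in> cs_carrier B"
      by (induction rule: Wind) (simp_all add: phic B.closed)
  qed
  have Wmult: "x \<otimes>\<^bsub>B\<^esub> y \<in> W" if "x \<in> W" "y \<in> W" for x y
    using that(1)
  proof (induction rule: Wind)
    case (cons Y t z)
    then have "(\<phi> Y t \<otimes>\<^bsub>B\<^esub> z) \<otimes>\<^bsub>B\<^esub> y = \<phi> Y t \<otimes>\<^bsub>B\<^esub> (z \<otimes>\<^bsub>B\<^esub> y)"
      using Wc that(2) phic by (intro B.mult_assoc) auto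
    then show ?case using \<open>z \<otimes>\<^bsub>B\<^esub> y \<in> W\<close> \<open>Y \<in> K\<close> \<open>t \<in> _\<close>
        lcons[of Y t "z \<otimes>\<^bsub>B\<^esub> y"] by simp
  qed (use lcons that(2) in auto)
  have sm: "star_morphism (A Y) B (\<phi> Y)" if "Y \<in> K" for Y
    using phi that by (simp add: net_morphism_def)
  have Wstar: "cs_star B x \<in> W" if "x \<in> W" for x
    using that
  proof (induction rule: Wind)
    case (single Y t)
    then have "cs_star B (\<phi> Y t) = \<phi> Y (cs_star (A Y) t)" "cs_star (A Y) t \<in> cs_carrier (A Y)"
      using sm[of Y] cstar_algebra.star_closed[OF A] by (auto simp: star_morphism_def)
    then show ?case using sing \<open>Y \<in> K\<close> by simp
  next
    case (cons Y t z)
    then have "cs_star B (\<phi> Y t \<otimes>\<^bsub>B\<^esub> z) = cs_star B z \<otimes>\<^bsub>B\<^esub> cs_star B (\<phi> Y t)"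
      using Wc phic by (intro B.star_mult) auto
    moreover have "cs_star B (\<phi> Y t) = \<phi> Y (cs_star (A Y) t)" "cs_star (A Y) t \<in> cs_carrier (A Y)"
      using cons sm[of Y] cstar_algebra.star_closed[OF A] by (auto simp: star_morphism_def)
    ultimately show ?case using sing cons Wmult by simp
  qed
  have Wscale: "c \<odot>\<^bsub>B\<^esub> x \<in> W" if "x \<in> W" for x c
  proof -
    have s1: "c \<odot>\<^bsub>B\<^esub> \<phi> Y t = \<phi> Y (c \<odot>\<^bsub>A Y\<^esub> t)" "c \<odot>\<^bsub>A Y\<^esub> t \<in> cs_carrier (A Y)"
      if "Y \<in> K" "t \<in> cs_carrier (A Y)" for Y t
      using that sm[of Y] cstar_algebra.scale_closed[OF A] by (auto simp: star_morphism_def)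
    show ?thesis using that
    proof (induction rule: Wind)
      case (single Y t)
      then show ?case using s1 sing by simp
    next
      case (cons Y t z)
      then have "c \<odot>\<^bsub>B\<^esub> (\<phi> Y t \<otimes>\<^bsub>B\<^esub> z) = (c \<odot>\<^bsub>B\<^esub> \<phi> Y t) \<otimes>\<^bsub>B\<^esub> z"
        using Wc phic by (intro B.mult_scale_left[symmetric]) auto
      then show ?case using s1 lcons cons by simp
    qed
  qed
  have WP: "x \<oplus>\<^bsub>B\<^esub> y \<in> ?P" if "x \<in> W" "y \<in> ?P" for x y
  proof -
    obtain w p where "w \<in> ?N" "x = ?w w" "p \<in> lists ?N" "y = ?p p"
      using \<open>x \<in> W\<close> \<open>y \<in> ?P\<close> by (auto simp: W_def)
    then show ?thesis by (intro image_eqI[of _ _ "w # p"]) auto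
  qed
  have P0: "\<zero>\<^bsub>B\<^esub> \<in> ?P" by (rule image_eqI[of _ _ "[]"]) auto
  have Pind [consumes 1, case_names zero add]: "Q x"
    if x: "x \<in> ?P" and 1: "Q \<zero>\<^bsub>B\<^esub>"
      and 2: "\<And>w y. w \<in> W \<Longrightarrow> y \<in> ?P \<Longrightarrow> Q y \<Longrightarrow> Q (w \<oplus>\<^bsub>B\<^esub> y)" for Q x
  proof -
    have "Q (?p p)" if "p \<in> lists ?N" for p
      using that
    proof (induction p)
      case (Cons w p)
      then show ?case using 2[of "?w w" "?p p"] by (auto simp: W_def)
    qed (use 1 in simp)
    then show ?thesis using x by auto
  qed
  have Pc: "x \<in> cs_carrier B" if "x \<in> ?P" for x
    using that by (induction rule: Pind) (use Wc B.closed in auto)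
  have Padd: "x \<oplus>\<^bsub>B\<^esub> y \<in> ?P" if "x \<in> ?P" "y \<in> ?P" for x y
    using that(1)
  proof (induction rule: Pind)
    case zero
    then show ?case using that(2) Pc B.zero_add by simp
  next
    case (add w z)
    then have "(w \<oplus>\<^bsub>B\<^esub> z) \<oplus>\<^bsub>B\<^esub> y = w \<oplus>\<^bsub>B\<^esub> (z \<oplus>\<^bsub>B\<^esub> y)"
      using Wc Pc that(2) by (intro B.add_assoc) auto
    then show ?case using WP add by simp
  qed
  have WinP: "w \<in> ?P" if "w \<in> W" for w
  proof -
    have "w \<oplus>\<^bsub>B\<^esub> \<zero>\<^bsub>B\<^esub> = w" using B.add_zero[of w] Wc that by blast
    then show ?thesis using WP[OF that P0] by simp
  qed
  have Pscale: "c \<odot>\<^bsub>B\<^esub> x \<in> ?P" if "x \<in> ?P" for x c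
    using that
  proof (induction rule: Pind)
    case zero
    then show ?case using P0 B.scale_zero_right by simp
  next
    case (add w z)
    then have "c \<odot>\<^bsub>B\<^esub> (w \<oplus>\<^bsub>B\<^esub> z) = (c \<odot>\<^bsub>B\<^esub> w) \<oplus>\<^bsub>B\<^esub> (c \<odot>\<^bsub>B\<^esub> z)"
      using Wc Pc by (intro B.scale_add_right) auto
    then show ?case using WP Wscale add by simp
  qed
  have Pstar: "cs_star B x \<in> ?P" if "x \<in> ?P" for x
    using that
  proof (induction rule: Pind)
    case zero
    then show ?case using P0 B.star_zero by simp
  next
    case (add w z)
    then have "cs_star B (w \<oplus>\<^bsub>B\<^esub> z) = cs_star B w \<oplus>\<^bsub>B\<^esub> cs_star B z"
      using Wc Pc by (intro B.star_add) auto
    then show ?case using WP Wstar add by simp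
  qed
  have WPmult: "w \<otimes>\<^bsub>B\<^esub> y \<in> ?P" if "w \<in> W" "y \<in> ?P" for w y
    using that(2)
  proof (induction rule: Pind)
    case zero
    have "w \<otimes>\<^bsub>B\<^esub> \<zero>\<^bsub>B\<^esub> = \<zero>\<^bsub>B\<^esub>" using B.mult_zero_r that(1) Wc by blast
    then show ?case using P0 by simp
  next
    case (add v z)
    then have "w \<otimes>\<^bsub>B\<^esub> (v \<oplus>\<^bsub>B\<^esub> z) = (w \<otimes>\<^bsub>B\<^esub> v) \<oplus>\<^bsub>B\<^esub> (w \<otimes>\<^bsub>B\<^esub> z)"
      using Wc Pc that(1) by (intro B.mult_add_right) auto
    then show ?case using WP Wmult add that(1) by simp
  qed
  have Pmult: "x \<otimes>\<^bsub>B\<^esub> y \<in> ?P" if "x \<in> ?P" "y \<in> ?P" for x y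
    using that(1)
  proof (induction rule: Pind)
    case zero
    have "\<zero>\<^bsub>B\<^esub> \<otimes>\<^bsub>B\<^esub> y = \<zero>\<^bsub>B\<^esub>" using B.mult_zero_l Pc[OF that(2)] by blast
    then show ?case using P0 by simp
  next
    case (add w z)
    then have "(w \<oplus>\<^bsub>B\<^esub> z) \<otimes>\<^bsub>B\<^esub> y = (w \<otimes>\<^bsub>B\<^esub> y) \<oplus>\<^bsub>B\<^esub> (z \<otimes>\<^bsub>B\<^esub> y)"
      using Wc Pc that(2) by (intro B.mult_add_left) auto
    then show ?case using Padd WPmult add that(2) by simp
  qed
  show "star_subalgebra B ?P"
    unfolding star_subalgebra_def linear_subspace_def
    by (intro conjI ballI allI subsetI Pc P0 Padd Pscale Pmult Pstar)
  show "\<phi> Y t \<in> ?P" if "Y \<in> K" "t \<in> cs_carrier (A Y)"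
    by (rule WinP[OF sing[OF that]])
qed

theorem universal_factorization:
  fixes K :: "'i::order set" and A :: "'i \<Rightarrow> 'a cstar" and U :: "'u cstar" and B :: "'b cstar"
  assumes U: "is_universal_algebra K A j U \<epsilon>" and net: "cstar_net K A j"
    and B: "cstar_algebra B" and phi: "net_morphism K A j B \<phi>"
  shows "\<exists>\<psi>. star_morphism U B \<psi> \<and> (\<forall>Y\<in>K. \<forall>t\<in>cs_carrier (A Y). \<phi> Y t = \<psi> (\<epsilon> Y t))"
proof -
  interpret B: cstar_algebra B by fact
  have A: "cstar_algebra (A Y)" if "Y \<in> K" for Y
    using net that by (simp add: cstar_net_def unital_cstar_algebra_def)
  let ?N = "net_words K A"
  define P where "P = eval_poly B \<phi> ` lists ?N"
  define D where "D = norm_closure B P"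
  have P: "star_subalgebra B P" and phiP: "\<And>Y t. Y \<in> K \<Longrightarrow> t \<in> cs_carrier (A Y) \<Longrightarrow> \<phi> Y t \<in> P"
    using star_subalgebra_polys[OF B phi A] unfolding P_def by blast+
  have Psub: "P \<subseteq> cs_carrier B" using P by (simp add: star_subalgebra_def linear_subspace_def)
  have Dsub: "D \<subseteq> cs_carrier B" by (auto simp: D_def norm_closure_def)
  let ?BD = "B\<lparr>cs_carrier := D\<rparr>"
  interpret D: cstar_algebra ?BD
    using B.subalgebra_cstar B.star_subalgebra_closure[OF P] B.closure_closure[OF Psub]
    unfolding D_def by blast
  have phiD: "net_morphism K A j ?BD \<phi>"
    using net_morphism_subalgebra[OF phi] phiP B.subset_closure[OF Psub] unfolding D_def by blast
  have "\<exists>s. (\<forall>n::nat. s n \<in> lists ?N) \<and> (\<lambda>n. cs_norm B (eval_poly B \<phi> (s n) \<ominus>\<^bsub>B\<^esub> d)) \<longlonglongrightarrow> 0"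
    if d: "d \<in> D" for d
  proof -
    obtain s where s: "\<And>n::nat. s n \<in> P" "(\<lambda>n. cs_norm B (s n \<ominus>\<^bsub>B\<^esub> d)) \<longlonglongrightarrow> 0"
      using B.closure_memD[OF d[unfolded D_def] Psub] by blast
    have "\<forall>n. \<exists>p. p \<in> lists ?N \<and> s n = eval_poly B \<phi> p" using s(1) by (auto simp: P_def)
    then obtain p where "\<And>n. p n \<in> lists ?N" "\<And>n. s n = eval_poly B \<phi> (p n)" by metis
    then show ?thesis using s(2) by auto
  qed
  then obtain s where s: "\<And>d n. d \<in> D \<Longrightarrow> s d n \<in> lists ?N"
      "\<And>d. d \<in> D \<Longrightarrow> (\<lambda>n::nat. cs_norm B (eval_poly B \<phi> (s d n) \<ominus>\<^bsub>B\<^esub> d)) \<longlonglongrightarrow> 0"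
    by metis
  let ?h = "\<lambda>d. Inr (s d) :: ('u, 'i, 'a) test_carrier"
  have inj: "inj_on ?h (cs_carrier ?BD)"
  proof (rule inj_onI)
    fix d e assume de: "d \<in> cs_carrier ?BD" "e \<in> cs_carrier ?BD" "?h d = ?h e"
    then have "s d = s e" by simp
    moreover have "eval_poly B \<phi> (s d n) \<in> cs_carrier B" for n
      using s(1)[of d n] de(1) Psub by (auto simp: P_def)
    ultimately show "d = e"
      using B.limit_unique[of "\<lambda>n. eval_poly B \<phi> (s d n)" d e] s(2)[of d] s(2)[of e] de Dsub by auto
  qed
  note T = D.transport_cstar[OF inj]
  obtain \<psi> where psi: "star_morphism U (transport ?h ?BD) \<psi>"
      "\<And>Y t. Y \<in> K \<Longrightarrow> t \<in> cs_carrier (A Y) \<Longrightarrow> ?h (\<phi> Y t) = \<psi> (\<epsilon> Y t)"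
    using universal_ex1[OF U T(1) net_morphism_comp[OF phiD T(2)]] by blast
  define k where "k = (\<lambda>u. inv_into D ?h (\<psi> u))"
  have k: "star_morphism U B k"
    using star_morphism_subalgebra[OF _ Dsub] star_morphism_comp[OF psi(1) T(3)] by (simp add: k_def)
  moreover have "k (\<epsilon> Y t) = \<phi> Y t" if Y: "Y \<in> K" "t \<in> cs_carrier (A Y)" for Y t
  proof -
    have "\<phi> Y t \<in> D" using phiP[OF Y] B.subset_closure[OF Psub] by (auto simp: D_def)
    then have "inv_into D ?h (?h (\<phi> Y t)) = \<phi> Y t"
      using inj by (intro inv_into_f_f) simp_all
    then show ?thesis using psi(2)[OF Y] by (simp add: k_def)
  qed
  ultimately show ?thesis by metis
qed

lemma induced_coset:
  assumes A: "cstar_algebra A" and B: "cstar_algebra B"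
    and I: "closed_ideal A I" and J: "closed_ideal B J"
    and f: "star_morphism A B f" "f ` I \<subseteq> J" and a: "a \<in> cs_carrier A"
  shows "induced_map B J f (cs_coset A I a) = cs_coset B J (f a)"
proof -
  interpret A: cstar_algebra A by fact
  interpret B: cstar_algebra B by fact
  have Ic: "I \<subseteq> cs_carrier A" "\<zero>\<^bsub>A\<^esub> \<in> I" using I by (auto simp: closed_ideal_def linear_subspace_def)
  have Jc: "J \<subseteq> cs_carrier B" "\<And>i j. i \<in> J \<Longrightarrow> j \<in> J \<Longrightarrow> i \<oplus>\<^bsub>B\<^esub> j \<in> J"
    using J by (auto simp: closed_ideal_def linear_subspace_def)
  have fa: "f a \<in> cs_carrier B" using f a by (auto simp: star_morphism_def)
  show ?thesis
  proof (intro equalityI subsetI)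
    fix x assume "x \<in> induced_map B J f (cs_coset A I a)"
    then obtain i j where x: "i \<in> I" "j \<in> J" "x = f (a \<oplus>\<^bsub>A\<^esub> i) \<oplus>\<^bsub>B\<^esub> j"
      by (auto simp: induced_map_def cs_coset_def)
    then have "x = f a \<oplus>\<^bsub>B\<^esub> (f i \<oplus>\<^bsub>B\<^esub> j)"
      using f a Ic Jc fa B.add_assoc by (auto simp: star_morphism_def subset_iff)
    moreover have "f i \<oplus>\<^bsub>B\<^esub> j \<in> J" using x f Jc by blast
    ultimately show "x \<in> cs_coset B J (f a)" by (auto simp: cs_coset_def)
  next
    fix x assume "x \<in> cs_coset B J (f a)"
    then obtain j where x: "j \<in> J" "x = f a \<oplus>\<^bsub>B\<^esub> j" by (auto simp: cs_coset_def)
    have "a \<in> cs_coset A I a" using Ic A.add_zero[OF a] by (force simp: cs_coset_def)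
    then show "x \<in> induced_map B J f (cs_coset A I a)" using x by (auto simp: induced_map_def)
  qed
qed

lemma coset_ops:
  assumes A: "cstar_algebra A" and I: "closed_ideal A I"
    and a: "a \<in> cs_carrier A" and b: "b \<in> cs_carrier A"
  shows "cs_coset A I a \<oplus>\<^bsub>cs_quotient A I\<^esub> cs_coset A I b = cs_coset A I (a \<oplus>\<^bsub>A\<^esub> b)"
    and "c \<odot>\<^bsub>cs_quotient A I\<^esub> cs_coset A I a = cs_coset A I (c \<odot>\<^bsub>A\<^esub> a)"
    and "cs_coset A I a \<otimes>\<^bsub>cs_quotient A I\<^esub> cs_coset A I b = cs_coset A I (a \<otimes>\<^bsub>A\<^esub> b)"
    and "(\<And>i. i \<in> I \<Longrightarrow> cs_star A i \<in> I) \<Longrightarrow>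
           cs_star (cs_quotient A I) (cs_coset A I a) = cs_coset A I (cs_star A a)"
proof -
  interpret A: cstar_algebra A by fact
  have Ic: "\<And>i. i \<in> I \<Longrightarrow> i \<in> cs_carrier A" and I0: "\<zero>\<^bsub>A\<^esub> \<in> I"
    and Ia: "\<And>i j. i \<in> I \<Longrightarrow> j \<in> I \<Longrightarrow> i \<oplus>\<^bsub>A\<^esub> j \<in> I" "\<And>c i. i \<in> I \<Longrightarrow> c \<odot>\<^bsub>A\<^esub> i \<in> I"
      "\<And>i a. i \<in> I \<Longrightarrow> a \<in> cs_carrier A \<Longrightarrow> a \<otimes>\<^bsub>A\<^esub> i \<in> I"
      "\<And>i a. i \<in> I \<Longrightarrow> a \<in> cs_carrier A \<Longrightarrow> i \<otimes>\<^bsub>A\<^esub> a \<in> I"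
    using I by (auto simp: closed_ideal_def linear_subspace_def)
  have mem: "d \<in> cs_coset A I d" if "d \<in> cs_carrier A" for d
    using I0 A.add_zero[OF that] by (force simp: cs_coset_def)
  have 1: "(a \<oplus>\<^bsub>A\<^esub> i) \<oplus>\<^bsub>A\<^esub> (b \<oplus>\<^bsub>A\<^esub> j) = (a \<oplus>\<^bsub>A\<^esub> b) \<oplus>\<^bsub>A\<^esub> (i \<oplus>\<^bsub>A\<^esub> j)" if "i \<in> I" "j \<in> I" for i j
    using that a b Ic by (simp add: A.add_ac A.closed)
  show "cs_coset A I a \<oplus>\<^bsub>cs_quotient A I\<^esub> cs_coset A I b = cs_coset A I (a \<oplus>\<^bsub>A\<^esub> b)" (is "?l = ?r")
  proof
    show "?l \<subseteq> ?r" using 1 Ia(1) by (force simp: cs_quotient_def cs_coset_def)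
    show "?r \<subseteq> ?l"
    proof
      fix x assume "x \<in> ?r"
      then obtain i where i: "i \<in> I" "x = (a \<oplus>\<^bsub>A\<^esub> b) \<oplus>\<^bsub>A\<^esub> i" by (auto simp: cs_coset_def)
      then have "x = a \<oplus>\<^bsub>A\<^esub> (b \<oplus>\<^bsub>A\<^esub> i)" using a b Ic A.add_assoc by simp
      then show "x \<in> ?l" using mem[OF a] i by (auto simp: cs_quotient_def cs_coset_def)
    qed
  qed
  show "c \<odot>\<^bsub>cs_quotient A I\<^esub> cs_coset A I a = cs_coset A I (c \<odot>\<^bsub>A\<^esub> a)" (is "?l = ?r")
  proof
    have "(c \<odot>\<^bsub>A\<^esub> (a \<oplus>\<^bsub>A\<^esub> i)) \<oplus>\<^bsub>A\<^esub> j = (c \<odot>\<^bsub>A\<^esub> a) \<oplus>\<^bsub>A\<^esub> (c \<odot>\<^bsub>A\<^esub> i \<oplus>\<^bsub>A\<^esub> j)" if "i \<in> I" "j \<in> I" for i j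
      using that a Ic by (simp add: A.scale_add_right A.add_assoc A.closed)
    then show "?l \<subseteq> ?r" using Ia by (force simp: cs_quotient_def cs_coset_def)
    show "?r \<subseteq> ?l" using mem[OF a] by (auto simp: cs_quotient_def cs_coset_def)
  qed
  show "cs_coset A I a \<otimes>\<^bsub>cs_quotient A I\<^esub> cs_coset A I b = cs_coset A I (a \<otimes>\<^bsub>A\<^esub> b)" (is "?l = ?r")
  proof
    have "((a \<oplus>\<^bsub>A\<^esub> i) \<otimes>\<^bsub>A\<^esub> (b \<oplus>\<^bsub>A\<^esub> j)) \<oplus>\<^bsub>A\<^esub> k
        = (a \<otimes>\<^bsub>A\<^esub> b) \<oplus>\<^bsub>A\<^esub> ((a \<otimes>\<^bsub>A\<^esub> j) \<oplus>\<^bsub>A\<^esub> (i \<otimes>\<^bsub>A\<^esub> (b \<oplus>\<^bsub>A\<^esub> j)) \<oplus>\<^bsub>A\<^esub> k)"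
      if "i \<in> I" "j \<in> I" "k \<in> I" for i j k
      using that a b Ic by (simp add: A.mult_add_left A.mult_add_right A.add_ac A.closed)
    moreover have "(a \<otimes>\<^bsub>A\<^esub> j) \<oplus>\<^bsub>A\<^esub> (i \<otimes>\<^bsub>A\<^esub> (b \<oplus>\<^bsub>A\<^esub> j)) \<oplus>\<^bsub>A\<^esub> k \<in> I"
      if "i \<in> I" "j \<in> I" "k \<in> I" for i j k
      using that a b Ic Ia A.closed by simp
    ultimately show "?l \<subseteq> ?r" by (force simp: cs_quotient_def cs_coset_def)
    show "?r \<subseteq> ?l" using mem[OF a] mem[OF b] by (auto simp: cs_quotient_def cs_coset_def)
  qed
  assume st: "\<And>i. i \<in> I \<Longrightarrow> cs_star A i \<in> I"
  show "cs_star (cs_quotient A I) (cs_coset A I a) = cs_coset A I (cs_star A a)" (is "?l = ?r")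
  proof
    have "cs_star A (a \<oplus>\<^bsub>A\<^esub> i) \<oplus>\<^bsub>A\<^esub> j = cs_star A a \<oplus>\<^bsub>A\<^esub> (cs_star A i \<oplus>\<^bsub>A\<^esub> j)" if "i \<in> I" "j \<in> I" for i j
      using that a Ic by (simp add: A.star_add A.add_assoc A.closed)
    then show "?l \<subseteq> ?r" using Ia st by (force simp: cs_quotient_def cs_coset_def)
    show "?r \<subseteq> ?l" using mem[OF a] by (auto simp: cs_quotient_def cs_coset_def)
  qed
qed

end

theory Submission
  imports Defs
begin

text \<open>
  Evaluation at \<open>x\<close> turns a \<open>C\<^sub>0(X)\<close>-algebra \<open>B\<close> into a field of fibres \<open>B\<^sub>x\<close>, and \<open>b\<close> is determined
  by its values because the norm of \<open>b\<close> is the supremum of their norms. For \<open>x \<in> Y\<close> the quotient map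
  onto \<open>B\<^sub>x\<close> factors through \<open>S\<^sub>Y B\<close>, so the maps \<open>\<phi>\<^sub>Y\<close> with \<open>x \<in> Y\<close> form a morphism of the restricted net
  into \<open>B\<^sub>x\<close> and yield \<open>\<psi>\<^sub>x : F x \<rightarrow> B\<^sub>x\<close>. The fields \<open>a\<close> for which some \<open>b\<close> has the values
  \<open>\<psi>\<^sub>x(a\<^sub>x)\<close> form a closed *-subalgebra containing the generators \<open>f \<epsilon>\<^sub>Y(t)\<close>, where \<open>b = f b'\<close> for
  any lift \<open>b'\<close> of \<open>\<phi>\<^sub>Y(t)\<close>; mapping \<open>a\<close> to \<open>b\<close> is the required morphism. It is unique because \<open>f\<close>
  kills the restriction ideal of \<open>Y\<close>, so that \<open>\<tau>\<close> prescribes the values on generators.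

  Contractivity of *-morphisms and of the action of functions rests on an elementary rotation
  argument (\<open>norm_le_rotation\<close>) in place of spectral theory.
\<close>

section \<open>Convergence in C*-algebras\<close>

text \<open>The fibre ideals are not generated by functions vanishing at a point. Instead
  \<open>b\<close> vanishes at \<open>z\<close> if functions with value 1 at \<open>z\<close> and
  modulus at most 1 make it arbitrarily small. With this form, facts usually drawn from approximate
  units become estimates: such a function leaves the value at \<open>z\<close> unchanged and can
  bring the norm close to the norm in the fibre. This yields the C*-identity of the fibres, without
  which the universal property of \<open>F x\<close> could not be applied to them. The algebras
  \<open>S_algebra\<close> are never shown to satisfy the C*-identity. Only their operations matter,
  since each is mapped on to fibres that are C*-algebras. The norm formula is used twice: it makes
  the element \<open>b\<close> with prescribed values unique, and it turns Cauchy sequences of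
  fields into Cauchy sequences in \<open>B\<close>, so that the fields with such a \<open>b\<close>
  are closed under limits. Its proof has to compare finitely many local bounds without losing a
  constant; passing to high powers absorbs the number of bounds.\<close>

abbreviation cs_tendsto :: "'a cstar \<Rightarrow> (nat \<Rightarrow> 'a) \<Rightarrow> 'a \<Rightarrow> bool" where
  "cs_tendsto A s l \<equiv> (\<lambda>n. cs_norm A (s n \<ominus>\<^bsub>A\<^esub> l)) \<longlonglongrightarrow> 0"

context cstar_algebra
begin

lemma diff_scale:
  "\<lbrakk>a \<in> cs_carrier A; b \<in> cs_carrier A\<rbrakk> \<Longrightarrow> c \<odot> (a \<ominus> b) = (c \<odot> a) \<ominus> (c \<odot> b)"
  by (simp add: cs_diff_def scale_add_right scale_scale closed)

lemma diff_mult_left: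
  "\<lbrakk>a \<in> cs_carrier A; b \<in> cs_carrier A; d \<in> cs_carrier A\<rbrakk> \<Longrightarrow> d \<otimes> (a \<ominus> b) = (d \<otimes> a) \<ominus> (d \<otimes> b)"
  by (simp add: cs_diff_def mult_add_right mult_scale_right closed)

lemma diff_mult_right:
  "\<lbrakk>a \<in> cs_carrier A; b \<in> cs_carrier A; d \<in> cs_carrier A\<rbrakk> \<Longrightarrow> (a \<ominus> b) \<otimes> d = (a \<otimes> d) \<ominus> (b \<otimes> d)"
  by (simp add: cs_diff_def mult_add_left mult_scale_left closed)

lemma diff_star:
  "\<lbrakk>a \<in> cs_carrier A; b \<in> cs_carrier A\<rbrakk> \<Longrightarrow> cs_star A (a \<ominus> b) = cs_star A a \<ominus> cs_star A b"
  by (simp add: cs_diff_def star_add star_scale closed)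

lemma add_diff_cancel:
  assumes "a \<in> cs_carrier A" "b \<in> cs_carrier A"
  shows "a \<oplus> (b \<ominus> a) = b"
  by (metis assms add_commute diff_add_cancel diff_closed)

text \<open>The middle term is \<open>u - 2m + q\<close>, and \<open>2m = p + q\<close> reduces it
  to \<open>u - p\<close>. In \<open>star_morphism_contractive\<close> this is the expansion of the
  square of \<open>s - ls\<close>.\<close>

lemma cancel_double:
  assumes c: "p \<in> cs_carrier A" "q \<in> cs_carrier A" "m \<in> cs_carrier A" "u \<in> cs_carrier A"
    and eq: "2 \<odot> m = p \<oplus> q"
  shows "p \<oplus> ((u \<ominus> m) \<ominus> (m \<ominus> q)) = u"
proof -
  have "p \<oplus> ((u \<ominus> m) \<ominus> (m \<ominus> q)) = u \<oplus> ((p \<oplus> q) \<oplus> ((-1) \<odot> m \<oplus> (-1) \<odot> m))"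
    using c by (simp add: cs_diff_def scale_add_right scale_scale scale_one closed add_ac)
  also have "(-1) \<odot> m \<oplus> (-1) \<odot> m = (-1) \<odot> (2 \<odot> m)"
    using c by (simp add: scale_scale flip: scale_add_left)
  finally show ?thesis using c eq by (simp add: add_minus add_zero closed)
qed

lemma norm_le_add_diff:
  "\<lbrakk>a \<in> cs_carrier A; b \<in> cs_carrier A\<rbrakk> \<Longrightarrow> cs_norm A a \<le> cs_norm A b + cs_norm A (a \<ominus> b)"
  using norm_triangle[of b "a \<ominus> b"] by (simp add: add_diff_cancel closed)

lemma tendsto_bound:
  assumes "\<And>n. f n \<in> cs_carrier A" "l \<in> cs_carrier A"
    and "\<And>n. cs_norm A (f n \<ominus> l) \<le> g n" "g \<longlonglongrightarrow> 0"
  shows "cs_tendsto A f l"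
  by (rule tendsto_sandwich[OF _ _ tendsto_const assms(4)])
    (auto intro!: always_eventually norm_nonneg closed assms)

lemma tendsto_lipschitz_seq:
  assumes "\<And>n. s n \<in> cs_carrier A" "a \<in> cs_carrier A" "cs_tendsto A s a"
    and "cstar_algebra B" "T \<in> cs_carrier A \<rightarrow> cs_carrier B"
    and "\<And>x. x \<in> cs_carrier A \<Longrightarrow> cs_norm B (T x \<ominus>\<^bsub>B\<^esub> T a) \<le> c * cs_norm A (x \<ominus> a)"
  shows "cs_tendsto B (\<lambda>n. T (s n)) (T a)"
proof -
  interpret B: cstar_algebra B by fact
  show ?thesis
  proof (rule B.tendsto_bound)
    show "(\<lambda>n. c * cs_norm A (s n \<ominus> a)) \<longlonglongrightarrow> 0"
      using tendsto_mult_right_zero[OF assms(3)] by simp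
  qed (use assms in auto)
qed

lemma tendsto_star_seq:
  assumes "\<And>n. s n \<in> cs_carrier A" "a \<in> cs_carrier A" "cs_tendsto A s a"
  shows "cs_tendsto A (\<lambda>n. cs_star A (s n)) (cs_star A a)"
  by (rule tendsto_lipschitz_seq[OF assms cstar_algebra_axioms, where c=1])
    (simp_all add: closed assms norm_star flip: diff_star)

lemma tendsto_mult_left_seq:
  assumes "\<And>n. s n \<in> cs_carrier A" "a \<in> cs_carrier A" "cs_tendsto A s a" "d \<in> cs_carrier A"
  shows "cs_tendsto A (\<lambda>n. d \<otimes> s n) (d \<otimes> a)"
  by (rule tendsto_lipschitz_seq[OF assms(1-3) cstar_algebra_axioms, where c="cs_norm A d"])
    (use assms in \<open>simp_all add: closed norm_mult flip: diff_mult_left\<close>)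

lemma tendsto_mult_right_seq:
  assumes "\<And>n. s n \<in> cs_carrier A" "a \<in> cs_carrier A" "cs_tendsto A s a" "d \<in> cs_carrier A"
  shows "cs_tendsto A (\<lambda>n. s n \<otimes> d) (a \<otimes> d)"
  by (rule tendsto_lipschitz_seq[OF assms(1-3) cstar_algebra_axioms, where c="cs_norm A d"])
    (use assms in \<open>auto simp: closed mult.commute[of "cs_norm A d"] norm_mult simp flip: diff_mult_right\<close>)

lemma tendsto_norm_seq:
  assumes "\<And>n. s n \<in> cs_carrier A" "a \<in> cs_carrier A" "cs_tendsto A s a"
  shows "(\<lambda>n. cs_norm A (s n)) \<longlonglongrightarrow> cs_norm A a"
proof -
  have "norm (cs_norm A (s n) - cs_norm A a) \<le> cs_norm A (s n \<ominus> a)" for n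
    using norm_le_add_diff[of a "s n"] norm_le_add_diff[of "s n" a] norm_diff_commute[of a "s n"] assms
    by (simp add: abs_le_iff algebra_simps)
  then have "(\<lambda>n. cs_norm A (s n) - cs_norm A a) \<longlonglongrightarrow> 0"
    by (intro Lim_null_comparison[OF _ assms(3)] always_eventually) simp
  then show ?thesis by (simp add: LIM_zero_iff)
qed

text \<open>The distance from \<open>s m\<close> to all later terms is at most
  \<open>C * r ^ m / (1 - r)\<close>. Serves the fixed-point iteration in
  \<open>sqrt_one_minus\<close> and the lifting of Cauchy sequences in
  \<open>quotient_complete\<close>.\<close>

lemma complete_geometric:
  assumes s: "\<And>n::nat. s n \<in> cs_carrier A" and r: "0 \<le> r" "r < 1"
    and step: "\<And>n. cs_norm A (s (Suc n) \<ominus> s n) \<le> C * r ^ n"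
  obtains l where "l \<in> cs_carrier A" "cs_tendsto A s l"
proof -
  have C: "0 \<le> C" using order_trans[OF norm_nonneg step[of 0]] s closed by simp
  have bound: "cs_norm A (s (m + k) \<ominus> s m) \<le> C * r ^ m / (1 - r)" for m k
  proof -
    have "cs_norm A (s (m + k) \<ominus> s m) \<le> C * r ^ m * (\<Sum>i<k. r ^ i)"
    proof (induction k)
      case 0
      then show ?case using s by (simp add: diff_self norm_zero)
    next
      case (Suc k)
      have "cs_norm A (s (m + Suc k) \<ominus> s m)
          \<le> cs_norm A (s (Suc (m + k)) \<ominus> s (m + k)) + cs_norm A (s (m + k) \<ominus> s m)"
        using norm_diff_triangle[of "s (Suc (m + k))" "s (m + k)" "s m"] s by simp
      also have "\<dots> \<le> C * r ^ (m + k) + C * r ^ m * (\<Sum>i<k. r ^ i)"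
        using Suc step by (intro add_mono) auto
      finally show ?case by (simp add: power_add algebra_simps)
    qed
    also have "(\<Sum>i<k. r ^ i) \<le> 1 / (1 - r)"
      using r by (simp add: sum_gp_strict divide_right_mono)
    then have "C * r ^ m * (\<Sum>i<k. r ^ i) \<le> C * r ^ m * (1 / (1 - r))"
      using C r by (intro mult_left_mono) auto
    finally show ?thesis by simp
  qed
  have "\<exists>N. \<forall>m\<ge>N. \<forall>n\<ge>N. cs_norm A (s m \<ominus> s n) < e" if e: "e > 0" for e
  proof -
    have "(\<lambda>n. C * r ^ n / (1 - r)) \<longlonglongrightarrow> C * 0 / (1 - r)"
      using r by (intro tendsto_intros LIMSEQ_realpow_zero) auto
    then have "\<forall>\<^sub>F n in sequentially. C * r ^ n / (1 - r) < e / 2"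
      using e by (intro order_tendstoD(2)[where y=0]) auto
    then obtain N where N: "C * r ^ N / (1 - r) < e / 2" by (auto simp: eventually_sequentially)
    have "cs_norm A (s m \<ominus> s n) < e" if "m \<ge> N" "n \<ge> N" for m n
    proof -
      have "cs_norm A (s m \<ominus> s n) \<le> cs_norm A (s m \<ominus> s N) + cs_norm A (s n \<ominus> s N)"
        using norm_diff_triangle[of "s m" "s N" "s n"] norm_diff_commute[of "s n" "s N"] s by simp
      also have "\<dots> \<le> C * r ^ N / (1 - r) + C * r ^ N / (1 - r)"
        using bound[of N "m - N"] bound[of N "n - N"] that by (intro add_mono) simp_all
      finally show ?thesis using N by linarith
    qed
    then show ?thesis by blast
  qed
  then have "\<exists>l\<in>cs_carrier A. cs_tendsto A s l" by (rule complete[OF s])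
  then show ?thesis using that by blast
qed


section \<open>Contractivity of *-morphisms\<close>

text \<open>\<open>x \<plusminus> i y\<close> has the same modulus as \<open>z\<close>, and \<open>x\<close> is the mean of the two.\<close>

lemma norm_le_rotation:
  assumes c: "x \<in> cs_carrier A" "y \<in> cs_carrier A" "z \<in> cs_carrier A"
    and comm: "cs_star A x \<otimes> y = cs_star A y \<otimes> x"
    and sq: "(cs_star A x \<otimes> x) \<oplus> (cs_star A y \<otimes> y) = cs_star A z \<otimes> z"
  shows "cs_norm A x \<le> cs_norm A z"
proof -
  \<comment> \<open>By \<open>comm\<close> the two cross terms are the same element \<open>m\<close>
    with coefficients \<open>w\<close> and \<open>cnj w\<close>, whose sum is 0.\<close>
  have eq: "cs_norm A (x \<oplus> w \<odot> y) = cs_norm A z" if w: "w = \<i> \<or> w = -\<i>" for w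
  proof -
    define m where "m = cs_star A y \<otimes> x"
    have mc: "m \<in> cs_carrier A" using c by (simp add: m_def closed)
    have "cs_star A (x \<oplus> w \<odot> y) \<otimes> (x \<oplus> w \<odot> y)
        = ((cs_star A x \<otimes> x) \<oplus> (w \<odot> m)) \<oplus> ((cnj w \<odot> m) \<oplus> ((cnj w * w) \<odot> (cs_star A y \<otimes> y)))"
      using c comm by (simp add: star_add star_scale mult_add_left mult_add_right closed
          mult_scale_left mult_scale_right scale_scale scale_add_right m_def add_ac mult.commute)
    also have "\<dots> = (cs_star A x \<otimes> x) \<oplus> ((cs_star A y \<otimes> y) \<oplus> ((w \<odot> m) \<oplus> (cnj w \<odot> m)))"
      using c mc w by (auto simp: scale_one closed add_ac)
    also have "(w \<odot> m) \<oplus> (cnj w \<odot> m) = \<zero>"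
      using w mc by (auto simp: scale_zero_left simp flip: scale_add_left)
    finally have "cs_star A (x \<oplus> w \<odot> y) \<otimes> (x \<oplus> w \<odot> y) = cs_star A z \<otimes> z"
      using c sq by (simp add: add_zero closed)
    then have "(cs_norm A (x \<oplus> w \<odot> y))\<^sup>2 = (cs_norm A z)\<^sup>2"
      using c norm_cstar[of "x \<oplus> w \<odot> y"] norm_cstar[of z] by (simp add: closed)
    then show ?thesis using c by (simp add: norm_nonneg closed)
  qed
  let ?p = "x \<oplus> \<i> \<odot> y" and ?q = "x \<oplus> (-\<i>) \<odot> y"
  have "?p \<oplus> ?q = (x \<oplus> x) \<oplus> (\<i> \<odot> y \<oplus> (-\<i>) \<odot> y)"
    using c by (simp add: add_ac closed)
  also have "\<dots> = 2 \<odot> x"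
    using c scale_add_left[of y \<i> "-\<i>", symmetric] scale_add_left[of x 1 1, symmetric]
    by (simp add: scale_zero_left add_zero scale_one closed)
  finally have "x = (1/2) \<odot> (?p \<oplus> ?q)" using c by (simp add: scale_scale scale_one)
  then have "cs_norm A x = 1/2 * cs_norm A (?p \<oplus> ?q)"
    using c norm_scale[of "?p \<oplus> ?q" "1/2"] by (simp add: closed norm_divide)
  also have "\<dots> \<le> 1/2 * (cs_norm A ?p + cs_norm A ?q)"
    using c by (simp add: norm_triangle closed)
  finally show ?thesis by (simp add: eq)
qed

text \<open>Solves \<open>(1 - k)\<^sup>2 = 1 - h\<close>, that is, \<open>k = 1 - \<surd>(1 - h)\<close>, without using a unit.\<close>

lemma sqrt_one_minus:
  assumes h: "h \<in> cs_carrier A" "cs_star A h = h" "cs_norm A h < 1"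
  obtains k where "k \<in> cs_carrier A" "cs_star A k = k" "2 \<odot> k = h \<oplus> (k \<otimes> k)"
    "\<And>c. c \<in> cs_carrier A \<Longrightarrow> c \<otimes> h = h \<otimes> c \<Longrightarrow> c \<otimes> k = k \<otimes> c"
proof -
  define T where "T k = (1/2) \<odot> (h \<oplus> (k \<otimes> k))" for k
  define s where "s n = (T ^^ n) \<zero>" for n
  have s0: "s 0 = \<zero>" and sS: "s (Suc n) = T (s n)" for n by (simp_all add: s_def)
  have Tc: "T k \<in> cs_carrier A" if "k \<in> cs_carrier A" for k
    using that h by (simp add: T_def closed)
  have sc: "s n \<in> cs_carrier A" for n
    by (induction n) (simp_all add: s0 sS Tc closed)
  \<comment> \<open>The smaller root of \<open>r^2 - 2r + cs_norm A h = 0\<close>: \<open>T\<close>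
    maps the ball of radius \<open>r\<close> into itself and is Lipschitz there with constant
    \<open>r < 1\<close>.\<close>
  define r where "r = 1 - sqrt (1 - cs_norm A h)"
  have r: "0 \<le> r" "r < 1" "cs_norm A h + r\<^sup>2 = 2 * r"
    using h norm_nonneg[of h] by (simp_all add: r_def power2_eq_square algebra_simps)
  have sr: "cs_norm A (s n) \<le> r" for n
  proof (induction n)
    case 0
    then show ?case using r by (simp add: s0 norm_zero)
  next
    case (Suc n)
    have "cs_norm A (T (s n)) = 1/2 * cs_norm A (h \<oplus> (s n \<otimes> s n))"
      using h sc by (simp add: T_def norm_scale closed norm_divide)
    also have "\<dots> \<le> 1/2 * (cs_norm A h + cs_norm A (s n) * cs_norm A (s n))"
      using norm_triangle[of h "s n \<otimes> s n"] norm_mult[of "s n" "s n"] h sc by (simp add: closed)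
    also have "\<dots> \<le> 1/2 * (cs_norm A h + r * r)"
      using Suc sc by (intro mult_left_mono add_left_mono mult_mono norm_nonneg r) auto
    also have "\<dots> = r" using r(3) by (simp add: power2_eq_square)
    finally show ?case by (simp add: sS)
  qed
  have Tlip: "cs_norm A (T a \<ominus> T b) \<le> r * cs_norm A (a \<ominus> b)"
    if "a \<in> cs_carrier A" "b \<in> cs_carrier A" "cs_norm A a \<le> r" "cs_norm A b \<le> r" for a b
  proof -
    have "T a \<ominus> T b = (1/2) \<odot> ((a \<otimes> a) \<ominus> (b \<otimes> b))"
      using that h by (simp add: T_def closed add_diff_add diff_self zero_add flip: diff_scale)
    then have "cs_norm A (T a \<ominus> T b) = 1/2 * cs_norm A ((a \<otimes> (a \<ominus> b)) \<oplus> ((a \<ominus> b) \<otimes> b))"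
      using that by (simp add: norm_scale closed mult_diff norm_divide)
    also have "\<dots> \<le> 1/2 * (cs_norm A a * cs_norm A (a \<ominus> b) + cs_norm A (a \<ominus> b) * cs_norm A b)"
      using that by (intro mult_left_mono order_trans[OF norm_triangle] add_mono norm_mult closed) auto
    also have "\<dots> \<le> 1/2 * (r * cs_norm A (a \<ominus> b) + cs_norm A (a \<ominus> b) * r)"
      using that by (intro mult_left_mono add_mono mult_right_mono norm_nonneg closed) auto
    finally show ?thesis by simp
  qed
  have step: "cs_norm A (s (Suc n) \<ominus> s n) \<le> cs_norm A (T \<zero> \<ominus> \<zero>) * r ^ n" for n
  proof (induction n)
    case 0
    then show ?case by (simp add: s0 sS)
  next
    case (Suc n)
    have "cs_norm A (s (Suc (Suc n)) \<ominus> s (Suc n)) \<le> r * cs_norm A (s (Suc n) \<ominus> s n)"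
      using Tlip[OF sc sc sr sr, of "Suc n" n] by (simp only: sS)
    also have "\<dots> \<le> r * (cs_norm A (T \<zero> \<ominus> \<zero>) * r ^ n)"
      using Suc r by (intro mult_left_mono) auto
    finally show ?case by (simp add: algebra_simps)
  qed
  obtain k where k: "k \<in> cs_carrier A" "cs_tendsto A s k"
    using complete_geometric[OF sc r(1,2) step] by blast
  have kr: "cs_norm A k \<le> r"
    using LIMSEQ_le_const2[OF tendsto_norm_seq[OF sc k]] sr by blast
  have Tk: "cs_tendsto A (\<lambda>n. T (s n)) (T k)"
  proof (rule tendsto_bound)
    show "cs_norm A (T (s n) \<ominus> T k) \<le> r * cs_norm A (s n \<ominus> k)" for n
      by (intro Tlip sc k kr sr)
    show "(\<lambda>n. r * cs_norm A (s n \<ominus> k)) \<longlonglongrightarrow> 0"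
      by (rule tendsto_mult_right_zero[OF k(2)])
  qed (use Tc sc k in auto)
  have "cs_tendsto A (\<lambda>n. T (s n)) k"
    using LIMSEQ_Suc[OF k(2)] by (simp add: sS)
  then have Tk_eq: "T k = k"
    using limit_unique[of "\<lambda>n. T (s n)" "T k" k] Tk Tc sc k by blast
  have sstar: "cs_star A (s n) = s n" for n
    by (induction n) (simp_all add: s0 sS star_zero T_def star_scale star_add star_mult h sc closed)
  \<comment> \<open>Each iterate is built from \<open>h\<close> alone, so it commutes with whatever
    commutes with \<open>h\<close>; multiplication by \<open>c\<close> then passes to the
    limit.\<close>
  have comm: "c \<otimes> k = k \<otimes> c" if c: "c \<in> cs_carrier A" "c \<otimes> h = h \<otimes> c" for c
  proof -
    have "c \<otimes> s n = s n \<otimes> c" for n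
    proof (induction n)
      case 0
      then show ?case using c by (simp add: s0 mult_zero_l mult_zero_r)
    next
      case (Suc n)
      have "c \<otimes> (s n \<otimes> s n) = s n \<otimes> (c \<otimes> s n)"
        using Suc c sc mult_assoc[of c "s n" "s n"] mult_assoc[of "s n" c "s n"] by simp
      also have "\<dots> = (s n \<otimes> s n) \<otimes> c"
        using Suc c sc mult_assoc[of "s n" "s n" c] by simp
      finally show ?case
        using c h sc by (simp add: sS T_def mult_scale_left mult_scale_right mult_add_left
            mult_add_right closed)
    qed
    then show ?thesis
      using limit_unique[of "\<lambda>n. c \<otimes> s n" "c \<otimes> k" "k \<otimes> c"] sc c k closed
        tendsto_mult_left_seq[OF sc k c(1)] tendsto_mult_right_seq[OF sc k c(1)] by simp
  qed
  have "cs_star A k = k"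
    using limit_unique[of s "cs_star A k" k] tendsto_star_seq[OF sc k] k sc closed by (simp add: sstar)
  moreover have "2 \<odot> T k = h \<oplus> (k \<otimes> k)"
    using h k by (simp add: T_def scale_scale scale_one closed)
  ultimately show ?thesis using that k(1) comm Tk_eq by simp
qed

end

lemma star_morphismD:
  assumes "star_morphism A B f"
  shows "a \<in> cs_carrier A \<Longrightarrow> f a \<in> cs_carrier B"
    and "\<lbrakk>a \<in> cs_carrier A; b \<in> cs_carrier A\<rbrakk> \<Longrightarrow> f (a \<oplus>\<^bsub>A\<^esub> b) = f a \<oplus>\<^bsub>B\<^esub> f b"
    and "a \<in> cs_carrier A \<Longrightarrow> f (c \<odot>\<^bsub>A\<^esub> a) = c \<odot>\<^bsub>B\<^esub> f a"
    and "\<lbrakk>a \<in> cs_carrier A; b \<in> cs_carrier A\<rbrakk> \<Longrightarrow> f (a \<otimes>\<^bsub>A\<^esub> b) = f a \<otimes>\<^bsub>B\<^esub> f b"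
    and "a \<in> cs_carrier A \<Longrightarrow> f (cs_star A a) = cs_star B (f a)"
  using assms by (auto simp: star_morphism_def)

lemma star_morphism_diff:
  assumes "cstar_algebra A" "star_morphism A B f" "a \<in> cs_carrier A" "b \<in> cs_carrier A"
  shows "f (a \<ominus>\<^bsub>A\<^esub> b) = f a \<ominus>\<^bsub>B\<^esub> f b"
  using assms by (simp add: cs_diff_def star_morphismD cstar_algebra.scale_closed)

lemma star_morphism_zero:
  assumes A: "cstar_algebra A" and B: "cstar_algebra B" and f: "star_morphism A B f"
  shows "f \<zero>\<^bsub>A\<^esub> = \<zero>\<^bsub>B\<^esub>"
proof -
  interpret A: cstar_algebra A by fact
  interpret B: cstar_algebra B by fact
  show ?thesis
    using star_morphismD(1)[OF f A.zero_closed] star_morphismD(3)[OF f A.zero_closed, of 0] A.scale_zero_left[OF A.zero_closed]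
      B.scale_zero_left[of "f \<zero>\<^bsub>A\<^esub>"] by simp
qed

text \<open>Scaling and the C*-identity reduce the claim to \<open>cs_norm B (f a) \<le> 1\<close>
  for self-adjoint \<open>a\<close> of norm below 1. There \<open>1 - a^2\<close> has the formal
  square root \<open>1 - k\<close>; the equation for \<open>k\<close> is purely algebraic, so
  \<open>f\<close> carries it to \<open>B\<close>. No continuity of \<open>f\<close> is
  presupposed.\<close>

theorem star_morphism_contractive:
  assumes A: "cstar_algebra A" and B: "cstar_algebra B" and f: "star_morphism A B f"
    and a: "a \<in> cs_carrier A"
  shows "cs_norm B (f a) \<le> cs_norm A a"
proof -
  interpret A: cstar_algebra A by fact
  interpret B: cstar_algebra B by fact
  note f' = star_morphismD[OF f]
  have unit: "cs_norm B (f a) \<le> 1"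
    if a: "a \<in> cs_carrier A" "cs_star A a = a" "cs_norm A a < 1" for a
  proof -
    let ?h = "a \<otimes>\<^bsub>A\<^esub> a"
    have "cs_norm A ?h = (cs_norm A a)\<^sup>2" using A.norm_cstar[OF a(1)] a by simp
    also have "\<dots> < 1" using a A.norm_nonneg by (simp add: power_less_one_iff)
    finally have "cs_norm A ?h < 1" .
    then obtain k where k: "k \<in> cs_carrier A" "cs_star A k = k" "2 \<odot>\<^bsub>A\<^esub> k = ?h \<oplus>\<^bsub>A\<^esub> (k \<otimes>\<^bsub>A\<^esub> k)"
      "\<And>c. c \<in> cs_carrier A \<Longrightarrow> c \<otimes>\<^bsub>A\<^esub> ?h = ?h \<otimes>\<^bsub>A\<^esub> c \<Longrightarrow> c \<otimes>\<^bsub>A\<^esub> k = k \<otimes>\<^bsub>A\<^esub> c"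
      using A.sqrt_one_minus[OF A.mult_closed[OF a(1) a(1)]] A.star_mult[OF a(1) a(1)] a(2) by metis
    define s l where "s = f a" and "l = f k"
    have c: "s \<in> cs_carrier B" "l \<in> cs_carrier B" using a k f' by (simp_all add: s_def l_def)
    have st: "cs_star B s = s" "cs_star B l = l" using a k f'(5) by (simp_all add: s_def l_def flip: f'(5))
    have sq: "2 \<odot>\<^bsub>B\<^esub> l = (s \<otimes>\<^bsub>B\<^esub> s) \<oplus>\<^bsub>B\<^esub> (l \<otimes>\<^bsub>B\<^esub> l)"
      using arg_cong[OF k(3), of f] a k(1) by (simp add: f' s_def l_def A.closed)
    have "s \<otimes>\<^bsub>B\<^esub> l = l \<otimes>\<^bsub>B\<^esub> s"
      using arg_cong[OF k(4)[OF a(1)], of f] a k(1) by (simp add: f' s_def l_def A.mult_assoc)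
    then have ls: "s \<otimes>\<^bsub>B\<^esub> (l \<otimes>\<^bsub>B\<^esub> b) = l \<otimes>\<^bsub>B\<^esub> (s \<otimes>\<^bsub>B\<^esub> b)" if "b \<in> cs_carrier B" for b
      using that c by (simp flip: B.mult_assoc)
    \<comment> \<open>Formally \<open>s\<close> and \<open>1 - l\<close> have squares adding up to
      1. Everything is multiplied by \<open>s\<close> to avoid the unit: \<open>s^2\<close> and
      \<open>(1 - l)s\<close> have squares adding up to \<open>s^2\<close>. The resulting bound on
      the norm of \<open>s^2\<close> forces the norm of \<open>s\<close> to be at most 1.\<close>
    have "cs_norm B (s \<otimes>\<^bsub>B\<^esub> s) \<le> cs_norm B s"
    proof (rule B.norm_le_rotation)
      let ?y = "s \<ominus>\<^bsub>B\<^esub> (l \<otimes>\<^bsub>B\<^esub> s)"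
      show "cs_star B (s \<otimes>\<^bsub>B\<^esub> s) \<otimes>\<^bsub>B\<^esub> ?y = cs_star B ?y \<otimes>\<^bsub>B\<^esub> (s \<otimes>\<^bsub>B\<^esub> s)"
        using c st by (simp add: B.diff_star B.diff_mult_left B.diff_mult_right B.star_mult
            B.mult_assoc B.closed ls)
      define m q p u where "m = s \<otimes>\<^bsub>B\<^esub> (l \<otimes>\<^bsub>B\<^esub> s)" and "q = s \<otimes>\<^bsub>B\<^esub> (l \<otimes>\<^bsub>B\<^esub> (l \<otimes>\<^bsub>B\<^esub> s))"
        and "p = s \<otimes>\<^bsub>B\<^esub> (s \<otimes>\<^bsub>B\<^esub> (s \<otimes>\<^bsub>B\<^esub> s))" and "u = s \<otimes>\<^bsub>B\<^esub> s"
      have mc: "m \<in> cs_carrier B" "q \<in> cs_carrier B" "p \<in> cs_carrier B" "u \<in> cs_carrier B"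
        using c by (simp_all add: m_def q_def p_def u_def B.closed)
      have "s \<otimes>\<^bsub>B\<^esub> ((2 \<odot>\<^bsub>B\<^esub> l) \<otimes>\<^bsub>B\<^esub> s) = p \<oplus>\<^bsub>B\<^esub> q"
        unfolding sq using c
        by (simp add: p_def q_def B.mult_add_left B.mult_add_right B.mult_assoc B.closed)
      then have "2 \<odot>\<^bsub>B\<^esub> m = p \<oplus>\<^bsub>B\<^esub> q"
        using c by (simp add: m_def B.mult_scale_left B.mult_scale_right B.closed)
      then have "p \<oplus>\<^bsub>B\<^esub> ((u \<ominus>\<^bsub>B\<^esub> m) \<ominus>\<^bsub>B\<^esub> (m \<ominus>\<^bsub>B\<^esub> q)) = u"
        using mc by (intro B.cancel_double)
      moreover have "cs_star B ?y \<otimes>\<^bsub>B\<^esub> ?y = (u \<ominus>\<^bsub>B\<^esub> m) \<ominus>\<^bsub>B\<^esub> (m \<ominus>\<^bsub>B\<^esub> q)"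
        using c st by (simp add: B.diff_star B.diff_mult_left B.diff_mult_right B.star_mult
            B.mult_assoc B.closed m_def q_def u_def)
      ultimately show "(cs_star B (s \<otimes>\<^bsub>B\<^esub> s) \<otimes>\<^bsub>B\<^esub> (s \<otimes>\<^bsub>B\<^esub> s)) \<oplus>\<^bsub>B\<^esub> (cs_star B ?y \<otimes>\<^bsub>B\<^esub> ?y)
          = cs_star B s \<otimes>\<^bsub>B\<^esub> s"
        using c st by (simp add: B.star_mult B.mult_assoc B.closed p_def u_def)
    qed (use c B.closed in auto)
    then have "(cs_norm B s)\<^sup>2 \<le> cs_norm B s" using B.norm_cstar[OF c(1)] st by simp
    then show ?thesis using B.norm_nonneg[OF c(1)]
      by (cases "cs_norm B s = 0") (auto simp: s_def power2_eq_square mult_le_cancel_left2)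
  qed
  have sa: "cs_norm B (f a) \<le> cs_norm A a" if a: "a \<in> cs_carrier A" "cs_star A a = a" for a
  proof (rule field_le_epsilon)
    fix e :: real assume e: "e > 0"
    define t where "t = 1 / (cs_norm A a + e)"
    have t: "t > 0" "t * (cs_norm A a + e) = 1"
      using e A.norm_nonneg[OF a(1)] by (simp_all add: t_def)
    have "cs_norm B (f (complex_of_real t \<odot>\<^bsub>A\<^esub> a)) \<le> 1"
    proof (rule unit)
      show "cs_norm A (complex_of_real t \<odot>\<^bsub>A\<^esub> a) < 1"
        using a(1) t mult_strict_left_mono[of "cs_norm A a" "cs_norm A a + e" t] e
        by (simp add: A.norm_scale)
    qed (use a A.scale_closed A.star_scale in simp_all)
    moreover have "cs_norm B (f (complex_of_real t \<odot>\<^bsub>A\<^esub> a)) = t * cs_norm B (f a)"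
      using a(1) t(1) f'(1,3) by (simp add: B.norm_scale)
    ultimately have "t * cs_norm B (f a) \<le> t * (cs_norm A a + e)"
      unfolding t(2) by (simp only:)
    then show "cs_norm B (f a) \<le> cs_norm A a + e" using t(1) by simp
  qed
  have "cs_norm B (f (cs_star A a \<otimes>\<^bsub>A\<^esub> a)) \<le> cs_norm A (cs_star A a \<otimes>\<^bsub>A\<^esub> a)"
    using a by (intro sa) (simp_all add: A.closed A.star_mult A.star_star)
  then have "(cs_norm B (f a))\<^sup>2 \<le> (cs_norm A a)\<^sup>2"
    using a by (simp add: f' A.closed A.norm_cstar B.norm_cstar)
  then show ?thesis using A.norm_nonneg[OF a] by (rule power2_le_imp_le)
qed


section \<open>Closed ideals and quotients\<close>

lemma closed_idealD:
  assumes "closed_ideal A I"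
  shows "i \<in> I \<Longrightarrow> i \<in> cs_carrier A" "\<zero>\<^bsub>A\<^esub> \<in> I"
    and "\<lbrakk>i \<in> I; k \<in> I\<rbrakk> \<Longrightarrow> i \<oplus>\<^bsub>A\<^esub> k \<in> I" "i \<in> I \<Longrightarrow> c \<odot>\<^bsub>A\<^esub> i \<in> I"
    and "\<lbrakk>i \<in> I; a \<in> cs_carrier A\<rbrakk> \<Longrightarrow> a \<otimes>\<^bsub>A\<^esub> i \<in> I" "\<lbrakk>i \<in> I; a \<in> cs_carrier A\<rbrakk> \<Longrightarrow> i \<otimes>\<^bsub>A\<^esub> a \<in> I"
    and "a \<in> norm_closure A I \<Longrightarrow> a \<in> I"
  using assms unfolding closed_ideal_def linear_subspace_def by blast+

text \<open>A Lipschitz map pulls closed sets back to closed sets. Applied to the involution, to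
  *-morphisms and to the action of functions, it lets inclusions of generated closed ideals be
  checked on generators.\<close>

lemma norm_closure_lipschitz_preimage:
  assumes T: "T \<in> cs_carrier A \<rightarrow> cs_carrier B"
    and lip: "\<And>x y. \<lbrakk>x \<in> cs_carrier A; y \<in> cs_carrier A\<rbrakk>
      \<Longrightarrow> cs_norm B (T x \<ominus>\<^bsub>B\<^esub> T y) \<le> c * cs_norm A (x \<ominus>\<^bsub>A\<^esub> y)"
    and c: "0 \<le> c" and J: "norm_closure B J \<subseteq> J"
  shows "norm_closure A {a \<in> cs_carrier A. T a \<in> J} \<subseteq> {a \<in> cs_carrier A. T a \<in> J}"
proof
  fix a assume a: "a \<in> norm_closure A {a \<in> cs_carrier A. T a \<in> J}"
  then have aC: "a \<in> cs_carrier A" by (simp add: norm_closure_def)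
  have "\<exists>s\<in>J. cs_norm B (T a \<ominus>\<^bsub>B\<^esub> s) < e" if e: "e > 0" for e
  proof -
    \<comment> \<open>Adding 1 keeps the denominator positive when \<open>c = 0\<close>.\<close>
    define d where "d = e / (c + 1)"
    have d: "d > 0" "c * d < e" using e c by (simp_all add: d_def field_simps)
    then obtain x where x: "x \<in> cs_carrier A" "T x \<in> J" "cs_norm A (a \<ominus>\<^bsub>A\<^esub> x) < d"
      using a by (auto simp: norm_closure_def)
    have "c * cs_norm A (a \<ominus>\<^bsub>A\<^esub> x) \<le> c * d" using x(3) c by (intro mult_left_mono) auto
    then have "c * cs_norm A (a \<ominus>\<^bsub>A\<^esub> x) < e" using d by simp
    then show ?thesis using lip[OF aC x(1)] x(2) by (intro bexI[of _ "T x"]) auto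
  qed
  then show "a \<in> {a \<in> cs_carrier A. T a \<in> J}"
    using aC T J by (auto simp: norm_closure_def Pi_iff)
qed

context cstar_algebra
begin

lemma closed_ideal_carrier: "closed_ideal A (cs_carrier A)"
  by (auto simp: closed_ideal_def linear_subspace_def norm_closure_def closed)

lemma closed_ideal_generated:
  assumes "G \<subseteq> cs_carrier A"
  shows "closed_ideal A (generated_closed_ideal A G)" "G \<subseteq> generated_closed_ideal A G"
proof -
  let ?F = "{I. closed_ideal A I \<and> G \<subseteq> I}"
  have ne: "cs_carrier A \<in> ?F" using assms closed_ideal_carrier by simp
  have sub: "norm_closure A (\<Inter>?F) \<subseteq> norm_closure A I" if "I \<in> ?F" for I
    using that by (fastforce simp: norm_closure_def)
  have "norm_closure A (\<Inter>?F) \<subseteq> I" if "I \<in> ?F" for I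
  proof -
    have "norm_closure A I \<subseteq> I" using that by (simp add: closed_ideal_def)
    then show ?thesis using sub[OF that] by (rule subset_trans[rotated])
  qed
  then have "norm_closure A (\<Inter>?F) \<subseteq> \<Inter>?F" by blast
  moreover have "\<Inter>?F \<subseteq> cs_carrier A" using ne by blast
  ultimately show "closed_ideal A (generated_closed_ideal A G)"
    unfolding generated_closed_ideal_def closed_ideal_def[of _ "\<Inter>_"] linear_subspace_def[of _ "\<Inter>_"]
    by (auto simp: closed_idealD)
  show "G \<subseteq> generated_closed_ideal A G" by (auto simp: generated_closed_ideal_def)
qed

lemma generated_closed_ideal_least:
  "\<lbrakk>closed_ideal A I; G \<subseteq> I\<rbrakk> \<Longrightarrow> generated_closed_ideal A G \<subseteq> I"
  by (auto simp: generated_closed_ideal_def)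

lemma closed_ideal_star_preimage:
  assumes I: "closed_ideal A I"
  shows "closed_ideal A {a \<in> cs_carrier A. cs_star A a \<in> I}"
proof -
  have "norm_closure A {a \<in> cs_carrier A. cs_star A a \<in> I} \<subseteq> {a \<in> cs_carrier A. cs_star A a \<in> I}"
    by (rule norm_closure_lipschitz_preimage[where c=1 and B=A])
      (use I in \<open>auto simp: closed norm_star closed_ideal_def simp flip: diff_star\<close>)
  then show ?thesis
    using closed_idealD[OF I] unfolding closed_ideal_def linear_subspace_def
    by (auto simp: closed star_zero star_add star_scale star_mult)
qed

text \<open>\<open>closed_ideal\<close> does not ask for stability under the involution. The
  elements whose adjoint lies in the generated ideal form a closed ideal containing
  \<open>G\<close>, hence contain the generated ideal.\<close>

lemma generated_closed_ideal_star:
  assumes G: "G \<subseteq> cs_carrier A" "\<And>g. g \<in> G \<Longrightarrow> cs_star A g \<in> G"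
    and i: "i \<in> generated_closed_ideal A G"
  shows "cs_star A i \<in> generated_closed_ideal A G"
proof -
  note gen = closed_ideal_generated[OF G(1)]
  have "generated_closed_ideal A G \<subseteq> {a \<in> cs_carrier A. cs_star A a \<in> generated_closed_ideal A G}"
    using gen G by (intro generated_closed_ideal_least closed_ideal_star_preimage) blast+
  then show ?thesis using i by blast
qed

lemma closed_ideal_zero: "closed_ideal A {\<zero>}"
proof -
  have "a = \<zero>" if a: "a \<in> norm_closure A {\<zero>}" for a
  proof -
    have aC: "a \<in> cs_carrier A" using a by (simp add: norm_closure_def)
    then have "a \<ominus> \<zero> = a" by (simp add: cs_diff_def scale_zero_right add_zero)
    then have "cs_norm A a < e" if "e > 0" for e
      using a that by (auto simp: norm_closure_def)
    then have "cs_norm A a \<le> 0" by (meson leI less_irrefl)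
    then show ?thesis using norm_eq_zero[OF aC] norm_nonneg[OF aC] by simp
  qed
  then show ?thesis
    by (auto simp: closed_ideal_def linear_subspace_def closed add_zero scale_zero_right
        mult_zero_l mult_zero_r)
qed

end

lemma closed_ideal_morphism_preimage:
  assumes A: "cstar_algebra A" and B: "cstar_algebra B" and f: "star_morphism A B f"
    and J: "closed_ideal B J"
  shows "closed_ideal A {a \<in> cs_carrier A. f a \<in> J}"
proof -
  interpret A: cstar_algebra A by fact
  have "norm_closure A {a \<in> cs_carrier A. f a \<in> J} \<subseteq> {a \<in> cs_carrier A. f a \<in> J}"
  proof (rule norm_closure_lipschitz_preimage[where c=1 and B=B])
    show "cs_norm B (f x \<ominus>\<^bsub>B\<^esub> f y) \<le> 1 * cs_norm A (x \<ominus>\<^bsub>A\<^esub> y)"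
      if "x \<in> cs_carrier A" "y \<in> cs_carrier A" for x y
      using star_morphism_contractive[OF A B f, of "x \<ominus>\<^bsub>A\<^esub> y"] star_morphism_diff[OF A f that] that
      by (simp add: A.closed)
  qed (use J star_morphismD[OF f] in \<open>auto simp: closed_ideal_def\<close>)
  then show ?thesis
    unfolding closed_ideal_def linear_subspace_def
    by (auto simp: A.closed star_morphismD[OF f] star_morphism_zero[OF A B f] closed_idealD(2-6)[OF J])
qed

text \<open>Every closed ideal is stable under the involution, but the general proof uses
  approximate units. For restriction ideals stability is read off the generators, for fibre ideals
  it comes from conjugating peak functions.\<close>

locale star_ideal = cstar_algebra +
  fixes I
  assumes ideal: "closed_ideal A I"
    and star_ideal: "i \<in> I \<Longrightarrow> cs_star A i \<in> I"
begin

abbreviation Q where "Q \<equiv> cs_quotient A I"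
abbreviation coset where "coset \<equiv> cs_coset A I"

lemmas ideal_simps = closed_idealD[OF ideal]

lemma quotient_carrier: "cs_carrier Q = coset ` cs_carrier A"
  by (simp add: cs_quotient_def)

lemma quotient_zero: "\<zero>\<^bsub>Q\<^esub> = coset \<zero>"
  by (simp add: cs_quotient_def)

lemma coset_add:
  "\<lbrakk>a \<in> cs_carrier A; b \<in> cs_carrier A\<rbrakk> \<Longrightarrow> coset a \<oplus>\<^bsub>Q\<^esub> coset b = coset (a \<oplus> b)"
  by (rule coset_ops[OF cstar_algebra_axioms ideal])

lemma coset_scale: "a \<in> cs_carrier A \<Longrightarrow> c \<odot>\<^bsub>Q\<^esub> coset a = coset (c \<odot> a)"
  by (rule coset_ops[OF cstar_algebra_axioms ideal])

lemma coset_mult: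
  "\<lbrakk>a \<in> cs_carrier A; b \<in> cs_carrier A\<rbrakk> \<Longrightarrow> coset a \<otimes>\<^bsub>Q\<^esub> coset b = coset (a \<otimes> b)"
  by (rule coset_ops[OF cstar_algebra_axioms ideal])

lemma coset_star: "a \<in> cs_carrier A \<Longrightarrow> cs_star Q (coset a) = coset (cs_star A a)"
  using coset_ops(4)[OF cstar_algebra_axioms ideal _ zero_closed star_ideal] by simp

lemmas coset_hom = coset_add coset_scale coset_mult coset_star

lemma coset_diff:
  "\<lbrakk>a \<in> cs_carrier A; b \<in> cs_carrier A\<rbrakk> \<Longrightarrow> coset a \<ominus>\<^bsub>Q\<^esub> coset b = coset (a \<ominus> b)"
  by (simp add: cs_diff_def coset_hom closed)

lemma coset_self: "a \<in> cs_carrier A \<Longrightarrow> a \<in> coset a"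
  using ideal_simps(2) add_zero[of a] by (force simp: cs_coset_def)

lemma coset_eq_iff:
  assumes "a \<in> cs_carrier A" "b \<in> cs_carrier A"
  shows "coset a = coset b \<longleftrightarrow> a \<ominus> b \<in> I"
proof
  assume "coset a = coset b"
  then have "a \<in> coset b" using coset_self[OF assms(1)] by simp
  then obtain i where i: "i \<in> I" "a = b \<oplus> i" by (auto simp: cs_coset_def)
  then have "a \<ominus> b = i"
    using assms ideal_simps(1)[OF i(1)] diff_add_cancel[of a b] add_cancel[of b "a \<ominus> b" i]
    by (simp add: add_commute closed)
  then show "a \<ominus> b \<in> I" using i by simp
next
  assume ab: "a \<ominus> b \<in> I"
  have ba: "b \<ominus> a \<in> I" using ideal_simps(4)[OF ab, of "-1"] diff_swap[of b a] assms by simp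
  have sub: "coset x \<subseteq> coset y" if "x \<in> cs_carrier A" "y \<in> cs_carrier A" "x \<ominus> y \<in> I" for x y
  proof
    fix z assume "z \<in> coset x"
    then obtain i where i: "i \<in> I" "z = x \<oplus> i" by (auto simp: cs_coset_def)
    have "y \<oplus> ((x \<ominus> y) \<oplus> i) = (y \<oplus> (x \<ominus> y)) \<oplus> i"
      using that i ideal_simps(1) closed add_assoc by simp
    then have "z = y \<oplus> ((x \<ominus> y) \<oplus> i)"
      using that i by (simp add: add_diff_cancel)
    then show "z \<in> coset y" using that(3) i ideal_simps(3) by (auto simp: cs_coset_def)
  qed
  show "coset a = coset b" using sub assms ab ba by blast
qed

lemma coset_eq_zero_iff: "a \<in> cs_carrier A \<Longrightarrow> coset a = \<zero>\<^bsub>Q\<^esub> \<longleftrightarrow> a \<in> I"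
  using coset_eq_iff[of a \<zero>]
  by (simp add: quotient_zero zero_closed cs_diff_def scale_zero_right add_zero)

section \<open>Norm and completeness of the quotient\<close>

lemma coset_norm_le:
  assumes "a \<in> cs_carrier A"
  shows "cs_norm Q (coset a) \<le> cs_norm A a"
proof -
  have "cs_norm A ` coset a \<subseteq> {0..}"
    using assms ideal_simps(1) by (auto simp: cs_coset_def intro!: norm_nonneg closed)
  then have "bdd_below (cs_norm A ` coset a)" by (meson bdd_below_Ici bdd_below_mono)
  then show ?thesis using coset_self[OF assms] by (simp add: cs_quotient_def cInf_lower)
qed

lemma coset_norm_nonneg: "P \<in> cs_carrier Q \<Longrightarrow> 0 \<le> cs_norm Q P"
  using coset_self ideal_simps(1)
  by (auto simp: cs_quotient_def cs_coset_def intro!: cInf_greatest norm_nonneg closed)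

lemma coset_norm_lessE:
  assumes P: "P \<in> cs_carrier Q" and less: "cs_norm Q P < r"
  obtains a where "a \<in> cs_carrier A" "P = coset a" "cs_norm A a < r"
proof -
  obtain b where b: "b \<in> cs_carrier A" "P = coset b" using P by (auto simp: quotient_carrier)
  have "\<exists>x\<in>cs_norm A ` coset b. x < r"
    using less b coset_self by (intro cInf_lessD) (auto simp: cs_quotient_def)
  then obtain i where i: "i \<in> I" "cs_norm A (b \<oplus> i) < r" by (auto simp: cs_coset_def)
  have "coset (b \<oplus> i) = coset b"
    using b i ideal_simps(1) add_diff_add[of b i b \<zero>]
    by (subst coset_eq_iff) (auto simp: closed diff_self zero_add add_zero cs_diff_def
        scale_zero_right add_ac add_minus)
  then show ?thesis using that[of "b \<oplus> i"] b i ideal_simps(1) closed by simp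
qed

lemma star_morphism_coset: "star_morphism A Q coset"
  by (auto simp: star_morphism_def quotient_carrier coset_hom)

lemma quotient_norm_triangle:
  assumes P: "P \<in> cs_carrier Q" and R: "R \<in> cs_carrier Q"
  shows "cs_norm Q (P \<oplus>\<^bsub>Q\<^esub> R) \<le> cs_norm Q P + cs_norm Q R"
proof (rule field_le_epsilon)
  fix e :: real assume e: "e > 0"
  obtain a where a: "a \<in> cs_carrier A" "P = coset a" "cs_norm A a < cs_norm Q P + e/2"
    using coset_norm_lessE[OF P, of "cs_norm Q P + e/2"] e by auto
  obtain b where b: "b \<in> cs_carrier A" "R = coset b" "cs_norm A b < cs_norm Q R + e/2"
    using coset_norm_lessE[OF R, of "cs_norm Q R + e/2"] e by auto
  have "cs_norm Q (P \<oplus>\<^bsub>Q\<^esub> R) \<le> cs_norm A (a \<oplus> b)"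
    using a b coset_norm_le[of "a \<oplus> b"] by (simp add: coset_hom closed)
  also have "\<dots> \<le> cs_norm A a + cs_norm A b" using a b by (simp add: norm_triangle)
  finally show "cs_norm Q (P \<oplus>\<^bsub>Q\<^esub> R) \<le> cs_norm Q P + cs_norm Q R + e" using a b by simp
qed

lemma quotient_norm_mult:
  assumes P: "P \<in> cs_carrier Q" and R: "R \<in> cs_carrier Q"
  shows "cs_norm Q (P \<otimes>\<^bsub>Q\<^esub> R) \<le> cs_norm Q P * cs_norm Q R"
proof -
  have "cs_norm Q (P \<otimes>\<^bsub>Q\<^esub> R) \<le> (cs_norm Q P + e) * (cs_norm Q R + e)" if e: "e > 0" for e
  proof -
    obtain a where a: "a \<in> cs_carrier A" "P = coset a" "cs_norm A a < cs_norm Q P + e"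
      using coset_norm_lessE[OF P, of "cs_norm Q P + e"] e by auto
    obtain b where b: "b \<in> cs_carrier A" "R = coset b" "cs_norm A b < cs_norm Q R + e"
      using coset_norm_lessE[OF R, of "cs_norm Q R + e"] e by auto
    have "cs_norm Q (P \<otimes>\<^bsub>Q\<^esub> R) \<le> cs_norm A (a \<otimes> b)"
      using a b coset_norm_le[of "a \<otimes> b"] by (simp add: coset_hom closed)
    also have "\<dots> \<le> cs_norm A a * cs_norm A b" using a b by (simp add: norm_mult)
    also have "\<dots> \<le> (cs_norm Q P + e) * (cs_norm Q R + e)"
      using a b by (intro mult_mono) (auto simp: norm_nonneg intro: order_trans[OF norm_nonneg])
    finally show ?thesis .
  qed
  then have "\<forall>\<^sub>F e in at_right 0. cs_norm Q (P \<otimes>\<^bsub>Q\<^esub> R) \<le> (cs_norm Q P + e) * (cs_norm Q R + e)"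
    by (simp add: eventually_at_right_less eventually_mono[OF eventually_at_right_less])
  moreover have "((\<lambda>e. (cs_norm Q P + e) * (cs_norm Q R + e)) \<longlongrightarrow>
      (cs_norm Q P + 0) * (cs_norm Q R + 0)) (at_right 0)"
    by (intro tendsto_intros)
  ultimately show ?thesis
    by (intro tendsto_lowerbound[where F="at_right (0::real)"]) auto
qed

lemma quotient_norm_scale:
  assumes P: "P \<in> cs_carrier Q"
  shows "cs_norm Q (c \<odot>\<^bsub>Q\<^esub> P) = cmod c * cs_norm Q P"
proof -
  have le: "cs_norm Q (c \<odot>\<^bsub>Q\<^esub> P) \<le> cmod c * cs_norm Q P" if P: "P \<in> cs_carrier Q" for c P
  proof (rule field_le_epsilon)
    fix e :: real assume e: "e > 0"
    define d where "d = e / (cmod c + 1)"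
    have d: "d > 0" "cmod c * d \<le> e"
      using e by (simp_all add: d_def add_nonneg_pos pos_divide_le_eq mult.commute mult_left_mono)
    obtain a where a: "a \<in> cs_carrier A" "P = coset a" "cs_norm A a < cs_norm Q P + d"
      using coset_norm_lessE[OF P, of "cs_norm Q P + d"] d by auto
    have "cs_norm Q (c \<odot>\<^bsub>Q\<^esub> P) \<le> cmod c * cs_norm A a"
      using a coset_norm_le[of "c \<odot> a"]
      by (simp add: coset_hom closed norm_scale)
    also have "\<dots> \<le> cmod c * (cs_norm Q P + d)" using a by (intro mult_left_mono) auto
    finally show "cs_norm Q (c \<odot>\<^bsub>Q\<^esub> P) \<le> cmod c * cs_norm Q P + e" using d by (simp add: algebra_simps)
  qed
  obtain a where a: "a \<in> cs_carrier A" "P = coset a" using P by (auto simp: quotient_carrier)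
  have cP: "c \<odot>\<^bsub>Q\<^esub> P \<in> cs_carrier Q"
    using a by (simp add: quotient_carrier coset_hom closed)
  show ?thesis
  proof (cases "c = 0")
    case True
    then show ?thesis using le[OF P, of c] coset_norm_nonneg[OF cP] by simp
  next
    case False
    have "inverse c \<odot>\<^bsub>Q\<^esub> (c \<odot>\<^bsub>Q\<^esub> P) = P"
      using a False by (simp add: coset_hom closed scale_scale scale_one)
    then have "cs_norm Q P \<le> inverse (cmod c) * cs_norm Q (c \<odot>\<^bsub>Q\<^esub> P)"
      using le[OF cP, of "inverse c"] by (simp add: norm_inverse)
    then show ?thesis using le[OF P, of c] False by (simp add: field_simps)
  qed
qed

lemma quotient_norm_eq_zero:
  assumes P: "P \<in> cs_carrier Q"
  shows "cs_norm Q P = 0 \<longleftrightarrow> P = \<zero>\<^bsub>Q\<^esub>"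
proof
  assume "P = \<zero>\<^bsub>Q\<^esub>"
  then show "cs_norm Q P = 0"
    using coset_norm_le[OF zero_closed] coset_norm_nonneg[OF P] by (simp add: quotient_zero norm_zero)
next
  assume 0: "cs_norm Q P = 0"
  obtain a where a: "a \<in> cs_carrier A" "P = coset a" using P by (auto simp: quotient_carrier)
  have "\<exists>i\<in>I. cs_norm A (a \<ominus> i) < e" if e: "e > 0" for e
  proof -
    obtain b where b: "b \<in> cs_carrier A" "P = coset b" "cs_norm A b < e"
      using coset_norm_lessE[OF P, of e] 0 e by metis
    then have "a \<ominus> b \<in> I" using a coset_eq_iff[of a b] by simp
    moreover have "a \<ominus> (a \<ominus> b) = b"
      using a b by (subst diff_swap[of a b])
        (simp_all add: cs_diff_def[of A a] scale_scale scale_one closed add_diff_cancel)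
    ultimately show ?thesis using b(3) by (intro bexI[of _ "a \<ominus> b"]) auto
  qed
  then have "a \<in> I" using a(1) ideal_simps(7) by (simp add: norm_closure_def)
  then show "P = \<zero>\<^bsub>Q\<^esub>" using a coset_eq_zero_iff by simp
qed

text \<open>A Cauchy sequence of cosets has a subsequence with successive distances below
  \<open>(1/2)^k\<close>. Each difference has a representative of that size, and adding these
  representatives one by one lifts the subsequence to a convergent sequence in
  \<open>A\<close>.\<close>

lemma quotient_complete:
  assumes S: "\<And>n::nat. S n \<in> cs_carrier Q"
    and C: "\<And>e. e > 0 \<Longrightarrow> \<exists>N. \<forall>m\<ge>N. \<forall>n\<ge>N. cs_norm Q (S m \<ominus>\<^bsub>Q\<^esub> S n) < e"
  shows "\<exists>L\<in>cs_carrier Q. cs_tendsto Q S L"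
proof -
  have "\<exists>N. \<forall>m\<ge>N. \<forall>n\<ge>N. cs_norm Q (S m \<ominus>\<^bsub>Q\<^esub> S n) < (1/2)^k" for k by (rule C) simp
  then obtain N where N: "\<And>k m n. \<lbrakk>m \<ge> N k; n \<ge> N k\<rbrakk> \<Longrightarrow> cs_norm Q (S m \<ominus>\<^bsub>Q\<^esub> S n) < (1/2)^k"
    by metis
  \<comment> \<open>The partial sums satisfy \<open>r k \<ge> N k\<close> and
    \<open>r (Suc k) \<ge> N k\<close>, so two consecutive indices are both admissible for
    \<open>N k\<close>.\<close>
  define r where "r k = (\<Sum>i\<le>k. N i)" for k
  have r: "r k \<ge> N k" "r (Suc k) \<ge> N k" for k
    by (simp_all add: r_def member_le_sum trans_le_add1)
  have "\<exists>b. \<forall>k. (b k \<in> cs_carrier A \<and> coset (b k) = S (r k)) \<and>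
      cs_norm A (b (Suc k) \<ominus> b k) \<le> (1/2)^k"
  proof (rule dependent_nat_choice)
    show "\<exists>a. a \<in> cs_carrier A \<and> coset a = S (r 0)"
      using S[of "r 0"] by (auto simp: quotient_carrier)
    fix a k assume a: "a \<in> cs_carrier A \<and> coset a = S (r k)"
    have "S (r (Suc k)) \<ominus>\<^bsub>Q\<^esub> S (r k) \<in> cs_carrier Q"
    proof -
      obtain c where "c \<in> cs_carrier A" "S (r (Suc k)) = coset c"
        using S[of "r (Suc k)"] by (auto simp: quotient_carrier)
      then show ?thesis using a by (metis coset_diff diff_closed imageI quotient_carrier)
    qed
    then obtain d where d: "d \<in> cs_carrier A" "S (r (Suc k)) \<ominus>\<^bsub>Q\<^esub> S (r k) = coset d"
      "cs_norm A d < (1/2)^k"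
      using coset_norm_lessE N[OF r(2) r(1)] by metis
    obtain c where c: "c \<in> cs_carrier A" "S (r (Suc k)) = coset c"
      using S[of "r (Suc k)"] by (auto simp: quotient_carrier)
    have "coset c = coset (a \<oplus> (c \<ominus> a))" using a c by (simp add: add_diff_cancel)
    also have "\<dots> = coset (a \<oplus> d)"
      using a c d by (metis coset_diff coset_add diff_closed)
    finally have "coset (a \<oplus> d) = S (r (Suc k))" using c by simp
    moreover have "(a \<oplus> d) \<ominus> a = d"
      using a d add_diff_cancel[of a "a \<oplus> d"] add_cancel[of a "(a \<oplus> d) \<ominus> a" d] by (simp add: closed)
    ultimately show "\<exists>b. (b \<in> cs_carrier A \<and> coset b = S (r (Suc k))) \<and>
        cs_norm A (b \<ominus> a) \<le> (1/2)^k"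
      using a d by (intro exI[of _ "a \<oplus> d"]) (auto simp: closed)
  qed
  then obtain b where b: "\<And>k. b k \<in> cs_carrier A" "\<And>k. coset (b k) = S (r k)"
    "\<And>k. cs_norm A (b (Suc k) \<ominus> b k) \<le> 1 * (1/2)^k" by auto
  obtain l where l: "l \<in> cs_carrier A" "cs_tendsto A b l"
    using complete_geometric[OF b(1) _ _ b(3)] by auto
  have "cs_tendsto Q S (coset l)"
  proof (rule LIMSEQ_I)
    fix e :: real assume e: "e > 0"
    have "\<forall>\<^sub>F k in sequentially. (1/2::real)^k < e/2"
      using e by (intro order_tendstoD(2)[OF LIMSEQ_realpow_zero]) auto
    moreover have "\<forall>\<^sub>F k in sequentially. cs_norm A (b k \<ominus> l) < e/2"
      using e by (intro order_tendstoD(2)[OF l(2)]) auto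
    ultimately have "\<forall>\<^sub>F k in sequentially. (1/2::real)^k < e/2 \<and> cs_norm A (b k \<ominus> l) < e/2"
      by (rule eventually_conj)
    then obtain k where k: "(1/2::real)^k < e/2" "cs_norm A (b k \<ominus> l) < e/2"
      by (auto simp: eventually_sequentially)
    have "cs_norm Q (S n \<ominus>\<^bsub>Q\<^esub> coset l) < e" if n: "n \<ge> r k" for n
    proof -
      obtain c where c: "c \<in> cs_carrier A" "S n = coset c" using S[of n] by (auto simp: quotient_carrier)
      have "c \<ominus> l = (c \<ominus> b k) \<oplus> (b k \<ominus> l)" using b l c by (simp add: diff_trans)
      then have "S n \<ominus>\<^bsub>Q\<^esub> coset l = (S n \<ominus>\<^bsub>Q\<^esub> S (r k)) \<oplus>\<^bsub>Q\<^esub> coset (b k \<ominus> l)"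
        using b(1) l c by (simp add: coset_diff coset_hom closed flip: b(2))
      then have "cs_norm Q (S n \<ominus>\<^bsub>Q\<^esub> coset l)
          \<le> cs_norm Q (S n \<ominus>\<^bsub>Q\<^esub> S (r k)) + cs_norm Q (coset (b k \<ominus> l))"
        using b(1) l c quotient_norm_triangle[of "S n \<ominus>\<^bsub>Q\<^esub> S (r k)" "coset (b k \<ominus> l)"]
        by (simp add: coset_diff quotient_carrier closed flip: b(2))
      also have "\<dots> < e"
        using N[of k n "r k"] r(1)[of k] n k coset_norm_le[of "b k \<ominus> l"] b(1)[of k] l(1)
        by (simp add: closed)
      finally show ?thesis .
    qed
    moreover have "0 \<le> cs_norm Q (S n \<ominus>\<^bsub>Q\<^esub> coset l)" for n
    proof -
      obtain c where c: "c \<in> cs_carrier A" "S n = coset c" using S[of n] by (auto simp: quotient_carrier)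
      then show ?thesis using l by (auto simp: coset_diff quotient_carrier closed intro!: coset_norm_nonneg)
    qed
    ultimately show "\<exists>no. \<forall>n\<ge>no. norm (cs_norm Q (S n \<ominus>\<^bsub>Q\<^esub> coset l) - 0) < e" by auto
  qed
  then show ?thesis using l by (auto simp: quotient_carrier)
qed

text \<open>The C*-identity of the quotient norm needs almost minimal representatives, which exist for
  every closed ideal by means of approximate units; here they are a hypothesis.\<close>

lemma quotient_cstar:
  assumes approx: "\<And>b d e. \<lbrakk>b \<in> cs_carrier A; d \<in> cs_carrier A; d \<ominus> (cs_star A b \<otimes> b) \<in> I; e > 0\<rbrakk>
      \<Longrightarrow> \<exists>b'\<in>cs_carrier A. b' \<ominus> b \<in> I \<and> (cs_norm A b')\<^sup>2 \<le> cs_norm A d + e"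
  shows "cstar_algebra Q"
proof -
  have cstar: "cs_norm Q (cs_star Q P \<otimes>\<^bsub>Q\<^esub> P) = (cs_norm Q P)\<^sup>2" if P: "P \<in> cs_carrier Q" for P
  proof -
    obtain b where b: "b \<in> cs_carrier A" "P = coset b" using P by (auto simp: quotient_carrier)
    let ?R = "coset (cs_star A b \<otimes> b)"
    have eq: "cs_star Q P \<otimes>\<^bsub>Q\<^esub> P = ?R"
      using b by (simp add: coset_hom closed)
    have star: "cs_norm Q (cs_star Q P) \<le> cs_norm Q P"
    proof (rule field_le_epsilon)
      fix e :: real assume "e > 0"
      then obtain a where a: "a \<in> cs_carrier A" "P = coset a" "cs_norm A a < cs_norm Q P + e"
        using coset_norm_lessE[OF P, of "cs_norm Q P + e"] by auto
      then show "cs_norm Q (cs_star Q P) \<le> cs_norm Q P + e"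
        using coset_norm_le[of "cs_star A a"] by (simp add: coset_star closed norm_star)
    qed
    have "cs_norm Q ?R \<le> cs_norm Q (cs_star Q P) * cs_norm Q P"
      using quotient_norm_mult[of "cs_star Q P" P] P b eq by (simp add: coset_star quotient_carrier closed)
    also have "\<dots> \<le> (cs_norm Q P)\<^sup>2"
      using star coset_norm_nonneg[OF P] by (simp add: power2_eq_square mult_right_mono)
    finally have "cs_norm Q ?R \<le> (cs_norm Q P)\<^sup>2" .
    moreover have "(cs_norm Q P)\<^sup>2 \<le> cs_norm Q ?R"
    proof (rule field_le_epsilon)
      fix e :: real assume e: "e > 0"
      obtain d where d: "d \<in> cs_carrier A" "?R = coset d" "cs_norm A d < cs_norm Q ?R + e/2"
        using coset_norm_lessE[of ?R "cs_norm Q ?R + e/2"] e b by (auto simp: quotient_carrier closed)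
      \<comment> \<open>\<open>d\<close> is an almost minimal representative of the class of
        \<open>cs_star A b \<otimes> b\<close>; \<open>approx\<close> converts it into a
        representative of \<open>P\<close> whose squared norm is almost as small.\<close>
      then obtain b' where b': "b' \<in> cs_carrier A" "b' \<ominus> b \<in> I" "(cs_norm A b')\<^sup>2 \<le> cs_norm A d + e/2"
        using approx[OF b(1) d(1), of "e/2"] coset_eq_iff[of d "cs_star A b \<otimes> b"] b e by (auto simp: closed)
      then have "cs_norm Q P \<le> cs_norm A b'"
        using coset_norm_le[of b'] coset_eq_iff[of b' b] b by simp
      then have "(cs_norm Q P)\<^sup>2 \<le> (cs_norm A b')\<^sup>2"
        using coset_norm_nonneg[OF P] by (rule power_mono)
      then show "(cs_norm Q P)\<^sup>2 \<le> cs_norm Q ?R + e" using b' d by simp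
    qed
    ultimately show ?thesis using eq by simp
  qed
  show ?thesis
  proof (unfold_locales, goal_cases)
    case (28 s)
    then show ?case by (rule quotient_complete)
  next
    case (27 a)
    then show ?case by (rule cstar)
  next
    case (26 a b)
    then show ?case by (rule quotient_norm_mult)
  next
    case (25 a c)
    then show ?case by (rule quotient_norm_scale)
  next
    case (24 a b)
    then show ?case by (rule quotient_norm_triangle)
  next
    case (23 a)
    then show ?case by (rule quotient_norm_eq_zero)
  qed (auto simp: quotient_carrier quotient_zero coset_hom
      closed add_ac add_zero add_minus scale_add_right scale_add_left scale_scale scale_one
      mult_assoc mult_add_left mult_add_right mult_scale_left mult_scale_right star_star star_add
      star_scale star_mult)
qed

end

text \<open>Only the operations on cosets enter, so it applies to quotients for which no C*-identity
  is available, in particular to \<open>S_algebra\<close>.\<close>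

lemma star_morphism_induced:
  assumes I: "star_ideal A I" and J: "star_ideal B J"
    and f: "star_morphism A B f" "f ` I \<subseteq> J"
  shows "star_morphism (cs_quotient A I) (cs_quotient B J) (induced_map B J f)"
proof -
  interpret I: star_ideal A I by fact
  interpret J: star_ideal B J by fact
  have ind: "induced_map B J f (I.coset a) = J.coset (f a)" if "a \<in> cs_carrier A" for a
    using that by (intro induced_coset I.cstar_algebra_axioms J.cstar_algebra_axioms I.ideal J.ideal f)
  show ?thesis
    using star_morphismD[OF f(1)]
    by (auto simp: star_morphism_def I.quotient_carrier J.quotient_carrier ind I.coset_hom J.coset_hom I.closed)
qed


section \<open>Functions on the one-point compactification\<close>

text \<open>The unitization of \<open>C0_functions X\<close>, with \<open>None\<close> as the point
  at infinity. Values off the compactification are unconstrained, which is why functions are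
  compared through \<open>act_cong\<close> later on.\<close>

definition C1_functions :: "'x topology \<Rightarrow> ('x option \<Rightarrow> complex) set" where
  "C1_functions X = {G. continuous_map (Alexandroff_compactification X) euclidean G}"

definition vanishing_part :: "'x topology \<Rightarrow> ('x option \<Rightarrow> complex) \<Rightarrow> 'x \<Rightarrow> complex" where
  "vanishing_part X G = (\<lambda>x. if x \<in> topspace X then G (Some x) - G None else 0)"

definition extend_C0 :: "('x \<Rightarrow> complex) \<Rightarrow> 'x option \<Rightarrow> complex" where
  "extend_C0 f = case_option 0 f"

lemma extend_C0_simps [simp]: "extend_C0 f None = 0" "extend_C0 f (Some x) = f x"
  by (simp_all add: extend_C0_def)

lemma C1_const [simp]: "(\<lambda>z. c) \<in> C1_functions X"
  by (simp add: C1_functions_def)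

lemma C1_add: "\<lbrakk>G \<in> C1_functions X; H \<in> C1_functions X\<rbrakk> \<Longrightarrow> (\<lambda>z. G z + H z) \<in> C1_functions X"
  by (simp add: C1_functions_def continuous_map_add)

lemma C1_diff: "\<lbrakk>G \<in> C1_functions X; H \<in> C1_functions X\<rbrakk> \<Longrightarrow> (\<lambda>z. G z - H z) \<in> C1_functions X"
  by (simp add: C1_functions_def continuous_map_diff)

lemma C1_mult: "\<lbrakk>G \<in> C1_functions X; H \<in> C1_functions X\<rbrakk> \<Longrightarrow> (\<lambda>z. G z * H z) \<in> C1_functions X"
  by (simp add: C1_functions_def continuous_map_atin tendsto_mult)

lemma C1_compose:
  assumes "G \<in> C1_functions X" "continuous_on UNIV h"
  shows "(\<lambda>z. h (G z)) \<in> C1_functions X"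
  using assms continuous_map_compose[of "Alexandroff_compactification X" euclidean G euclidean h]
  by (simp add: C1_functions_def o_def)

lemma C1_sum:
  assumes "finite S" "\<And>s. s \<in> S \<Longrightarrow> G s \<in> C1_functions X"
  shows "(\<lambda>z. \<Sum>s\<in>S. G s z) \<in> C1_functions X"
  using assms by (induction S rule: finite_induct) (simp_all add: C1_add)

lemma C1_power: "G \<in> C1_functions X \<Longrightarrow> (\<lambda>z. G z ^ n) \<in> C1_functions X"
  by (induction n) (simp_all add: C1_mult)

lemma C1_cnj: "G \<in> C1_functions X \<Longrightarrow> (\<lambda>z. cnj (G z)) \<in> C1_functions X"
  by (rule C1_compose[where h=cnj]) (simp_all add: linear_continuous_on bounded_linear_cnj)

lemma C1_bounded:
  assumes "G \<in> C1_functions X"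
  obtains M where "M \<ge> 0" "\<And>z. z \<in> topspace (Alexandroff_compactification X) \<Longrightarrow> cmod (G z) \<le> M"
proof -
  have "compactin euclidean (G ` topspace (Alexandroff_compactification X))"
    using assms image_compactin compact_space_Alexandroff_compactification
    unfolding C1_functions_def compact_space_def by blast
  then have "bounded (G ` topspace (Alexandroff_compactification X))"
    by (intro compact_imp_bounded) simp
  then obtain M where "\<And>z. z \<in> topspace (Alexandroff_compactification X) \<Longrightarrow> cmod (G z) \<le> M"
    unfolding bounded_iff by blast
  then show ?thesis by (intro that[of "max M 0"]) (auto simp: le_max_iff_disj)
qed

text \<open>For \<open>e > 0\<close> the set where \<open>G - G None\<close> has modulus at least
  \<open>e\<close> is closed in the compactification and misses \<open>None\<close>. Such a set is
  the image of a closed compact subset of \<open>X\<close>.\<close>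

lemma vanishing_part_C0:
  assumes "G \<in> C1_functions X"
  shows "vanishing_part X G \<in> C0_functions X"
proof -
  let ?H = "\<lambda>z. G z - G None"
  have H: "continuous_map (Alexandroff_compactification X) euclidean ?H"
    using C1_diff[OF assms C1_const[of "G None"]] by (simp add: C1_functions_def)
  have "continuous_map X euclidean (\<lambda>x. ?H (Some x))"
    using continuous_map_compose[OF continuous_map_Some H] by (simp add: o_def)
  then have cont: "continuous_map X euclidean (vanishing_part X G)"
    by (rule continuous_map_eq) (simp add: vanishing_part_def)
  have comp: "compactin X {x \<in> topspace X. e \<le> cmod (vanishing_part X G x)}" if e: "e > 0" for e
  proof -
    let ?S = "{x \<in> topspace X. e \<le> cmod (vanishing_part X G x)}"
    have "closedin (Alexandroff_compactification X)
        {z \<in> topspace (Alexandroff_compactification X). ?H z \<in> {w. e \<le> cmod w}}"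
      by (rule closedin_continuous_map_preimage[OF H])
        (auto intro!: closed_Collect_le continuous_intros simp flip: closed_closedin)
    moreover have "{z \<in> topspace (Alexandroff_compactification X). ?H z \<in> {w. e \<le> cmod w}} = Some ` ?S"
      using e by (auto simp: vanishing_part_def)
    ultimately show ?thesis by simp
  qed
  show ?thesis using cont comp by (simp add: C0_functions_def vanishing_part_def)
qed

text \<open>Neighbourhoods of infinity are complements of closed compact sets. So the preimage of
  \<open>V\<close> is treated according to whether \<open>V\<close> contains 0, the value at
  infinity.\<close>

lemma extend_C0_C1:
  assumes X: "Hausdorff_space X" and f: "f \<in> C0_functions X"
  shows "extend_C0 f \<in> C1_functions X"
  unfolding C1_functions_def mem_Collect_eq continuous_map_def
proof (intro conjI allI impI)
  fix V :: "complex set" assume "openin euclidean V"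
  then have V: "open V" by simp
  have contf: "continuous_map X euclidean f" using f by (simp add: C0_functions_def)
  have op: "openin X {x \<in> topspace X. f x \<in> V}"
    using openin_continuous_map_preimage[OF contf] V by simp
  show "openin (Alexandroff_compactification X)
      {z \<in> topspace (Alexandroff_compactification X). extend_C0 f z \<in> V}" (is "openin _ ?P")
  proof (cases "0 \<in> V")
    case False
    then have "?P = Some ` {x \<in> topspace X. f x \<in> V}" by auto
    then show ?thesis using op by simp
  next
    case True
    then obtain e where e: "e > 0" "ball 0 e \<subseteq> V" using V open_contains_ball by blast
    let ?C = "{x \<in> topspace X. f x \<notin> V}"
    have clo: "closedin X ?C"
    proof -
      have "topspace X - {x \<in> topspace X. f x \<in> V} = ?C" by auto
      then show ?thesis using closedin_diff[OF closedin_topspace op] by (simp only:)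
    qed
    have "?C \<subseteq> {x \<in> topspace X. e \<le> cmod (f x)}"
    proof clarify
      fix x assume "f x \<notin> V"
      then have "f x \<notin> ball 0 e" using e by blast
      then show "e \<le> cmod (f x)" by simp
    qed
    moreover have "compactin X {x \<in> topspace X. e \<le> cmod (f x)}"
      using f e by (simp add: C0_functions_def)
    ultimately have "compactin X ?C" using clo closed_compactin by blast
    moreover have "?P = insert None (Some ` (topspace X - ?C))" using True by auto
    ultimately show ?thesis using clo by (auto simp: openin_Alexandroff_compactification)
  qed
qed auto

lemma vanishing_part_extend: "f \<in> C0_functions X \<Longrightarrow> vanishing_part X (extend_C0 f) = f"
  by (auto simp: vanishing_part_def C0_functions_def)


section \<open>The action of functions on a \<open>C\<^sub>0(X)\<close>-algebra\<close>

locale C0_module = cstar_algebra B for B :: "'b cstar" (structure) +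
  fixes X :: "'x topology" and \<theta> :: "('x, 'b) C0_structure"
  assumes Hausdorff: "Hausdorff_space X" and C0_algebra: "is_C0_algebra X B \<theta>"
begin

lemma C0_act_multiplier:
  assumes f: "f \<in> C0_functions X"
  shows "bounded_operator B (fst (\<theta> f))" "bounded_operator B (snd (\<theta> f))"
    and "\<lbrakk>a \<in> cs_carrier B; b \<in> cs_carrier B\<rbrakk> \<Longrightarrow> C0_act \<theta> f (a \<otimes> b) = C0_act \<theta> f a \<otimes> b"
    and "\<lbrakk>a \<in> cs_carrier B; b \<in> cs_carrier B\<rbrakk> \<Longrightarrow> C0_act \<theta> f (a \<otimes> b) = a \<otimes> C0_act \<theta> f b"
    and "\<lbrakk>a \<in> cs_carrier B; b \<in> cs_carrier B\<rbrakk> \<Longrightarrow> snd (\<theta> f) a \<otimes> b = a \<otimes> C0_act \<theta> f b"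
proof -
  let ?M = "multiplier_algebra B"
  have z: "\<theta> f \<in> cs_carrier ?M"
    and central: "\<And>m. m \<in> cs_carrier ?M \<Longrightarrow> \<theta> f \<otimes>\<^bsub>?M\<^esub> m = m \<otimes>\<^bsub>?M\<^esub> \<theta> f"
    using C0_algebra f
    by (auto simp: is_C0_algebra_def star_morphism_def cs_centre_def C0_algebra_def Pi_iff)
  have z': "bounded_operator B (fst (\<theta> f))" "bounded_operator B (snd (\<theta> f))"
    "\<And>a b. \<lbrakk>a \<in> cs_carrier B; b \<in> cs_carrier B\<rbrakk> \<Longrightarrow> C0_act \<theta> f (a \<otimes> b) = C0_act \<theta> f a \<otimes> b"
    "\<And>a b. \<lbrakk>a \<in> cs_carrier B; b \<in> cs_carrier B\<rbrakk> \<Longrightarrow> snd (\<theta> f) a \<otimes> b = a \<otimes> C0_act \<theta> f b"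
    using z by (auto simp: multiplier_algebra_def Let_def)
  then show "bounded_operator B (fst (\<theta> f))" "bounded_operator B (snd (\<theta> f))"
    "\<lbrakk>a \<in> cs_carrier B; b \<in> cs_carrier B\<rbrakk> \<Longrightarrow> C0_act \<theta> f (a \<otimes> b) = C0_act \<theta> f a \<otimes> b"
    "\<lbrakk>a \<in> cs_carrier B; b \<in> cs_carrier B\<rbrakk> \<Longrightarrow> snd (\<theta> f) a \<otimes> b = a \<otimes> C0_act \<theta> f b"
    by auto
  assume ab: "a \<in> cs_carrier B" "b \<in> cs_carrier B"
  \<comment> \<open>The inner multiplier given by \<open>a\<close>. Commuting with it is what moves
    the function past \<open>a\<close> on the left.\<close>
  let ?m = "(\<lambda>b\<in>cs_carrier B. a \<otimes> b, \<lambda>b\<in>cs_carrier B. b \<otimes> a)"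
  have "\<exists>c. \<forall>b\<in>cs_carrier B. cs_norm B (a \<otimes> b) \<le> c * cs_norm B b"
    "\<exists>c. \<forall>b\<in>cs_carrier B. cs_norm B (b \<otimes> a) \<le> c * cs_norm B b"
    using ab norm_mult by (auto intro!: exI[of _ "cs_norm B a"] simp: mult.commute[of "cs_norm B a"])
  then have "?m \<in> cs_carrier ?M"
    using ab by (simp add: multiplier_algebra_def Let_def bounded_operator_def closed mult_add_left
        mult_add_right mult_scale_left mult_scale_right mult_assoc)
  then have "fst (\<theta> f \<otimes>\<^bsub>?M\<^esub> ?m) b = fst (?m \<otimes>\<^bsub>?M\<^esub> \<theta> f) b" using central by simp
  moreover have "fst (\<theta> f) b \<in> cs_carrier B" using z'(1) ab by (auto simp: bounded_operator_def)
  ultimately show "C0_act \<theta> f (a \<otimes> b) = a \<otimes> C0_act \<theta> f b"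
    using ab by (simp add: multiplier_algebra_def Let_def split_beta)
qed

lemma C0_act_linear:
  assumes f: "f \<in> C0_functions X" and a: "a \<in> cs_carrier B"
  shows "C0_act \<theta> f a \<in> cs_carrier B"
    and "b \<in> cs_carrier B \<Longrightarrow> C0_act \<theta> f (a \<oplus> b) = C0_act \<theta> f a \<oplus> C0_act \<theta> f b"
    and "C0_act \<theta> f (c \<odot> a) = c \<odot> C0_act \<theta> f a"
  using C0_act_multiplier(1)[OF f] a by (auto simp: bounded_operator_def)

text \<open>The difference \<open>?d\<close> of the two components annihilates every element from
  the left, in particular its own adjoint, so the C*-identity makes it zero. Hence the first
  component alone describes a central multiplier.\<close>

lemma C0_act_right:
  assumes f: "f \<in> C0_functions X" and a: "a \<in> cs_carrier B"
  shows "snd (\<theta> f) a = C0_act \<theta> f a"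
proof -
  have c: "snd (\<theta> f) a \<in> cs_carrier B" "C0_act \<theta> f a \<in> cs_carrier B"
    using C0_act_multiplier(1,2)[OF f] a by (auto simp: bounded_operator_def)
  let ?d = "snd (\<theta> f) a \<ominus> C0_act \<theta> f a"
  have "?d \<otimes> b = \<zero>" if "b \<in> cs_carrier B" for b
  proof -
    have "snd (\<theta> f) a \<otimes> b = C0_act \<theta> f a \<otimes> b"
      using C0_act_multiplier[OF f] a that by metis
    then show ?thesis using c that by (simp add: diff_mult_right diff_self closed)
  qed
  then have "(cs_norm B (cs_star B ?d))\<^sup>2 = 0"
    using norm_cstar[of "cs_star B ?d"] c by (simp add: star_star norm_zero closed)
  then have "?d = \<zero>" using c norm_eq_zero[of ?d] by (simp add: norm_star closed)
  then show ?thesis using c diff_eq_zero by blast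
qed

lemma C0_act_hom:
  assumes f: "f \<in> C0_functions X" and b: "b \<in> cs_carrier B"
  shows "g \<in> C0_functions X \<Longrightarrow> C0_act \<theta> (\<lambda>x. f x + g x) b = C0_act \<theta> f b \<oplus> C0_act \<theta> g b"
    and "C0_act \<theta> (\<lambda>x. c * f x) b = c \<odot> C0_act \<theta> f b"
    and "g \<in> C0_functions X \<Longrightarrow> C0_act \<theta> (\<lambda>x. f x * g x) b = C0_act \<theta> f (C0_act \<theta> g b)"
    and "C0_act \<theta> (\<lambda>x. cnj (f x)) (cs_star B b) = cs_star B (C0_act \<theta> f b)"
proof -
  let ?M = "multiplier_algebra B"
  have "g \<in> C0_functions X \<Longrightarrow> \<theta> (\<lambda>x. f x + g x) = \<theta> f \<oplus>\<^bsub>?M\<^esub> \<theta> g"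
    "\<theta> (\<lambda>x. c * f x) = c \<odot>\<^bsub>?M\<^esub> \<theta> f"
    "g \<in> C0_functions X \<Longrightarrow> \<theta> (\<lambda>x. f x * g x) = \<theta> f \<otimes>\<^bsub>?M\<^esub> \<theta> g"
    "\<theta> (\<lambda>x. cnj (f x)) = cs_star ?M (\<theta> f)"
    using C0_algebra f by (auto simp: is_C0_algebra_def star_morphism_def cs_centre_def C0_algebra_def)
  then show "g \<in> C0_functions X \<Longrightarrow> C0_act \<theta> (\<lambda>x. f x + g x) b = C0_act \<theta> f b \<oplus> C0_act \<theta> g b"
    "C0_act \<theta> (\<lambda>x. c * f x) b = c \<odot> C0_act \<theta> f b"
    "g \<in> C0_functions X \<Longrightarrow> C0_act \<theta> (\<lambda>x. f x * g x) b = C0_act \<theta> f (C0_act \<theta> g b)"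
    "C0_act \<theta> (\<lambda>x. cnj (f x)) (cs_star B b) = cs_star B (C0_act \<theta> f b)"
    using b f by (simp_all add: multiplier_algebra_def Let_def split_beta closed star_star C0_act_right)
qed

text \<open>Constants act as scalars and the rest through \<open>\<theta>\<close>, so the function 1
  acts as the identity although neither \<open>B\<close> nor the algebra of functions vanishing at
  infinity need have a unit. Square roots of \<open>1 - g^2\<close>, partitions into peaks and
  \<open>g - 1\<close> can then all act on \<open>B\<close>.\<close>

definition act :: "('x option \<Rightarrow> complex) \<Rightarrow> 'b \<Rightarrow> 'b" where
  "act G b = (G None \<odot> b) \<oplus> C0_act \<theta> (vanishing_part X G) b"

lemma act_closed:
  "\<lbrakk>G \<in> C1_functions X; b \<in> cs_carrier B\<rbrakk> \<Longrightarrow> act G b \<in> cs_carrier B"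
  by (simp add: act_def closed C0_act_linear vanishing_part_C0)

lemma act_add_right:
  assumes "G \<in> C1_functions X" "a \<in> cs_carrier B" "b \<in> cs_carrier B"
  shows "act G (a \<oplus> b) = act G a \<oplus> act G b"
  using assms by (simp add: act_def closed C0_act_linear vanishing_part_C0 scale_add_right add_ac)

lemma act_scale_right:
  "\<lbrakk>G \<in> C1_functions X; a \<in> cs_carrier B\<rbrakk> \<Longrightarrow> act G (c \<odot> a) = c \<odot> act G a"
  by (simp add: act_def closed C0_act_linear vanishing_part_C0 scale_add_right scale_scale mult.commute)

lemma act_diff_right:
  "\<lbrakk>G \<in> C1_functions X; a \<in> cs_carrier B; b \<in> cs_carrier B\<rbrakk> \<Longrightarrow> act G (a \<ominus> b) = act G a \<ominus> act G b"
  by (simp add: cs_diff_def act_add_right act_scale_right closed)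

lemma act_zero_right: "G \<in> C1_functions X \<Longrightarrow> act G \<zero> = \<zero>"
  using act_scale_right[of G \<zero> 0] act_closed[of G \<zero>] by (simp add: closed scale_zero_left)

lemma act_mult:
  assumes "G \<in> C1_functions X" "a \<in> cs_carrier B" "b \<in> cs_carrier B"
  shows "act G (a \<otimes> b) = act G a \<otimes> b" "act G (a \<otimes> b) = a \<otimes> act G b"
  using assms C0_act_multiplier(3,4)[OF vanishing_part_C0[OF assms(1)], of a b]
  by (simp_all add: act_def closed C0_act_linear vanishing_part_C0 mult_add_left mult_add_right
      mult_scale_left mult_scale_right)

lemma act_cong:
  assumes "\<And>z. z \<in> topspace (Alexandroff_compactification X) \<Longrightarrow> G z = H z"
  shows "act G b = act H b"
proof -
  have "vanishing_part X G = vanishing_part X H" using assms by (auto simp: vanishing_part_def)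
  then show ?thesis using assms[of None] by (simp add: act_def)
qed

lemma act_add_left:
  assumes G: "G \<in> C1_functions X" and H: "H \<in> C1_functions X" and b: "b \<in> cs_carrier B"
  shows "act (\<lambda>z. G z + H z) b = act G b \<oplus> act H b"
proof -
  have "vanishing_part X (\<lambda>z. G z + H z) = (\<lambda>x. vanishing_part X G x + vanishing_part X H x)"
    by (auto simp: vanishing_part_def)
  then show ?thesis
    using G H b by (simp add: act_def C0_act_hom C0_act_linear vanishing_part_C0 scale_add_left closed add_ac)
qed

lemma act_scale_left:
  assumes G: "G \<in> C1_functions X" and b: "b \<in> cs_carrier B"
  shows "act (\<lambda>z. c * G z) b = c \<odot> act G b"
proof -
  have "vanishing_part X (\<lambda>z. c * G z) = (\<lambda>x. c * vanishing_part X G x)"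
    by (auto simp: vanishing_part_def algebra_simps)
  then show ?thesis
    using G b by (simp add: act_def C0_act_hom C0_act_linear vanishing_part_C0 scale_add_right
        scale_scale closed)
qed

lemma act_const:
  assumes b: "b \<in> cs_carrier B"
  shows "act (\<lambda>z. c) b = c \<odot> b"
proof -
  have 0: "vanishing_part X (\<lambda>z. c) = (\<lambda>x. 0 * vanishing_part X (\<lambda>z. c) x)"
    by (auto simp: vanishing_part_def)
  have "C0_act \<theta> (vanishing_part X (\<lambda>z. c)) b = \<zero>"
    using b C0_act_hom(2)[OF vanishing_part_C0[OF C1_const[of c]] b, of 0] 0
      C0_act_linear(1)[OF vanishing_part_C0[OF C1_const[of c]] b] by (simp add: scale_zero_left)
  then show ?thesis using b by (simp add: act_def add_zero closed)
qed

lemma act_diff_left: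
  assumes "G \<in> C1_functions X" "H \<in> C1_functions X" "b \<in> cs_carrier B"
  shows "act (\<lambda>z. G z - H z) b = act G b \<ominus> act H b"
proof -
  have "(\<lambda>z. -1 * H z) \<in> C1_functions X" using assms by (intro C1_mult) simp_all
  then show ?thesis
    using assms act_add_left[of G "\<lambda>z. -1 * H z" b] act_scale_left[of H b "-1"]
    by (simp add: cs_diff_def)
qed

lemma act_extend:
  "\<lbrakk>f \<in> C0_functions X; b \<in> cs_carrier B\<rbrakk> \<Longrightarrow> act (extend_C0 f) b = C0_act \<theta> f b"
  by (simp add: act_def vanishing_part_extend scale_zero_left zero_add C0_act_linear)

lemma act_act:
  assumes G: "G \<in> C1_functions X" and H: "H \<in> C1_functions X" and b: "b \<in> cs_carrier B"
  shows "act G (act H b) = act (\<lambda>z. G z * H z) b"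
proof -
  let ?g = "vanishing_part X G" and ?h = "vanishing_part X H"
  let ?P = "\<lambda>z. (G z - G None) * (H z - H None)"
  have gh: "?g \<in> C0_functions X" "?h \<in> C0_functions X" by (simp_all add: G H vanishing_part_C0)
  have P: "?P \<in> C1_functions X" by (intro C1_mult C1_diff G H C1_const)
  have "vanishing_part X ?P = (\<lambda>x. ?g x * ?h x)" by (auto simp: vanishing_part_def)
  then have actP: "act ?P b = C0_act \<theta> ?g (C0_act \<theta> ?h b)"
    using gh b by (simp add: act_def C0_act_hom scale_zero_left zero_add C0_act_linear)
  \<comment> \<open>The product is split so that the two vanishing parts meet in \<open>?P\<close>
    only; this is the one term that needs multiplicativity of \<open>\<theta>\<close>.\<close>
  have "act (\<lambda>z. G z * H z) b = act (\<lambda>z. (?P z + G None * H z) + H None * (G z - G None)) b"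
    by (rule act_cong) (simp add: algebra_simps)
  also have "\<dots> = (act ?P b \<oplus> G None \<odot> act H b) \<oplus> H None \<odot> act (\<lambda>z. G z - G None) b"
    using G H P b by (simp add: act_add_left act_scale_left C1_add C1_mult C1_diff)
  also have "act (\<lambda>z. G z - G None) b = C0_act \<theta> ?g b"
  proof -
    have "vanishing_part X (\<lambda>z. G z - G None) = ?g" by (auto simp: vanishing_part_def)
    then show ?thesis using b gh by (simp add: act_def scale_zero_left zero_add C0_act_linear)
  qed
  finally have "act (\<lambda>z. G z * H z) b
      = (C0_act \<theta> ?g (C0_act \<theta> ?h b) \<oplus> G None \<odot> act H b) \<oplus> H None \<odot> C0_act \<theta> ?g b"
    by (simp only: actP)
  moreover have "act G (act H b)
      = G None \<odot> act H b \<oplus> (H None \<odot> C0_act \<theta> ?g b \<oplus> C0_act \<theta> ?g (C0_act \<theta> ?h b))"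
    unfolding act_def[of G] using b gh by (simp add: act_def[of H] C0_act_linear closed)
  moreover have "x \<oplus> (y \<oplus> w) = (w \<oplus> x) \<oplus> y"
    if "x \<in> cs_carrier B" "y \<in> cs_carrier B" "w \<in> cs_carrier B" for x y w
    using that by (simp add: add_ac closed)
  ultimately show ?thesis using b gh H by (simp add: C0_act_linear closed act_closed)
qed

lemma act_star:
  assumes G: "G \<in> C1_functions X" and b: "b \<in> cs_carrier B"
  shows "cs_star B (act G b) = act (\<lambda>z. cnj (G z)) (cs_star B b)"
proof -
  have "vanishing_part X (\<lambda>z. cnj (G z)) = (\<lambda>x. cnj (vanishing_part X G x))"
    by (auto simp: vanishing_part_def)
  then show ?thesis
    using G b by (simp add: act_def star_add star_scale C0_act_hom(4) C0_act_linear vanishing_part_C0 closed)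
qed

lemma act_star_mult:
  assumes G: "G \<in> C1_functions X" and H: "H \<in> C1_functions X"
    and a: "a \<in> cs_carrier B" and b: "b \<in> cs_carrier B"
  shows "cs_star B (act G a) \<otimes> act H b = act (\<lambda>z. cnj (G z) * H z) (cs_star B a \<otimes> b)"
proof -
  have "cs_star B (act G a) \<otimes> act H b = act (\<lambda>z. cnj (G z)) (cs_star B a \<otimes> act H b)"
    using assms by (simp add: act_star act_mult(1) C1_cnj closed act_closed)
  then show ?thesis using assms by (simp add: act_mult(2)[symmetric] act_act C1_cnj closed)
qed

text \<open>With \<open>?W\<close> the square root of \<open>1 - g^2\<close>, the functions
  \<open>g + i W\<close> and \<open>g - i W\<close> have modulus 1. This is the situation of
  \<open>norm_le_rotation\<close> with \<open>z = b\<close>.\<close>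

lemma norm_act_real:
  assumes G: "(\<lambda>z. complex_of_real (g z)) \<in> C1_functions X" (is "?G \<in> _") and b: "b \<in> cs_carrier B"
    and g: "\<And>z. z \<in> topspace (Alexandroff_compactification X) \<Longrightarrow> \<bar>g z\<bar> \<le> 1"
  shows "cs_norm B (act ?G b) \<le> cs_norm B b"
proof -
  let ?W = "\<lambda>z. complex_of_real (sqrt (1 - (g z)\<^sup>2))"
  \<comment> \<open>\<open>C1_compose\<close> asks for continuity on the whole plane, where
    \<open>1 - (Re w)^2\<close> takes negative values; the real \<open>sqrt\<close> is continuous
    there as well.\<close>
  have "(\<lambda>z. complex_of_real (sqrt (1 - (Re (?G z))\<^sup>2))) \<in> C1_functions X"
    by (rule C1_compose[OF G]) (intro continuous_intros)
  then have W: "?W \<in> C1_functions X" by simp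
  have bb: "cs_star B b \<otimes> b \<in> cs_carrier B" using b by (simp add: closed)
  show ?thesis
  proof (rule norm_le_rotation)
    show "act ?G b \<in> cs_carrier B" "act ?W b \<in> cs_carrier B" "b \<in> cs_carrier B"
      using G W b by (simp_all add: act_closed)
    show "cs_star B (act ?G b) \<otimes> act ?W b = cs_star B (act ?W b) \<otimes> act ?G b"
      using G W b by (simp add: act_star_mult mult.commute)
    have "cs_star B (act ?G b) \<otimes> act ?G b \<oplus> cs_star B (act ?W b) \<otimes> act ?W b
        = act (\<lambda>z. ?G z * ?G z + ?W z * ?W z) (cs_star B b \<otimes> b)"
      using G W b bb by (simp add: act_star_mult act_add_left C1_mult)
    also have "\<dots> = act (\<lambda>z. 1) (cs_star B b \<otimes> b)"
    proof (rule act_cong)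
      fix z assume "z \<in> topspace (Alexandroff_compactification X)"
      then have "(g z)\<^sup>2 \<le> 1" using g by (simp add: abs_square_le_1)
      then have "g z * g z + sqrt (1 - (g z)\<^sup>2) * sqrt (1 - (g z)\<^sup>2) = 1"
        by (simp add: power2_eq_square)
      then show "?G z * ?G z + ?W z * ?W z = 1" by (metis of_real_1 of_real_add of_real_mult)
    qed
    finally show "cs_star B (act ?G b) \<otimes> act ?G b \<oplus> cs_star B (act ?W b) \<otimes> act ?W b = cs_star B b \<otimes> b"
      using bb by (simp add: act_const scale_one)
  qed
qed

text \<open>The C*-identity replaces \<open>G\<close> by the square of its modulus. Divided by
  \<open>M^2\<close> this is real with values between 0 and 1, as \<open>norm_act_real\<close>
  demands.\<close>

lemma norm_act_le:
  assumes G: "G \<in> C1_functions X" and b: "b \<in> cs_carrier B" and M: "M \<ge> 0"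
    and bound: "\<And>z. z \<in> topspace (Alexandroff_compactification X) \<Longrightarrow> cmod (G z) \<le> M"
  shows "cs_norm B (act G b) \<le> M * cs_norm B b"
proof (cases "M = 0")
  case True
  then have "act G b = act (\<lambda>z. 0) b" using bound by (intro act_cong) force
  then show ?thesis using True b by (simp add: act_const scale_zero_left norm_zero)
next
  case False
  let ?g = "\<lambda>z. (cmod (G z) / M)\<^sup>2"
  let ?H = "\<lambda>z. complex_of_real (?g z)"
  have bb: "cs_star B b \<otimes> b \<in> cs_carrier B" using b by (simp add: closed)
  have H: "?H \<in> C1_functions X"
    by (rule C1_compose[OF G]) (use False in \<open>intro continuous_intros, auto\<close>)
  have "(cs_norm B (act G b))\<^sup>2 = cs_norm B (act (\<lambda>z. cnj (G z) * G z) (cs_star B b \<otimes> b))"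
    using G b norm_cstar[of "act G b"] by (simp add: act_closed act_star_mult)
  also have "(\<lambda>z. cnj (G z) * G z) = (\<lambda>z. complex_of_real (M\<^sup>2) * ?H z)"
    using False by (auto simp: power_divide complex_norm_square mult.commute simp flip: of_real_power)
  also have "cs_norm B (act \<dots> (cs_star B b \<otimes> b)) = M\<^sup>2 * cs_norm B (act ?H (cs_star B b \<otimes> b))"
    using H bb act_closed norm_scale by (simp add: act_scale_left norm_mult del: of_real_power)
  also have "\<dots> \<le> M\<^sup>2 * cs_norm B (cs_star B b \<otimes> b)"
  proof (intro mult_left_mono norm_act_real H bb)
    fix z assume "z \<in> topspace (Alexandroff_compactification X)"
    then have "cmod (G z) / M \<le> 1" using bound[of z] False M by (simp add: divide_le_eq)
    then show "\<bar>?g z\<bar> \<le> 1" using M by (simp add: power_le_one)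
  qed simp
  also have "\<dots> = (M * cs_norm B b)\<^sup>2" using b by (simp add: norm_cstar power_mult_distrib)
  finally show ?thesis by (rule power2_le_imp_le) (use M b in \<open>simp add: norm_nonneg\<close>)
qed

text \<open>Combined with \<open>restriction_ideal_least\<close> or \<open>nondegenerate\<close>, it
  lets a statement about \<open>act G b\<close> be verified for elements of the form
  \<open>C0_act \<theta> f v\<close> only.\<close>

lemma closed_ideal_act_preimage:
  assumes G: "G \<in> C1_functions X" and J: "closed_ideal B J"
  shows "closed_ideal B {b \<in> cs_carrier B. act G b \<in> J}"
proof -
  obtain M where M: "M \<ge> 0" "\<And>z. z \<in> topspace (Alexandroff_compactification X) \<Longrightarrow> cmod (G z) \<le> M"
    using C1_bounded[OF G] by metis
  have "norm_closure B {b \<in> cs_carrier B. act G b \<in> J} \<subseteq> {b \<in> cs_carrier B. act G b \<in> J}"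
  proof (rule norm_closure_lipschitz_preimage[OF _ _ M(1)])
    show "cs_norm B (act G x \<ominus> act G y) \<le> M * cs_norm B (x \<ominus> y)"
      if "x \<in> cs_carrier B" "y \<in> cs_carrier B" for x y
      using norm_act_le[OF G diff_closed[OF that] M] that by (simp add: act_diff_right G)
  qed (use J G act_closed in \<open>auto simp: closed_ideal_def\<close>)
  moreover have "act G (a \<otimes> i) \<in> J" "act G (i \<otimes> a) \<in> J"
    if "act G i \<in> J" "i \<in> cs_carrier B" "a \<in> cs_carrier B" for i a
    using act_mult(1)[OF G that(2,3)] act_mult(2)[OF G that(3,2)] closed_idealD(5,6)[OF J] that by simp_all
  ultimately show ?thesis
    unfolding closed_ideal_def linear_subspace_def
    by (auto simp: closed G act_zero_right act_add_right act_scale_right closed_idealD(2-4)[OF J])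
qed

end


section \<open>Fibres of a \<open>C\<^sub>0(X)\<close>-algebra\<close>

context C0_module
begin

abbreviation X1 where "X1 \<equiv> Alexandroff_compactification X"

text \<open>The bound 1 makes peaks act contractively, and the value 1 makes them act trivially in
  the fibre at \<open>z\<close>. They are stable under products, so several smallness conditions can
  be met by one peak.\<close>

definition peak :: "'x option \<Rightarrow> ('x option \<Rightarrow> complex) set" where
  "peak z = {G \<in> C1_functions X. G z = 1 \<and> (\<forall>w\<in>topspace X1. cmod (G w) \<le> 1)}"

text \<open>The kernel of the evaluation at \<open>z\<close>. The point at infinity is included because the peak
  functions then live on a compact space; its fibre is trivial (\<open>fibre_ideal_None\<close>).\<close>

definition fibre_ideal :: "'x option \<Rightarrow> 'b set" where
  "fibre_ideal z = {b \<in> cs_carrier B. \<forall>e>0. \<exists>G\<in>peak z. cs_norm B (act G b) < e}"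

lemma peakD:
  assumes "G \<in> peak z"
  shows "G \<in> C1_functions X" "G z = 1" "w \<in> topspace X1 \<Longrightarrow> cmod (G w) \<le> 1"
  using assms by (auto simp: peak_def)

lemma peak_one: "(\<lambda>w. 1) \<in> peak z"
  by (simp add: peak_def)

lemma peak_mult: "\<lbrakk>G \<in> peak z; H \<in> peak z\<rbrakk> \<Longrightarrow> (\<lambda>w. G w * H w) \<in> peak z"
  by (auto simp: peak_def C1_mult Real_Vector_Spaces.norm_mult intro: mult_le_one)

lemma peak_cnj: "G \<in> peak z \<Longrightarrow> (\<lambda>w. cnj (G w)) \<in> peak z"
  by (simp add: peak_def C1_cnj)

lemma norm_act_peak: "\<lbrakk>G \<in> peak z; b \<in> cs_carrier B\<rbrakk> \<Longrightarrow> cs_norm B (act G b) \<le> cs_norm B b"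
  using norm_act_le[of G b 1] by (simp add: peakD)

lemma fibre_idealE:
  assumes "b \<in> fibre_ideal z" "e > 0"
  obtains G where "G \<in> peak z" "cs_norm B (act G b) < e"
  using assms unfolding fibre_ideal_def by blast

lemma fibre_ideal_carrier: "b \<in> fibre_ideal z \<Longrightarrow> b \<in> cs_carrier B"
  by (simp add: fibre_ideal_def)

text \<open>Allows a constant factor in front of \<open>e\<close>, so that estimates need not be
  rescaled each time.\<close>

lemma fibre_ideal_boundI:
  assumes b: "b \<in> cs_carrier B"
    and "\<And>e. e > 0 \<Longrightarrow> \<exists>G\<in>peak z. cs_norm B (act G b) \<le> C * e"
  shows "b \<in> fibre_ideal z"
proof -
  have "\<exists>G\<in>peak z. cs_norm B (act G b) < e" if e: "e > 0" for e
  proof -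
    define d where "d = e / (\<bar>C\<bar> + 1)"
    have d: "d > 0" "\<bar>C\<bar> * d < e" using e by (simp_all add: d_def field_simps)
    obtain G where G: "G \<in> peak z" "cs_norm B (act G b) \<le> C * d" using assms(2)[OF d(1)] by blast
    have "C * d \<le> \<bar>C\<bar> * d" using d by (simp add: mult_right_mono)
    then have "cs_norm B (act G b) < e" using G(2) d(2) by linarith
    then show ?thesis using G(1) by blast
  qed
  then show ?thesis using b by (simp add: fibre_ideal_def)
qed

text \<open>The cut-off \<open>H\<close>, the positive part of \<open>1 - cmod G / e\<close>, is a
  peak at \<open>z\<close> because \<open>G z = 0\<close>. It vanishes wherever
  \<open>cmod G\<close> exceeds \<open>e\<close>, so \<open>H G\<close> is bounded by
  \<open>e\<close>.\<close>

lemma act_mem_fibre_ideal: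
  assumes G: "G \<in> C1_functions X" "G z = 0" and b: "b \<in> cs_carrier B"
  shows "act G b \<in> fibre_ideal z"
proof (rule fibre_ideal_boundI[where C="cs_norm B b"])
  fix e :: real assume e: "e > 0"
  define H where "H w = complex_of_real (max 0 (1 - cmod (G w) / e))" for w
  have H: "H \<in> C1_functions X"
    unfolding H_def by (rule C1_compose[OF G(1)]) (use e in \<open>intro continuous_intros, auto\<close>)
  have "cmod (H w) \<le> 1" for w using e by (simp add: H_def)
  then have "H \<in> peak z" using H G by (simp add: peak_def H_def)
  moreover have "cmod (H w * G w) \<le> e" for w
  proof (cases "cmod (G w) \<le> e")
    case True
    then have "cmod (H w) * cmod (G w) \<le> 1 * e"
      using \<open>cmod (H w) \<le> 1\<close> by (intro mult_mono) auto
    then show ?thesis by (simp add: Real_Vector_Spaces.norm_mult)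
  next
    case False
    then have "H w = 0" using e by (simp add: H_def field_simps)
    then show ?thesis using e by simp
  qed
  then have "cs_norm B (act H (act G b)) \<le> cs_norm B b * e"
    using norm_act_le[OF C1_mult[OF H G(1)] b, of e] e H G b by (simp add: act_act mult.commute)
  ultimately show "\<exists>H\<in>peak z. cs_norm B (act H (act G b)) \<le> cs_norm B b * e" by blast
qed (use G b in \<open>simp add: act_closed\<close>)

lemma star_ideal_fibre: "star_ideal B (fibre_ideal z)"
proof
  have zero: "\<zero> \<in> fibre_ideal z"
    by (rule fibre_ideal_boundI[where C=1])
      (auto simp: closed act_zero_right norm_zero intro!: bexI[OF _ peak_one])
  have add: "a \<oplus> b \<in> fibre_ideal z" if a: "a \<in> fibre_ideal z" and b: "b \<in> fibre_ideal z" for a b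
  proof (rule fibre_ideal_boundI[where C=2])
    have c: "a \<in> cs_carrier B" "b \<in> cs_carrier B" using a b by (simp_all add: fibre_ideal_def)
    then show "a \<oplus> b \<in> cs_carrier B" by (rule add_closed)
    fix e :: real assume e: "e > 0"
    obtain G where G: "G \<in> peak z" "cs_norm B (act G a) < e" using fibre_idealE[OF a e] .
    obtain H where H: "H \<in> peak z" "cs_norm B (act H b) < e" using fibre_idealE[OF b e] .
    note GH = peakD(1)[OF G(1)] peakD(1)[OF H(1)]
    have "act (\<lambda>w. G w * H w) (a \<oplus> b) = act H (act G a) \<oplus> act G (act H b)"
      using c GH by (simp add: act_act act_add_right C1_mult mult.commute)
    also have "cs_norm B \<dots> \<le> cs_norm B (act H (act G a)) + cs_norm B (act G (act H b))"
      using c GH by (simp add: norm_triangle act_closed)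
    also have "\<dots> \<le> cs_norm B (act G a) + cs_norm B (act H b)"
      using c GH G H by (intro add_mono norm_act_peak act_closed) auto
    finally show "\<exists>G\<in>peak z. cs_norm B (act G (a \<oplus> b)) \<le> 2 * e"
      using G H peak_mult by (intro bexI[of _ "\<lambda>w. G w * H w"]) auto
  qed
  have scale: "c \<odot> a \<in> fibre_ideal z" if a: "a \<in> fibre_ideal z" for a c
  proof (rule fibre_ideal_boundI[where C="cmod c"])
    have ac: "a \<in> cs_carrier B" using a by (simp add: fibre_ideal_def)
    then show "c \<odot> a \<in> cs_carrier B" by (rule scale_closed)
    fix e :: real assume e: "e > 0"
    obtain G where G: "G \<in> peak z" "cs_norm B (act G a) < e" using fibre_idealE[OF a e] .
    then show "\<exists>G\<in>peak z. cs_norm B (act G (c \<odot> a)) \<le> cmod c * e"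
      using ac peakD(1)[OF G(1)]
      by (intro bexI[of _ G]) (auto simp: act_scale_right norm_scale act_closed mult_left_mono)
  qed
  have mult: "a \<otimes> i \<in> fibre_ideal z" "i \<otimes> a \<in> fibre_ideal z"
    if i: "i \<in> fibre_ideal z" and a: "a \<in> cs_carrier B" for a i
  proof -
    have ic: "i \<in> cs_carrier B" using i by (simp add: fibre_ideal_def)
    have "\<exists>G\<in>peak z. cs_norm B (act G (a \<otimes> i)) \<le> cs_norm B a * e \<and>
        cs_norm B (act G (i \<otimes> a)) \<le> cs_norm B a * e" if e: "e > 0" for e
    proof -
      obtain G where G: "G \<in> peak z" "cs_norm B (act G i) < e" using fibre_idealE[OF i e] .
      note G1 = peakD(1)[OF G(1)]
      have "cs_norm B (a \<otimes> act G i) \<le> cs_norm B a * cs_norm B (act G i)"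
        "cs_norm B (act G i \<otimes> a) \<le> cs_norm B (act G i) * cs_norm B a"
        using a ic G1 by (simp_all add: norm_mult act_closed)
      moreover have "cs_norm B a * cs_norm B (act G i) \<le> cs_norm B a * e"
        using G a by (intro mult_left_mono norm_nonneg) auto
      ultimately show ?thesis
        using G act_mult(1)[OF G1 ic a] act_mult(2)[OF G1 a ic]
        by (intro bexI[of _ G]) (auto simp: mult.commute)
    qed
    then show "a \<otimes> i \<in> fibre_ideal z" "i \<otimes> a \<in> fibre_ideal z"
      using a ic by (auto intro!: fibre_ideal_boundI[where C="cs_norm B a"] mult_closed)
  qed
  have clo: "a \<in> fibre_ideal z" if a: "a \<in> norm_closure B (fibre_ideal z)" for a
  proof (rule fibre_ideal_boundI[where C=2])
    show ac: "a \<in> cs_carrier B" using a by (simp add: norm_closure_def)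
    fix e :: real assume e: "e > 0"
    obtain s where s: "s \<in> fibre_ideal z" "cs_norm B (a \<ominus> s) < e"
      using a e unfolding norm_closure_def by blast
    obtain G where G: "G \<in> peak z" "cs_norm B (act G s) < e" using fibre_idealE[OF s(1) e] .
    note G1 = peakD(1)[OF G(1)]
    have sc: "s \<in> cs_carrier B" using s by (simp add: fibre_ideal_def)
    have "cs_norm B (act G a) \<le> cs_norm B (act G s) + cs_norm B (act G (a \<ominus> s))"
      using norm_le_add_diff[of "act G a" "act G s"] ac sc G1 by (simp add: act_closed act_diff_right)
    also have "\<dots> \<le> e + e"
      using norm_act_peak[OF G(1), of "a \<ominus> s"] ac sc G s by (intro add_mono) (auto simp: closed)
    finally show "\<exists>G\<in>peak z. cs_norm B (act G a) \<le> 2 * e" using G by auto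
  qed
  show "closed_ideal B (fibre_ideal z)"
    unfolding closed_ideal_def linear_subspace_def
    by (intro conjI ballI allI subsetI) (simp_all add: zero add scale mult clo fibre_ideal_carrier)
  fix i assume i: "i \<in> fibre_ideal z"
  show "cs_star B i \<in> fibre_ideal z"
  proof (rule fibre_ideal_boundI[where C=1])
    have ic: "i \<in> cs_carrier B" using i by (simp add: fibre_ideal_def)
    then show "cs_star B i \<in> cs_carrier B" by (rule star_closed)
    fix e :: real assume e: "e > 0"
    obtain G where G: "G \<in> peak z" "cs_norm B (act G i) < e" using fibre_idealE[OF i e] .
    have "cs_norm B (act (\<lambda>w. cnj (G w)) (cs_star B i)) = cs_norm B (act G i)"
      using ic peakD(1)[OF G(1)] by (simp add: norm_star act_closed flip: act_star)
    then show "\<exists>G\<in>peak z. cs_norm B (act G (cs_star B i)) \<le> 1 * e"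
      using G peak_cnj by (intro bexI[of _ "\<lambda>w. cnj (G w)"]) auto
  qed
qed

abbreviation fibre :: "'x option \<Rightarrow> 'b set cstar" where
  "fibre z \<equiv> cs_quotient B (fibre_ideal z)"

abbreviation ev :: "'x option \<Rightarrow> 'b \<Rightarrow> 'b set" where
  "ev z \<equiv> cs_coset B (fibre_ideal z)"

section \<open>Evaluation at a point and the C*-structure of the fibres\<close>

interpretation fib: star_ideal B "fibre_ideal z" for z
  by (rule star_ideal_fibre)

lemma ev_act:
  assumes G: "G \<in> C1_functions X" and b: "b \<in> cs_carrier B"
  shows "ev z (act G b) = G z \<odot>\<^bsub>fibre z\<^esub> ev z b"
proof -
  have "act (\<lambda>w. G w - G z) b \<in> fibre_ideal z"
    by (rule act_mem_fibre_ideal) (use G b in \<open>simp_all add: C1_diff\<close>)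
  then have "act G b \<ominus> G z \<odot> b \<in> fibre_ideal z"
    using G b by (simp add: act_diff_left act_const)
  then show ?thesis
    using G b by (simp add: fib.coset_scale fib.coset_eq_iff closed act_closed)
qed

lemma ev_act_peak:
  assumes "G \<in> peak z" "b \<in> cs_carrier B"
  shows "ev z (act G b) = ev z b"
  using assms by (simp add: ev_act peakD fib.coset_scale scale_one)

text \<open>A representative \<open>a\<close> of norm below \<open>r\<close> differs from
  \<open>b\<close> by an element that some peak makes smaller than the remaining gap, and the same
  peak does not enlarge \<open>a\<close>. Thus peaks realize the quotient norm up to any
  error.\<close>

lemma ev_norm_lessE:
  assumes b: "b \<in> cs_carrier B" and less: "cs_norm (fibre z) (ev z b) < r"
  obtains G where "G \<in> peak z" "cs_norm B (act G b) < r"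
proof -
  have "ev z b \<in> cs_carrier (fibre z)" using b by (simp add: fib.quotient_carrier)
  then obtain a where a: "a \<in> cs_carrier B" "ev z b = ev z a" "cs_norm B a < r"
    using fib.coset_norm_lessE less by metis
  then have "b \<ominus> a \<in> fibre_ideal z" using b by (simp add: fib.coset_eq_iff)
  then obtain G where G: "G \<in> peak z" "cs_norm B (act G (b \<ominus> a)) < r - cs_norm B a"
    using fibre_idealE[of "b \<ominus> a" z "r - cs_norm B a"] a by auto
  have "cs_norm B (act G b) \<le> cs_norm B (act G a) + cs_norm B (act G (b \<ominus> a))"
    using norm_le_add_diff[of "act G b" "act G a"] a b peakD(1)[OF G(1)]
    by (simp add: act_closed act_diff_right)
  also have "\<dots> < r" using G norm_act_peak[OF G(1) a(1)] by simp
  finally show ?thesis using that G by blast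
qed

text \<open>The representative required by \<open>quotient_cstar\<close> is \<open>act G b\<close>
  for a peak \<open>G\<close> that makes \<open>d - ?p\<close> small. Its squared norm is the norm
  of \<open>?p\<close> acted on by \<open>cnj G * G\<close>, hence at most that of
  \<open>act G ?p\<close>, which is close to \<open>act G d\<close>.\<close>

lemma fibre_cstar: "cstar_algebra (fibre z)"
proof (rule fib.quotient_cstar)
  fix b d and e :: real
  assume b: "b \<in> cs_carrier B" and d: "d \<in> cs_carrier B" and e: "e > 0"
    and bd: "d \<ominus> (cs_star B b \<otimes> b) \<in> fibre_ideal z"
  let ?p = "cs_star B b \<otimes> b"
  have p: "?p \<in> cs_carrier B" using b by (simp add: closed)
  obtain G where G: "G \<in> peak z" "cs_norm B (act G (d \<ominus> ?p)) < e" using fibre_idealE[OF bd e] .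
  note G1 = peakD(1)[OF G(1)]
  have "(cs_norm B (act G b))\<^sup>2 = cs_norm B (act (\<lambda>w. cnj (G w)) (act G ?p))"
    using b p G1 norm_cstar[of "act G b"] by (simp add: act_closed act_star_mult act_act C1_cnj)
  also have "\<dots> \<le> cs_norm B (act G ?p)"
    using p G1 by (intro norm_act_peak[OF peak_cnj[OF G(1)]] act_closed)
  also have "\<dots> \<le> cs_norm B (act G d) + cs_norm B (act G (d \<ominus> ?p))"
    using norm_le_add_diff[of "act G ?p" "act G d"] norm_diff_commute[of "act G ?p" "act G d"] d p G1
    by (simp add: act_closed act_diff_right)
  also have "\<dots> \<le> cs_norm B d + e" using G norm_act_peak[OF G(1) d] by simp
  finally have "(cs_norm B (act G b))\<^sup>2 \<le> cs_norm B d + e" .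
  moreover have "act G b \<ominus> b \<in> fibre_ideal z"
    using ev_act_peak[OF G(1) b] b G1 by (simp add: fib.coset_eq_iff act_closed)
  ultimately show "\<exists>b'\<in>cs_carrier B. b' \<ominus> b \<in> fibre_ideal z \<and> (cs_norm B b')\<^sup>2 \<le> cs_norm B d + e"
    using b G1 act_closed by blast
qed

lemma star_morphism_ev: "star_morphism B (fibre z) (ev z)"
  by (rule fib.star_morphism_coset)

text \<open>The density axiom in the form in which it is applied: a property that cuts out a closed
  ideal holds for all of \<open>B\<close> once it holds for every \<open>f b\<close>.\<close>

lemma nondegenerate:
  assumes J: "closed_ideal B J"
    and gen: "\<And>f b. \<lbrakk>f \<in> C0_functions X; b \<in> cs_carrier B\<rbrakk> \<Longrightarrow> C0_act \<theta> f b \<in> J"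
  shows "J = cs_carrier B"
proof
  show "J \<subseteq> cs_carrier B" using closed_idealD(1)[OF J] by blast
  let ?G = "{C0_act \<theta> f b | f b. f \<in> C0_functions X \<and> b \<in> cs_carrier B}"
  have "linear_subspace B J" using J by (simp add: closed_ideal_def)
  then have "linear_hull B ?G \<subseteq> J" using gen unfolding linear_hull_def by blast
  then have "norm_closure B (linear_hull B ?G) \<subseteq> norm_closure B J"
    by (fastforce simp: norm_closure_def)
  then show "cs_carrier B \<subseteq> J"
    using C0_algebra closed_idealD(7)[OF J] by (auto simp: is_C0_algebra_def)
qed

text \<open>Each \<open>f b\<close> vanishes at infinity, so nondegeneracy leaves nothing there. In
  \<open>norm_le_of_fibres\<close> bounds at the points of \<open>X\<close> therefore suffice,
  although the compact space has one point more.\<close>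

lemma fibre_ideal_None: "fibre_ideal None = cs_carrier B"
proof (rule nondegenerate[OF fib.ideal])
  fix f b assume fb: "f \<in> C0_functions X" "b \<in> cs_carrier B"
  then have "act (extend_C0 f) b \<in> fibre_ideal None"
    by (intro act_mem_fibre_ideal extend_C0_C1 Hausdorff) simp_all
  then show "C0_act \<theta> f b \<in> fibre_ideal None" using fb by (simp add: act_extend)
qed

section \<open>The norm as the supremum of the fibre norms\<close>

lemma norm_act_sum:
  assumes "finite S" "\<And>s. s \<in> S \<Longrightarrow> G s \<in> C1_functions X" "b \<in> cs_carrier B"
  shows "cs_norm B (act (\<lambda>w. \<Sum>s\<in>S. G s w) b) \<le> (\<Sum>s\<in>S. cs_norm B (act (G s) b))"
  using assms
proof (induction S rule: finite_induct)
  case empty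
  then show ?case by (simp add: act_const scale_zero_left norm_zero)
next
  case (insert s S)
  then have "act (\<lambda>w. \<Sum>s\<in>insert s S. G s w) b = act (G s) b \<oplus> act (\<lambda>w. \<Sum>s\<in>S. G s w) b"
    by (simp add: act_add_left C1_sum)
  then show ?case
    using insert norm_triangle[of "act (G s) b" "act (\<lambda>w. \<Sum>s\<in>S. G s w) b"]
    by (simp add: act_closed C1_sum)
qed

text \<open>The power of \<open>b\<close> with exponent \<open>2 ^ m\<close>. Repeated squaring is
  what the C*-identity controls exactly: for self-adjoint \<open>b\<close> the norm is squared at
  each step.\<close>

fun iter_sq :: "nat \<Rightarrow> 'b \<Rightarrow> 'b" where
  "iter_sq 0 b = b"
| "iter_sq (Suc m) b = iter_sq m b \<otimes> iter_sq m b"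

lemma iter_sq_closed: "b \<in> cs_carrier B \<Longrightarrow> iter_sq m b \<in> cs_carrier B"
  by (induction m) (simp_all add: closed)

lemma norm_iter_sq_le: "b \<in> cs_carrier B \<Longrightarrow> cs_norm B (iter_sq m b) \<le> cs_norm B b ^ (2 ^ m)"
proof (induction m)
  case (Suc m)
  have "cs_norm B (iter_sq (Suc m) b) \<le> cs_norm B (iter_sq m b) * cs_norm B (iter_sq m b)"
    using Suc by (simp add: norm_mult iter_sq_closed)
  also have "\<dots> \<le> cs_norm B b ^ (2 ^ m) * cs_norm B b ^ (2 ^ m)"
    using Suc by (intro mult_mono) (auto simp: norm_nonneg iter_sq_closed)
  finally show ?case by (simp add: mult_2 flip: power_add)
qed simp

lemma norm_iter_sq:
  assumes "b \<in> cs_carrier B" "cs_star B b = b"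
  shows "cs_norm B (iter_sq m b) = cs_norm B b ^ (2 ^ m)"
proof -
  have "cs_star B (iter_sq m b) = iter_sq m b" for m
    by (induction m) (simp_all add: assms star_mult iter_sq_closed)
  then have "cs_norm B (iter_sq (Suc m) b) = (cs_norm B (iter_sq m b))\<^sup>2" for m
    using norm_cstar[of "iter_sq m b"] assms by (simp add: iter_sq_closed)
  then show ?thesis by (induction m) (simp_all add: power_mult mult.commute flip: power_even_eq)
qed

lemma iter_sq_act:
  assumes G: "G \<in> C1_functions X" and b: "b \<in> cs_carrier B"
  shows "iter_sq m (act G b) = act (\<lambda>w. G w ^ (2 ^ m)) (iter_sq m b)"
proof (induction m)
  case (Suc m)
  let ?H = "\<lambda>w. G w ^ (2 ^ m)" and ?b = "iter_sq m b"
  have H: "?H \<in> C1_functions X" "?b \<in> cs_carrier B" using G b by (simp_all add: C1_power iter_sq_closed)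
  have "act ?H ?b \<otimes> act ?H ?b = act ?H (?b \<otimes> act ?H ?b)"
    using H by (simp add: act_mult(1) act_closed)
  also have "\<dots> = act ?H (act ?H (?b \<otimes> ?b))" using H by (simp add: act_mult(2))
  also have "\<dots> = act (\<lambda>w. ?H w * ?H w) (?b \<otimes> ?b)" using H by (simp add: act_act closed)
  finally show ?case using Suc by (simp add: mult_2 power_add)
qed simp

text \<open>By compactness the moduli of finitely many peak functions cover \<open>X1\<close>. Comparing \<open>n\<close>-th powers
  of \<open>b\<^sup>* b\<close> makes the number of functions in the cover irrelevant as \<open>n \<rightarrow> \<infinity>\<close>.\<close>

lemma norm_le_of_fibres:
  assumes b: "b \<in> cs_carrier B" and c: "c \<ge> 0"
    and le: "\<And>x. x \<in> topspace X \<Longrightarrow> cs_norm (fibre (Some x)) (ev (Some x) b) \<le> c"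
  shows "cs_norm B b \<le> c"
proof (rule ccontr)
  assume "\<not> cs_norm B b \<le> c"
  \<comment> \<open>Strictly above \<open>c\<close>, so that every fibre norm leaves room for a
    peak; also positive when \<open>c = 0\<close>, so that it can be divided by.\<close>
  then obtain c' where c': "c < c'" "c' < cs_norm B b" using dense[of c "cs_norm B b"] by auto
  have c'0: "c' > 0" using c c' by simp
  define p where "p = cs_star B b \<otimes> b"
  have p: "p \<in> cs_carrier B" "cs_star B p = p" "cs_norm B p = (cs_norm B b)\<^sup>2"
    using b by (simp_all add: p_def closed star_mult star_star norm_cstar)
  have "c'\<^sup>2 < cs_norm B p" using c' c'0 p(3) by (simp add: power_strict_mono)
  moreover from this have pos: "cs_norm B p > 0" by (meson le_less_trans zero_le_power2)
  ultimately have "c'\<^sup>2 / cs_norm B p < 1" by simp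
  \<comment> \<open>\<open>q < 1\<close> makes each \<open>W z\<close> below an open neighbourhood
    of \<open>z\<close>; the lower bound on \<open>q\<close> keeps \<open>q * cs_norm B p\<close>
    above \<open>c'^2\<close>, which drives the contradiction.\<close>
  then obtain q where q: "c'\<^sup>2 / cs_norm B p < q" "q < 1" using dense by blast
  have q0: "q > 0" using q(1) pos c'0 by (meson divide_pos_pos less_trans zero_less_power)
  have qp: "c'\<^sup>2 < q * cs_norm B p" using q(1) pos by (simp add: divide_less_eq)
  have "\<exists>G\<in>peak z. cs_norm B (act G b) < c'" if z: "z \<in> topspace X1" for z
  proof (cases z)
    case None
    then show ?thesis using b c'0 fibre_ideal_None by (auto simp: fibre_ideal_def)
  next
    case (Some x)
    then have "cs_norm (fibre z) (ev z b) < c'" using le[of x] z c' by auto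
    then show ?thesis using ev_norm_lessE[OF b] by metis
  qed
  then obtain G where G: "\<And>z. z \<in> topspace X1 \<Longrightarrow> G z \<in> peak z"
    "\<And>z. z \<in> topspace X1 \<Longrightarrow> cs_norm B (act (G z) b) < c'" by metis
  define E where "E z w = complex_of_real ((cmod (G z w))\<^sup>2)" for z w
  have E: "E z \<in> C1_functions X" if "z \<in> topspace X1" for z
    unfolding E_def by (rule C1_compose[OF peakD(1)[OF G(1)[OF that]]]) (intro continuous_intros)
  have actE: "cs_norm B (act (E z) p) \<le> c'\<^sup>2" if z: "z \<in> topspace X1" for z
  proof -
    have "act (E z) p = cs_star B (act (G z) b) \<otimes> act (G z) b"
      using b peakD(1)[OF G(1)[OF z]]
      by (simp add: act_star_mult p_def E_def[abs_def] complex_norm_square mult.commute del: of_real_power)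
    then have "cs_norm B (act (E z) p) = (cs_norm B (act (G z) b))\<^sup>2"
      using b norm_cstar[of "act (G z) b"] peakD(1)[OF G(1)[OF z]] by (simp add: act_closed)
    also have "\<dots> \<le> c'\<^sup>2"
      using G(2)[OF z] b peakD(1)[OF G(1)[OF z]] by (intro power_mono) (auto simp: norm_nonneg act_closed)
    finally show ?thesis .
  qed
  define W where "W z = {w \<in> topspace X1. E z w \<in> {v. q < Re v}}" for z
  have "openin X1 (W z)" if "z \<in> topspace X1" for z
    unfolding W_def using E[OF that]
    by (intro openin_continuous_map_preimage[where Y=euclidean])
      (auto simp: C1_functions_def intro!: open_Collect_less continuous_intros)
  moreover have "topspace X1 \<subseteq> \<Union>(W ` topspace X1)"
  proof
    fix z assume z: "z \<in> topspace X1"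
    then have "z \<in> W z" using peakD(2)[OF G(1)[OF z]] q by (simp add: W_def E_def)
    then show "z \<in> \<Union>(W ` topspace X1)" using z by blast
  qed
  ultimately have "\<exists>\<F>. finite \<F> \<and> \<F> \<subseteq> W ` topspace X1 \<and> topspace X1 \<subseteq> \<Union>\<F>"
    using compact_space_Alexandroff_compactification[of X] unfolding compact_space_def
    by (intro compactinD) blast+
  then obtain \<F> where F: "finite \<F>" "\<F> \<subseteq> W ` topspace X1" "topspace X1 \<subseteq> \<Union>\<F>" by metis
  then obtain Z where Z: "finite Z" "Z \<subseteq> topspace X1" "topspace X1 \<subseteq> \<Union>(W ` Z)"
    using finite_subset_image[OF F(1,2)] F(3) by metis
  \<comment> \<open>The sum \<open>S\<close> of the \<open>n\<close>-th powers of the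
    \<open>E z\<close> is at least \<open>q ^ n\<close> on the compactification, so its inverse acts
    with norm at most \<open>1 / q ^ n\<close>. Each summand turns the \<open>n\<close>-th power of
    \<open>p\<close> into the \<open>n\<close>-th power of \<open>act (E z) p\<close>, of norm at
    most \<open>c'^2\<close> to the power \<open>n\<close>. The right-hand side
    \<open>card Z\<close> does not depend on \<open>m\<close>.\<close>
  have bound: "(q * cs_norm B p / c'\<^sup>2) ^ (2 ^ m) \<le> card Z" for m
  proof -
    define n :: nat where "n = 2 ^ m"
    define S where "S w = (\<Sum>z\<in>Z. E z w ^ n)" for w
    define R where "R w = complex_of_real (1 / max (q ^ n) (Re (S w)))" for w
    have En: "(\<lambda>w. E z w ^ n) \<in> C1_functions X" if "z \<in> Z" for z
      using that Z E by (intro C1_power) auto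
    have S: "S \<in> C1_functions X" unfolding S_def using Z En by (intro C1_sum) auto
    have qn: "q ^ n > 0" using q0 by simp
    have "max (q ^ n) x \<noteq> 0" for x using less_le_trans[OF qn max.cobounded1[of "q ^ n" x]] by simp
    then have R: "R \<in> C1_functions X"
      unfolding R_def by (intro C1_compose[OF S] continuous_intros) auto
    have RS: "R w * S w = 1" if w: "w \<in> topspace X1" for w
    proof -
      have Sw: "S w = complex_of_real (\<Sum>z\<in>Z. (cmod (G z w))\<^sup>2 ^ n)" by (simp add: S_def E_def)
      obtain z where z: "z \<in> Z" "w \<in> W z" using Z w by blast
      have "q ^ n \<le> (cmod (G z w))\<^sup>2 ^ n"
        using z q0 by (intro power_mono) (auto simp: W_def E_def)
      also have "\<dots> \<le> (\<Sum>z\<in>Z. (cmod (G z w))\<^sup>2 ^ n)"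
        using z Z by (intro member_le_sum) auto
      finally have "q ^ n \<le> Re (S w)" using Sw by simp
      then show ?thesis
        using qn Sw by (simp add: R_def max_def complex_eq_iff)
    qed
    have pn: "iter_sq m p \<in> cs_carrier B" using p by (simp add: iter_sq_closed)
    have "iter_sq m p = act (\<lambda>w. 1) (iter_sq m p)" using pn by (simp add: act_const scale_one)
    also have "\<dots> = act (\<lambda>w. R w * S w) (iter_sq m p)" by (rule act_cong) (simp add: RS)
    also have "\<dots> = act R (act S (iter_sq m p))" using R S pn by (simp add: act_act)
    finally have "cs_norm B (iter_sq m p) = cs_norm B (act R (act S (iter_sq m p)))" by simp
    also have "\<dots> \<le> (1 / q ^ n) * cs_norm B (act S (iter_sq m p))"
    proof (intro norm_act_le R act_closed S pn)
      show "cmod (R w) \<le> 1 / q ^ n" for w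
        using qn by (simp add: R_def norm_divide frac_le)
    qed (use q0 in simp)
    also have "cs_norm B (act S (iter_sq m p)) \<le> (\<Sum>z\<in>Z. cs_norm B (act (\<lambda>w. E z w ^ n) (iter_sq m p)))"
      unfolding S_def[abs_def] using Z En pn by (intro norm_act_sum) auto
    also have "\<dots> \<le> (\<Sum>z\<in>Z. (c'\<^sup>2) ^ n)"
    proof (intro sum_mono)
      fix z assume "z \<in> Z"
      then have z: "z \<in> topspace X1" using Z by blast
      have "act (\<lambda>w. E z w ^ n) (iter_sq m p) = iter_sq m (act (E z) p)"
        using iter_sq_act[OF E[OF z] p(1)] by (simp add: n_def)
      also have "cs_norm B \<dots> \<le> cs_norm B (act (E z) p) ^ n"
        unfolding n_def using E[OF z] p(1) by (intro norm_iter_sq_le act_closed)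
      also have "\<dots> \<le> (c'\<^sup>2) ^ n"
        using actE[OF z] E[OF z] p(1) by (intro power_mono) (auto simp: norm_nonneg act_closed)
      finally show "cs_norm B (act (\<lambda>w. E z w ^ n) (iter_sq m p)) \<le> (c'\<^sup>2) ^ n" .
    qed
    finally have "cs_norm B p ^ n \<le> (1 / q ^ n) * (card Z * (c'\<^sup>2) ^ n)"
      using q0 norm_iter_sq[OF p(1,2), of m] by (simp add: n_def divide_right_mono)
    then have "q ^ n * cs_norm B p ^ n \<le> card Z * (c'\<^sup>2) ^ n"
      using qn by (simp add: field_simps)
    then show ?thesis
      using c'0 by (simp add: n_def power_divide power_mult_distrib divide_le_eq)
  qed
  have "q * cs_norm B p / c'\<^sup>2 > 1" using qp c'0 by (simp add: less_divide_eq)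
  then obtain m where m: "real (card Z) < (q * cs_norm B p / c'\<^sup>2) ^ m" using real_arch_pow by blast
  also have "\<dots> \<le> (q * cs_norm B p / c'\<^sup>2) ^ (2 ^ m)"
    using \<open>q * cs_norm B p / c'\<^sup>2 > 1\<close> by (intro power_increasing) (auto simp: less_imp_le)
  finally show False using bound[of m] by simp
qed

end


section \<open>Restriction ideals\<close>

text \<open>Extension by zero. The delicate case is a preimage of a neighbourhood of 0: it contains
  all points where the modulus is below some \<open>e\<close>, and these form an open set because
  compact sets are closed in a Hausdorff space.\<close>

lemma C0_on_imp_C0:
  assumes X: "Hausdorff_space X" and U: "openin X U" and f: "f \<in> C0_on X U"
  shows "f \<in> C0_functions X"
proof -
  have top: "topspace (subtopology X U) = U" using openin_subset[OF U] by auto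
  have f0: "f x = 0" if "x \<notin> U" for x using f that top by (simp add: C0_functions_def)
  have contf: "continuous_map (subtopology X U) euclidean f" using f by (simp add: C0_functions_def)
  have comp: "compactin X {x \<in> topspace X. e \<le> cmod (f x)}" if e: "e > 0" for e
  proof -
    have "{x \<in> topspace X. e \<le> cmod (f x)} = {x \<in> U. e \<le> cmod (f x)}"
      using e openin_subset[OF U] f0 by (metis (no_types, lifting) Collect_cong norm_zero not_le subsetD)
    moreover have "compactin (subtopology X U) {x \<in> U. e \<le> cmod (f x)}"
      using f e unfolding C0_functions_def top by simp
    ultimately show ?thesis by (simp add: compactin_subtopology)
  qed
  have "openin X {x \<in> topspace X. f x \<in> V}" if V: "open V" for V
  proof -
    have opU: "openin X {x \<in> U. f x \<in> V}"
      using openin_continuous_map_preimage[OF contf, of V] V U unfolding top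
      by (simp add: openin_open_subtopology)
    show ?thesis
    proof (cases "0 \<in> V")
      case False
      then have "{x \<in> topspace X. f x \<in> V} = {x \<in> U. f x \<in> V}"
        using f0 openin_subset[OF U] by (metis (no_types, lifting) Collect_cong subsetD)
      then show ?thesis using opU by simp
    next
      case True
      then obtain e where e: "e > 0" "ball 0 e \<subseteq> V" using V open_contains_ball by blast
      let ?C = "{x \<in> topspace X. e \<le> cmod (f x)}"
      have "closedin X ?C" using comp[OF e(1)] X by (rule compactin_imp_closedin[rotated])
      then have "openin X (topspace X - ?C)" by blast
      then have "openin X ({x \<in> U. f x \<in> V} \<union> (topspace X - ?C))" using opU by blast
      moreover have "{x \<in> topspace X. f x \<in> V} = {x \<in> U. f x \<in> V} \<union> (topspace X - ?C)"
      proof (intro equalityI subsetI)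
        fix x assume x: "x \<in> {x \<in> topspace X. f x \<in> V}"
        show "x \<in> {x \<in> U. f x \<in> V} \<union> (topspace X - ?C)"
          using x f0[of x] e by (cases "x \<in> U") auto
      next
        fix x assume x: "x \<in> {x \<in> U. f x \<in> V} \<union> (topspace X - ?C)"
        have "f x \<in> V" if "\<not> e \<le> cmod (f x)"
          using e(2) that by (auto simp: subset_iff)
        then show "x \<in> {x \<in> topspace X. f x \<in> V}" using x openin_subset[OF U] by auto
      qed
      ultimately show ?thesis by simp
    qed
  qed
  then have "continuous_map X euclidean f" by (simp add: continuous_map_def)
  moreover have "f x = 0" if "x \<notin> topspace X" for x using f0[of x] that openin_subset[OF U] by blast
  ultimately show ?thesis using comp by (simp add: C0_functions_def)
qed

lemma C0_onI:
  assumes f: "f \<in> C0_functions X" and U: "U \<subseteq> topspace X" and 0: "\<And>x. x \<notin> U \<Longrightarrow> f x = 0"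
  shows "f \<in> C0_on X U"
proof -
  have top: "topspace (subtopology X U) = U" using U by auto
  have "compactin (subtopology X U) {x \<in> U. e \<le> cmod (f x)}" if e: "e > 0" for e
  proof -
    have "{x \<in> topspace X. e \<le> cmod (f x)} = {x \<in> U. e \<le> cmod (f x)}"
      using e U 0 by (metis (no_types, lifting) Collect_cong norm_zero not_le subsetD)
    moreover have "compactin X {x \<in> topspace X. e \<le> cmod (f x)}"
      using f e by (simp add: C0_functions_def)
    ultimately have "compactin X {x \<in> U. e \<le> cmod (f x)}" by simp
    then show ?thesis by (auto simp: compactin_subtopology)
  qed
  then show ?thesis
    using f 0 unfolding C0_functions_def top by (auto intro: continuous_map_from_subtopology)
qed

lemma C0_mult:
  assumes X: "Hausdorff_space X" and f: "f \<in> C0_functions X" and g: "g \<in> C0_functions X"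
  shows "(\<lambda>x. f x * g x) \<in> C0_functions X"
proof -
  have "vanishing_part X (\<lambda>z. extend_C0 f z * extend_C0 g z) = (\<lambda>x. f x * g x)"
    using f g by (auto simp: vanishing_part_def C0_functions_def)
  then show ?thesis
    using vanishing_part_C0[OF C1_mult[OF extend_C0_C1[OF X f] extend_C0_C1[OF X g]]] by simp
qed

lemma C0_cnj:
  assumes "f \<in> C0_functions X"
  shows "(\<lambda>x. cnj (f x)) \<in> C0_functions X"
proof -
  have "continuous_map X euclidean (cnj \<circ> f)"
    using assms by (intro continuous_map_compose[where X'=euclidean])
      (auto simp: C0_functions_def linear_continuous_on bounded_linear_cnj)
  then show ?thesis using assms by (simp add: C0_functions_def o_def)
qed

lemma C0_bounded:
  assumes X: "Hausdorff_space X" and f: "f \<in> C0_functions X"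
  obtains M where "M \<ge> 0" "\<And>x. cmod (f x) \<le> M"
proof -
  obtain M where M: "M \<ge> 0" "\<And>z. z \<in> topspace (Alexandroff_compactification X) \<Longrightarrow> cmod (extend_C0 f z) \<le> M"
    using C1_bounded[OF extend_C0_C1[OF X f]] by metis
  have "cmod (f x) \<le> M" for x
    using M(1) M(2)[of "Some x"] f by (cases "x \<in> topspace X") (auto simp: C0_functions_def)
  then show ?thesis using that M(1) by blast
qed

section \<open>Functions acting on and modulo the restriction ideals\<close>

context C0_module
begin

lemma open_complement_closure: "openin X (topspace X - X closure_of Y)"
  by (simp add: openin_diff)

lemma restriction_generator:
  assumes "f \<in> C0_on X (topspace X - X closure_of Y)"
  shows "f \<in> C0_functions X" "x \<in> X closure_of Y \<Longrightarrow> f x = 0"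
  using C0_on_imp_C0[OF Hausdorff open_complement_closure assms] assms
  by (auto simp: C0_functions_def)

lemma star_ideal_restriction: "star_ideal B (restriction_ideal X B \<theta> Y)"
proof
  let ?U = "topspace X - X closure_of Y"
  let ?G = "{C0_act \<theta> f v | f v. f \<in> C0_on X ?U \<and> v \<in> cs_carrier B}"
  have G: "?G \<subseteq> cs_carrier B" using restriction_generator C0_act_linear(1) by blast
  show "closed_ideal B (restriction_ideal X B \<theta> Y)"
    unfolding restriction_ideal_def C0_ideal_def by (rule closed_ideal_generated[OF G])
  have "cs_star B g \<in> ?G" if g: "g \<in> ?G" for g
  proof -
    obtain f v where f: "f \<in> C0_on X ?U" "v \<in> cs_carrier B" "g = C0_act \<theta> f v" using g by blast
    then have "cs_star B g = C0_act \<theta> (\<lambda>x. cnj (f x)) (cs_star B v)"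
      by (simp add: C0_act_hom restriction_generator)
    then show ?thesis using f C0_cnj star_closed by blast
  qed
  then show "cs_star B i \<in> restriction_ideal X B \<theta> Y" if "i \<in> restriction_ideal X B \<theta> Y" for i
    using generated_closed_ideal_star[OF G] that unfolding restriction_ideal_def C0_ideal_def by blast
qed

lemma restriction_ideal_least:
  assumes "closed_ideal B J"
    and "\<And>f v. \<lbrakk>f \<in> C0_on X (topspace X - X closure_of Y); v \<in> cs_carrier B\<rbrakk> \<Longrightarrow> C0_act \<theta> f v \<in> J"
  shows "restriction_ideal X B \<theta> Y \<subseteq> J"
  unfolding restriction_ideal_def C0_ideal_def
  using assms by (intro generated_closed_ideal_least) auto

lemma restriction_idealI:
  "\<lbrakk>f \<in> C0_on X (topspace X - X closure_of Y); v \<in> cs_carrier B\<rbrakk>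
    \<Longrightarrow> C0_act \<theta> f v \<in> restriction_ideal X B \<theta> Y"
  unfolding restriction_ideal_def C0_ideal_def generated_closed_ideal_def by blast

lemma restriction_ideal_antimono:
  assumes "Y \<subseteq> Y'"
  shows "restriction_ideal X B \<theta> Y' \<subseteq> restriction_ideal X B \<theta> Y"
proof (rule restriction_ideal_least)
  show "closed_ideal B (restriction_ideal X B \<theta> Y)"
    using star_ideal_restriction by (rule star_ideal.ideal)
  fix f v assume f: "f \<in> C0_on X (topspace X - X closure_of Y')" and v: "v \<in> cs_carrier B"
  have "f \<in> C0_on X (topspace X - X closure_of Y)"
  proof (rule C0_onI[OF restriction_generator(1)[OF f]])
    fix x assume x: "x \<notin> topspace X - X closure_of Y"
    then have "x \<notin> topspace X \<or> x \<in> X closure_of Y'" using closure_of_mono[OF assms] by blast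
    then show "f x = 0"
      using restriction_generator[OF f] by (auto simp: C0_functions_def)
  qed auto
  then show "C0_act \<theta> f v \<in> restriction_ideal X B \<theta> Y" using v by (rule restriction_idealI)
qed

lemma restriction_ideal_fibre:
  assumes x: "x \<in> X closure_of Y"
  shows "restriction_ideal X B \<theta> Y \<subseteq> fibre_ideal (Some x)"
proof (rule restriction_ideal_least)
  show "closed_ideal B (fibre_ideal (Some x))" using star_ideal_fibre by (rule star_ideal.ideal)
  fix f v assume f: "f \<in> C0_on X (topspace X - X closure_of Y)" and v: "v \<in> cs_carrier B"
  note f' = restriction_generator[OF f]
  have "act (extend_C0 f) v \<in> fibre_ideal (Some x)"
    using f' x v by (intro act_mem_fibre_ideal extend_C0_C1 Hausdorff) simp_all
  then show "C0_act \<theta> f v \<in> fibre_ideal (Some x)" using f' v by (simp add: act_extend)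
qed

text \<open>Functions living on \<open>Y\<close> and functions living off the closure of
  \<open>Y\<close> have product zero, and the elements killed by \<open>f\<close> form a closed
  ideal.\<close>

lemma C0_act_restriction_ideal:
  assumes Y: "openin X Y" and f: "f \<in> C0_on X Y" and i: "i \<in> restriction_ideal X B \<theta> Y"
  shows "C0_act \<theta> f i = \<zero>"
proof -
  note fC = C0_on_imp_C0[OF Hausdorff Y f]
  note f1 = extend_C0_C1[OF Hausdorff fC]
  have "restriction_ideal X B \<theta> Y \<subseteq> {b \<in> cs_carrier B. act (extend_C0 f) b \<in> {\<zero>}}"
  proof (rule restriction_ideal_least[OF closed_ideal_act_preimage[OF f1 closed_ideal_zero]])
    fix g v assume g: "g \<in> C0_on X (topspace X - X closure_of Y)" and v: "v \<in> cs_carrier B"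
    note g' = restriction_generator[OF g]
    have fg: "f x * g x = 0" for x
    proof (cases "x \<in> Y")
      case True
      then have "x \<in> X closure_of Y"
        using closure_of_subset[OF openin_subset[OF Y]] by blast
      then show ?thesis using g'(2) by simp
    next
      case False
      then have "x \<notin> topspace (subtopology X Y)" by simp
      then have "f x = 0" using f unfolding C0_functions_def by blast
      then show ?thesis by simp
    qed
    have "act (extend_C0 f) (C0_act \<theta> g v) = act (\<lambda>z. extend_C0 f z * extend_C0 g z) v"
      using f1 g'(1) v by (simp add: act_act extend_C0_C1 Hausdorff flip: act_extend)
    also have "(\<lambda>z. extend_C0 f z * extend_C0 g z) = (\<lambda>z. 0)"
    proof
      show "extend_C0 f z * extend_C0 g z = 0" for z using fg by (cases z) auto
    qed
    finally show "C0_act \<theta> g v \<in> {b \<in> cs_carrier B. act (extend_C0 f) b \<in> {\<zero>}}"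
      using v g'(1) by (simp add: act_const scale_zero_left C0_act_linear)
  qed
  then have "act (extend_C0 f) i = \<zero>" "i \<in> cs_carrier B" using i by auto
  then show ?thesis using fC by (simp add: act_extend)
qed

text \<open>\<open>g - 1\<close> need not vanish at infinity, so it is handled as a function on the
  compactification and tested on elements \<open>f v\<close>. There \<open>(g - 1) f\<close> does
  vanish at infinity and on the closure of \<open>Y\<close>, hence gives a generator of the
  ideal.\<close>

lemma C0_act_diff_restriction_ideal:
  assumes Y: "Y \<subseteq> topspace X" and g: "g \<in> C0_functions X" "\<And>x. x \<in> Y \<Longrightarrow> g x = 1"
    and b: "b \<in> cs_carrier B"
  shows "C0_act \<theta> g b \<ominus> b \<in> restriction_ideal X B \<theta> Y"
proof -
  let ?I = "restriction_ideal X B \<theta> Y" and ?D = "\<lambda>z. extend_C0 g z - 1"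
  have I: "closed_ideal B ?I" using star_ideal_restriction by (rule star_ideal.ideal)
  note g1 = extend_C0_C1[OF Hausdorff g(1)]
  have D: "?D \<in> C1_functions X" using g1 by (simp add: C1_diff)
  \<comment> \<open>The ideal is built from the complement of the closure, so the equation
    \<open>g = 1\<close> has to be carried from \<open>Y\<close> to its closure by
    continuity.\<close>
  have gcl: "g x = 1" if x: "x \<in> X closure_of Y" for x
  proof -
    have "continuous_map X euclidean g" using g by (simp add: C0_functions_def)
    then have "closedin X {x \<in> topspace X. g x \<in> {1}}"
      by (rule closedin_continuous_map_preimage) simp
    moreover have "Y \<subseteq> {x \<in> topspace X. g x \<in> {1}}" using g(2) Y by auto
    ultimately have "X closure_of Y \<subseteq> {x \<in> topspace X. g x \<in> {1}}" by (rule closure_of_minimal[rotated])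
    then show ?thesis using x by auto
  qed
  have "{b \<in> cs_carrier B. act ?D b \<in> ?I} = cs_carrier B"
  proof (rule nondegenerate[OF closed_ideal_act_preimage[OF D I]])
    fix f v assume f: "f \<in> C0_functions X" and v: "v \<in> cs_carrier B"
    note f1 = extend_C0_C1[OF Hausdorff f]
    let ?k = "vanishing_part X (\<lambda>z. ?D z * extend_C0 f z)"
    have k: "?k \<in> C0_functions X" by (intro vanishing_part_C0 C1_mult D f1)
    have kon: "?k \<in> C0_on X (topspace X - X closure_of Y)"
      by (rule C0_onI[OF k]) (auto simp: vanishing_part_def gcl)
    have "act ?D (C0_act \<theta> f v) = act (\<lambda>z. ?D z * extend_C0 f z) v"
      using D f f1 v by (simp add: act_act flip: act_extend)
    also have "\<dots> = act (extend_C0 ?k) v"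
      by (rule act_cong) (auto simp: vanishing_part_def)
    also have "\<dots> = C0_act \<theta> ?k v" using k v by (rule act_extend)
    also have "\<dots> \<in> ?I" using kon v by (rule restriction_idealI)
    finally show "C0_act \<theta> f v \<in> {b \<in> cs_carrier B. act ?D b \<in> ?I}"
      using f v by (simp add: C0_act_linear)
  qed
  then have "act ?D b \<in> ?I" using b by blast
  then show ?thesis
    using g g1 b by (simp add: act_diff_left act_const scale_one act_extend)
qed

end


section \<open>Bounded fields\<close>

locale cstar_family =
  fixes S :: "'x set" and F :: "'x \<Rightarrow> 'u cstar"
  assumes family: "x \<in> S \<Longrightarrow> cstar_algebra (F x)"
begin

abbreviation P where "P \<equiv> bounded_fields S F"

lemmas fam_closed = cstar_algebra.closed[OF family]

lemma field_closed: "\<lbrakk>a \<in> cs_carrier P; x \<in> S\<rbrakk> \<Longrightarrow> a x \<in> cs_carrier (F x)"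
  by (auto simp: bounded_fields_def PiE_iff)

lemma field_boundE:
  assumes "a \<in> cs_carrier P"
  obtains c where "c \<ge> 0" "\<And>x. x \<in> S \<Longrightarrow> cs_norm (F x) (a x) \<le> c"
proof -
  obtain c where c: "\<And>x. x \<in> S \<Longrightarrow> cs_norm (F x) (a x) \<le> c"
    using assms by (auto simp: bounded_fields_def)
  show ?thesis by (rule that[of "max 0 c"]) (use c in \<open>auto simp: le_max_iff_disj\<close>)
qed

lemma field_norm_le:
  assumes a: "a \<in> cs_carrier P" and x: "x \<in> S"
  shows "cs_norm (F x) (a x) \<le> cs_norm P a"
proof -
  obtain c where c: "c \<ge> 0" "\<And>x. x \<in> S \<Longrightarrow> cs_norm (F x) (a x) \<le> c" using field_boundE[OF a] by blast
  have "bdd_above (insert 0 ((\<lambda>x. cs_norm (F x) (a x)) ` S))"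
    by (rule bdd_aboveI[of _ c]) (use c in auto)
  then show ?thesis using x by (simp add: bounded_fields_def cSup_upper)
qed

lemma field_norm_least:
  "\<lbrakk>c \<ge> 0; \<And>x. x \<in> S \<Longrightarrow> cs_norm (F x) (a x) \<le> c\<rbrakk> \<Longrightarrow> cs_norm P a \<le> c"
  by (auto simp: bounded_fields_def intro!: cSup_least)

lemma field_norm_nonneg:
  assumes a: "a \<in> cs_carrier P"
  shows "0 \<le> cs_norm P a"
proof -
  obtain c where c: "c \<ge> 0" "\<And>x. x \<in> S \<Longrightarrow> cs_norm (F x) (a x) \<le> c" using field_boundE[OF a] by blast
  have "bdd_above (insert 0 ((\<lambda>x. cs_norm (F x) (a x)) ` S))"
    by (rule bdd_aboveI[of _ c]) (use c in auto)
  then show ?thesis by (simp add: bounded_fields_def cSup_upper)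
qed

lemma fieldI:
  assumes "\<And>x. x \<in> S \<Longrightarrow> a x \<in> cs_carrier (F x)" "a \<in> extensional S"
    and "\<And>x. x \<in> S \<Longrightarrow> cs_norm (F x) (a x) \<le> c"
  shows "a \<in> cs_carrier P"
  using assms by (auto simp: bounded_fields_def PiE_iff)

lemma field_ops:
  "\<zero>\<^bsub>P\<^esub> = (\<lambda>x\<in>S. \<zero>\<^bsub>F x\<^esub>)" "a \<oplus>\<^bsub>P\<^esub> b = (\<lambda>x\<in>S. a x \<oplus>\<^bsub>F x\<^esub> b x)"
  "c \<odot>\<^bsub>P\<^esub> a = (\<lambda>x\<in>S. c \<odot>\<^bsub>F x\<^esub> a x)" "a \<otimes>\<^bsub>P\<^esub> b = (\<lambda>x\<in>S. a x \<otimes>\<^bsub>F x\<^esub> b x)"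
  "cs_star P a = (\<lambda>x\<in>S. cs_star (F x) (a x))"
  by (simp_all add: bounded_fields_def)

lemma field_diff: "x \<in> S \<Longrightarrow> (a \<ominus>\<^bsub>P\<^esub> b) x = a x \<ominus>\<^bsub>F x\<^esub> b x"
  by (simp add: cs_diff_def field_ops)

lemma field_eqI:
  assumes "a \<in> cs_carrier P" "b \<in> cs_carrier P" "\<And>x. x \<in> S \<Longrightarrow> a x = b x"
  shows "a = b"
  using assms by (intro PiE_ext[of a S "\<lambda>x. cs_carrier (F x)"]) (auto simp: bounded_fields_def)

lemma field_ops_closed:
  "\<zero>\<^bsub>P\<^esub> \<in> cs_carrier P"
  "\<lbrakk>a \<in> cs_carrier P; b \<in> cs_carrier P\<rbrakk> \<Longrightarrow> a \<oplus>\<^bsub>P\<^esub> b \<in> cs_carrier P"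
  "a \<in> cs_carrier P \<Longrightarrow> c \<odot>\<^bsub>P\<^esub> a \<in> cs_carrier P"
  "\<lbrakk>a \<in> cs_carrier P; b \<in> cs_carrier P\<rbrakk> \<Longrightarrow> a \<otimes>\<^bsub>P\<^esub> b \<in> cs_carrier P"
  "a \<in> cs_carrier P \<Longrightarrow> cs_star P a \<in> cs_carrier P"
proof -
  show "\<zero>\<^bsub>P\<^esub> \<in> cs_carrier P"
    by (rule fieldI[where c=0]) (auto simp: field_ops fam_closed cstar_algebra.norm_zero[OF family])
  show "c \<odot>\<^bsub>P\<^esub> a \<in> cs_carrier P" if a: "a \<in> cs_carrier P"
    by (rule fieldI[where c="cmod c * cs_norm P a"])
      (auto simp: field_ops fam_closed field_closed[OF a] cstar_algebra.norm_scale[OF family]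
        intro!: mult_left_mono field_norm_le a)
  show "cs_star P a \<in> cs_carrier P" if a: "a \<in> cs_carrier P"
    by (rule fieldI[where c="cs_norm P a"])
      (auto simp: field_ops fam_closed field_closed[OF a] cstar_algebra.norm_star[OF family]
        intro!: field_norm_le a)
  assume a: "a \<in> cs_carrier P" and b: "b \<in> cs_carrier P"
  show "a \<oplus>\<^bsub>P\<^esub> b \<in> cs_carrier P"
    by (rule fieldI[where c="cs_norm P a + cs_norm P b"])
      (auto simp: field_ops fam_closed field_closed[OF a] field_closed[OF b]
        intro!: order_trans[OF cstar_algebra.norm_triangle[OF family]] add_mono field_norm_le a b)
  show "a \<otimes>\<^bsub>P\<^esub> b \<in> cs_carrier P"
    by (rule fieldI[where c="cs_norm P a * cs_norm P b"])
      (auto simp: field_ops fam_closed field_closed[OF a] field_closed[OF b]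
        intro!: order_trans[OF cstar_algebra.norm_mult[OF family]] mult_mono field_norm_le
          field_norm_nonneg cstar_algebra.norm_nonneg[OF family] a b)
qed

lemma fields_complete:
  assumes s: "\<And>n::nat. s n \<in> cs_carrier P"
    and C: "\<And>e. e > 0 \<Longrightarrow> \<exists>N. \<forall>m\<ge>N. \<forall>n\<ge>N. cs_norm P (s m \<ominus>\<^bsub>P\<^esub> s n) < e"
  shows "\<exists>l\<in>cs_carrier P. cs_tendsto P s l"
proof -
  have diffc: "a \<ominus>\<^bsub>P\<^esub> b \<in> cs_carrier P" if "a \<in> cs_carrier P" "b \<in> cs_carrier P" for a b
    using that by (simp add: cs_diff_def field_ops_closed)
  have pt: "cs_norm (F x) (s m x \<ominus>\<^bsub>F x\<^esub> s n x) \<le> cs_norm P (s m \<ominus>\<^bsub>P\<^esub> s n)" if "x \<in> S" for x m n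
    using field_norm_le[OF diffc[OF s s] that, of m n] by (simp add: field_diff that)
  have "\<exists>l\<in>cs_carrier (F x). cs_tendsto (F x) (\<lambda>n. s n x) l" if x: "x \<in> S" for x
    by (rule cstar_algebra.complete[OF family[OF x]])
      (use field_closed[OF s x] C pt[OF x] in \<open>auto, meson le_less_trans\<close>)
  then obtain l where l: "\<And>x. x \<in> S \<Longrightarrow> l x \<in> cs_carrier (F x)"
    "\<And>x. x \<in> S \<Longrightarrow> cs_tendsto (F x) (\<lambda>n. s n x) (l x)" by metis
  \<comment> \<open>Let \<open>m\<close> tend to infinity in the Cauchy estimate. The index
    \<open>N\<close> is the same for all \<open>x\<close>, so the pointwise limits are
    uniform.\<close>
  have lim: "cs_norm (F x) (s n x \<ominus>\<^bsub>F x\<^esub> l x) \<le> e"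
    if x: "x \<in> S" and N: "\<And>m. m \<ge> N \<Longrightarrow> cs_norm P (s m \<ominus>\<^bsub>P\<^esub> s n) < e" for x n e N
  proof (rule LIMSEQ_le_const)
    interpret Fx: cstar_algebra "F x" by (rule family[OF x])
    show "(\<lambda>m. e + cs_norm (F x) (s m x \<ominus>\<^bsub>F x\<^esub> l x)) \<longlonglongrightarrow> e"
      using tendsto_add[OF tendsto_const l(2)[OF x], of e] by simp
    have "cs_norm (F x) (s n x \<ominus>\<^bsub>F x\<^esub> l x) \<le> e + cs_norm (F x) (s m x \<ominus>\<^bsub>F x\<^esub> l x)" if m: "m \<ge> N" for m
    proof -
      have "cs_norm (F x) (s n x \<ominus>\<^bsub>F x\<^esub> l x)
          \<le> cs_norm (F x) (s n x \<ominus>\<^bsub>F x\<^esub> s m x) + cs_norm (F x) (s m x \<ominus>\<^bsub>F x\<^esub> l x)"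
        using field_closed[OF s x] l(1)[OF x] by (intro Fx.norm_diff_triangle)
      moreover have "cs_norm (F x) (s n x \<ominus>\<^bsub>F x\<^esub> s m x) \<le> e"
        using pt[OF x, of m n] N[OF m] Fx.norm_diff_commute[of "s n x" "s m x"] field_closed[OF s x] by simp
      ultimately show ?thesis by simp
    qed
    then show "\<exists>M. \<forall>m\<ge>M. cs_norm (F x) (s n x \<ominus>\<^bsub>F x\<^esub> l x) \<le> e + cs_norm (F x) (s m x \<ominus>\<^bsub>F x\<^esub> l x)"
      by blast
  qed
  define L where "L = restrict l S"
  have L: "L \<in> cs_carrier P"
  proof -
    obtain N where N: "\<And>m. m \<ge> N \<Longrightarrow> cs_norm P (s m \<ominus>\<^bsub>P\<^esub> s N) < 1"
      using C[of 1] by (metis order_refl zero_less_one)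
    have "cs_norm (F x) (l x) \<le> cs_norm P (s N) + 1" if x: "x \<in> S" for x
    proof -
      interpret Fx: cstar_algebra "F x" by (rule family[OF x])
      have "cs_norm (F x) (l x) \<le> cs_norm (F x) (s N x) + cs_norm (F x) (s N x \<ominus>\<^bsub>F x\<^esub> l x)"
        using Fx.norm_le_add_diff[of "l x" "s N x"] Fx.norm_diff_commute[of "l x" "s N x"]
          field_closed[OF s x] l(1)[OF x] by simp
      then show ?thesis using field_norm_le[OF s x, of N] lim[OF x, where N=N and n=N and e=1] N by simp
    qed
    then show ?thesis by (intro fieldI) (auto simp: L_def l)
  qed
  have "cs_tendsto P s L"
  proof (rule LIMSEQ_I)
    fix e :: real assume e: "e > 0"
    then obtain N where N: "\<And>m n. \<lbrakk>m \<ge> N; n \<ge> N\<rbrakk> \<Longrightarrow> cs_norm P (s m \<ominus>\<^bsub>P\<^esub> s n) < e/2"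
      using C[of "e/2"] by auto
    have "cs_norm P (s n \<ominus>\<^bsub>P\<^esub> L) \<le> e/2" if n: "n \<ge> N" for n
    proof (rule field_norm_least)
      fix x assume x: "x \<in> S"
      then show "cs_norm (F x) ((s n \<ominus>\<^bsub>P\<^esub> L) x) \<le> e/2"
        using lim[OF x N[OF _ n]] by (simp add: field_diff L_def)
    qed (use e in simp)
    then show "\<exists>no. \<forall>n\<ge>no. norm (cs_norm P (s n \<ominus>\<^bsub>P\<^esub> L) - 0) < e"
      using e field_norm_nonneg[OF diffc[OF s L]] by (intro exI[of _ N]) force
  qed
  then show ?thesis using L by blast
qed

lemma fields_cstar: "cstar_algebra P"
proof -
  note ax = field_ops_closed field_closed
  have restr: "restrict f S = restrict g S" if "\<And>x. x \<in> S \<Longrightarrow> f x = g x" for f g :: "'x \<Rightarrow> 'u"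
    using that by auto
  have id: "restrict (\<lambda>x. a x) S = a" if "a \<in> cs_carrier P" for a
    using that by (auto simp: bounded_fields_def PiE_iff extensional_def)
  show ?thesis
  proof (unfold_locales, goal_cases)
    case (23 a)
    have "a x = \<zero>\<^bsub>P\<^esub> x" if "cs_norm P a = 0" and x: "x \<in> S" for x
      using field_norm_le[OF 23 x] cstar_algebra.norm_nonneg[OF family[OF x] field_closed[OF 23 x]]
        cstar_algebra.norm_eq_zero[OF family[OF x] field_closed[OF 23 x]] that
      by (simp add: field_ops)
    then have "cs_norm P a = 0 \<Longrightarrow> a = \<zero>\<^bsub>P\<^esub>"
      by (intro field_eqI[OF 23 field_ops_closed(1)])
    moreover have "cs_norm P \<zero>\<^bsub>P\<^esub> \<le> 0"
      by (rule field_norm_least) (auto simp: field_ops cstar_algebra.norm_zero[OF family])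
    ultimately show ?case
      using field_norm_nonneg[OF field_ops_closed(1)] by auto
  next
    case (24 a b)
    show ?case
      by (rule field_norm_least)
        (auto simp: field_ops field_norm_nonneg 24 field_closed
          intro!: order_trans[OF cstar_algebra.norm_triangle[OF family]] add_mono field_norm_le)
  next
    case (25 a c)
    have le: "cs_norm P (d \<odot>\<^bsub>P\<^esub> b) \<le> cmod d * cs_norm P b" if b: "b \<in> cs_carrier P" for d b
      by (rule field_norm_least)
        (auto simp: field_ops field_norm_nonneg b field_closed cstar_algebra.norm_scale[OF family]
          intro!: mult_left_mono field_norm_le)
    show ?case
    proof (cases "c = 0")
      case True
      then show ?thesis using le[OF 25, of c] field_norm_nonneg[OF field_ops_closed(3)[OF 25], of c] by simp
    next
      case False
      have "inverse c \<odot>\<^bsub>P\<^esub> (c \<odot>\<^bsub>P\<^esub> a) = a"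
        using False 25 by (intro field_eqI field_ops_closed)
          (simp_all add: field_ops cstar_algebra.scale_scale[OF family] cstar_algebra.scale_one[OF family] field_closed)
      then have "cs_norm P a \<le> inverse (cmod c) * cs_norm P (c \<odot>\<^bsub>P\<^esub> a)"
        using le[OF field_ops_closed(3)[OF 25], of "inverse c" c] by (simp add: norm_inverse)
      then show ?thesis using le[OF 25, of c] False by (simp add: field_simps)
    qed
  next
    case (26 a b)
    show ?case
      by (rule field_norm_least)
        (auto simp: field_ops field_norm_nonneg 26 field_closed
          intro!: order_trans[OF cstar_algebra.norm_mult[OF family]] mult_mono field_norm_le
            cstar_algebra.norm_nonneg[OF family])
  next
    case (27 a)
    let ?r = "cs_star P a \<otimes>\<^bsub>P\<^esub> a"
    have r: "?r \<in> cs_carrier P" using 27 by (simp add: field_ops_closed)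
    have rx: "cs_norm (F x) (?r x) = (cs_norm (F x) (a x))\<^sup>2" if "x \<in> S" for x
      using that 27 by (simp add: field_ops cstar_algebra.norm_cstar[OF family] field_closed)
    have "cs_norm P ?r \<le> (cs_norm P a)\<^sup>2"
      by (rule field_norm_least)
        (auto simp: rx field_closed 27 intro!: power_mono field_norm_le cstar_algebra.norm_nonneg[OF family])
    moreover have "cs_norm P a \<le> sqrt (cs_norm P ?r)"
    proof (rule field_norm_least)
      show "cs_norm (F x) (a x) \<le> sqrt (cs_norm P ?r)" if x: "x \<in> S" for x
        using field_norm_le[OF r x] rx[OF x] by (simp add: real_le_rsqrt)
    qed (simp add: field_norm_nonneg r)
    then have "(cs_norm P a)\<^sup>2 \<le> (sqrt (cs_norm P ?r))\<^sup>2"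
      using field_norm_nonneg[OF 27] by (rule power_mono)
    ultimately show ?case using field_norm_nonneg[OF r] by simp
  next
    case (28 s)
    then show ?case by (rule fields_complete)
  qed (auto simp: field_ops_closed field_closed fam_closed intro!: field_eqI,
      auto simp: field_ops field_closed fam_closed
        cstar_algebra.add_ac[OF family] cstar_algebra.add_zero[OF family]
        cstar_algebra.add_minus[OF family] cstar_algebra.scale_add_right[OF family]
        cstar_algebra.scale_add_left[OF family] cstar_algebra.scale_scale[OF family]
        cstar_algebra.scale_one[OF family] cstar_algebra.mult_assoc[OF family]
        cstar_algebra.mult_add_left[OF family] cstar_algebra.mult_add_right[OF family]
        cstar_algebra.mult_scale_left[OF family] cstar_algebra.mult_scale_right[OF family]
        cstar_algebra.star_star[OF family] cstar_algebra.star_add[OF family]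
        cstar_algebra.star_scale[OF family] cstar_algebra.star_mult[OF family])
qed

end


section \<open>The algebra of a net\<close>

locale net_fields =
  fixes X :: "'x topology" and K :: "'x set set" and A :: "'x set \<Rightarrow> 'a cstar"
    and j :: "'x set \<Rightarrow> 'x set \<Rightarrow> 'a \<Rightarrow> 'a" and F :: "'x \<Rightarrow> 'u cstar"
    and \<epsilon> :: "'x \<Rightarrow> 'x set \<Rightarrow> 'a \<Rightarrow> 'u"
  assumes Hausdorff_X: "Hausdorff_space X"
    and open_K: "Y \<in> K \<Longrightarrow> openin X Y"
    and net: "cstar_net K A j"
    and fibres: "x \<in> topspace X \<Longrightarrow> is_universal_algebra (fibre_index K x) A j (F x) (\<epsilon> x)"
begin

abbreviation fields where "fields \<equiv> bounded_fields (topspace X) F"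
abbreviation alg where "alg \<equiv> net_C0_algebra X K A F \<epsilon>"
abbreviation struct where "struct \<equiv> net_C0_structure X K A F \<epsilon>"

definition gen :: "('x \<Rightarrow> complex) \<Rightarrow> 'x set \<Rightarrow> 'a \<Rightarrow> 'x \<Rightarrow> 'u" where
  "gen f Y t = field_mult X F f (eps_hat X F \<epsilon> Y t)"

definition gens :: "('x \<Rightarrow> 'u) set" where
  "gens = {gen f Y t | Y f t. Y \<in> K \<and> f \<in> C0_on X Y \<and> t \<in> cs_carrier (A Y)}"

lemma fam: "x \<in> topspace X \<Longrightarrow> cstar_algebra (F x)"
  using fibres by (simp add: is_universal_algebra_def)

sublocale family: cstar_family "topspace X" F
  by (rule cstar_family.intro) (rule fam)

sublocale flds: cstar_algebra fields
  by (rule family.fields_cstar)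

lemma cstar_A: "Y \<in> K \<Longrightarrow> cstar_algebra (A Y)"
  using net by (simp add: cstar_net_def unital_cstar_algebra_def)

lemma subset_K: "Y \<in> K \<Longrightarrow> Y \<subseteq> topspace X"
  using open_K openin_subset by blast

lemma eps_morphism: "\<lbrakk>Y \<in> K; x \<in> Y\<rbrakk> \<Longrightarrow> star_morphism (A Y) (F x) (\<epsilon> x Y)"
  using fibres[of x] subset_K[of Y]
  by (auto simp: is_universal_algebra_def net_morphism_def fibre_index_def)

lemma j_closed:
  assumes "Y \<in> K" "Y' \<in> K" "Y \<subseteq> Y'" "t \<in> cs_carrier (A Y)"
  shows "j Y' Y t \<in> cs_carrier (A Y')"
proof -
  have "star_morphism (A Y) (A Y') (j Y' Y)"
    using net assms by (simp add: cstar_net_def unital_star_monomorphism_def)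
  then show ?thesis using assms(4) by (rule star_morphismD(1))
qed

lemma eps_compat:
  assumes "Y \<in> K" "Y' \<in> K" "Y \<subseteq> Y'" "x \<in> Y" "t \<in> cs_carrier (A Y)"
  shows "\<epsilon> x Y' (j Y' Y t) = \<epsilon> x Y t"
proof -
  have "Y \<in> fibre_index K x" "Y' \<in> fibre_index K x" using assms by (auto simp: fibre_index_def)
  moreover have "x \<in> topspace X" using assms subset_K by blast
  ultimately show ?thesis
    using fibres[of x] assms(3,5) unfolding is_universal_algebra_def net_morphism_def by blast
qed

lemma gen_apply:
  assumes "x \<in> topspace X"
  shows "gen f Y t x = (if x \<in> Y then f x \<odot>\<^bsub>F x\<^esub> \<epsilon> x Y t else \<zero>\<^bsub>F x\<^esub>)"
  using assms by (simp add: gen_def field_mult_def eps_hat_def cstar_algebra.scale_zero_right[OF fam])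

lemma C0_on_K: "\<lbrakk>Y \<in> K; f \<in> C0_on X Y\<rbrakk> \<Longrightarrow> f \<in> C0_functions X"
  using C0_on_imp_C0[OF Hausdorff_X open_K] .

lemma C0_on_zero: "\<lbrakk>f \<in> C0_on X Y; x \<notin> Y\<rbrakk> \<Longrightarrow> f x = 0"
  by (simp add: C0_functions_def)

lemma gen_closed:
  assumes Y: "Y \<in> K" and f: "f \<in> C0_functions X" and t: "t \<in> cs_carrier (A Y)"
  shows "gen f Y t \<in> cs_carrier fields"
proof -
  obtain M where M: "M \<ge> 0" "\<And>x. cmod (f x) \<le> M" using C0_bounded[OF Hausdorff_X f] by blast
  show ?thesis
  proof (rule family.fieldI[where c="M * cs_norm (A Y) t"])
    fix x assume x: "x \<in> topspace X"
    have eps: "\<epsilon> x Y t \<in> cs_carrier (F x)" "cs_norm (F x) (\<epsilon> x Y t) \<le> cs_norm (A Y) t" if "x \<in> Y"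
      using eps_morphism[OF Y that] star_morphismD(1)[OF _ t]
        star_morphism_contractive[OF cstar_A[OF Y] fam[OF x] _ t] by blast+
    then show "gen f Y t x \<in> cs_carrier (F x)"
      using x by (simp add: gen_apply family.fam_closed)
    have "0 \<le> cs_norm (A Y) t" using cstar_algebra.norm_nonneg[OF cstar_A[OF Y] t] .
    then show "cs_norm (F x) (gen f Y t x) \<le> M * cs_norm (A Y) t"
      using x eps M cstar_algebra.norm_nonneg[OF fam[OF x] eps(1)]
      by (auto simp: gen_apply cstar_algebra.norm_scale[OF fam] cstar_algebra.norm_zero[OF fam]
          intro!: mult_mono)
  qed (simp add: gen_def field_mult_def)
qed

lemma gens_fields: "gens \<subseteq> cs_carrier fields"
  using gen_closed C0_on_K by (auto simp: gens_def)

lemma alg_eq: "alg = fields\<lparr>cs_carrier := norm_closure fields (generated_star_subalgebra fields gens)\<rparr>"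
  unfolding net_C0_algebra_def gens_def gen_def Let_def by meson

lemma alg_ops [simp]:
  "\<zero>\<^bsub>alg\<^esub> = \<zero>\<^bsub>fields\<^esub>" "cs_add alg = cs_add fields" "cs_scale alg = cs_scale fields"
  "cs_mult alg = cs_mult fields" "cs_star alg = cs_star fields" "cs_norm alg = cs_norm fields"
  "cs_diff alg = cs_diff fields"
  by (simp_all add: alg_eq cs_diff_def[abs_def])

lemma alg_carrier: "cs_carrier alg = norm_closure fields (generated_star_subalgebra fields gens)"
  by (simp add: alg_eq)

lemma alg_subset: "a \<in> cs_carrier alg \<Longrightarrow> a \<in> cs_carrier fields"
  by (simp add: alg_carrier norm_closure_def)

lemma star_subalgebra_alg: "star_subalgebra fields (cs_carrier alg)"
  unfolding alg_carrier
  by (intro flds.star_subalgebra_closure flds.star_subalgebra_generated gens_fields)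

lemma closure_alg: "norm_closure fields (cs_carrier alg) \<subseteq> cs_carrier alg"
  unfolding alg_carrier using flds.star_subalgebra_generated(1)[OF gens_fields]
  by (intro flds.closure_closure) (simp add: star_subalgebra_def linear_subspace_def)

sublocale algebra: cstar_algebra alg
  using flds.subalgebra_cstar[OF star_subalgebra_alg closure_alg] by (simp add: alg_eq)

lemma gen_alg: "\<lbrakk>Y \<in> K; f \<in> C0_on X Y; t \<in> cs_carrier (A Y)\<rbrakk> \<Longrightarrow> gen f Y t \<in> cs_carrier alg"
proof -
  assume "Y \<in> K" "f \<in> C0_on X Y" "t \<in> cs_carrier (A Y)"
  then have "gen f Y t \<in> gens" by (auto simp: gens_def)
  moreover have "generated_star_subalgebra fields gens \<subseteq> cs_carrier alg"
    unfolding alg_carrier using flds.star_subalgebra_generated(1)[OF gens_fields]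
    by (intro flds.subset_closure) (simp add: star_subalgebra_def linear_subspace_def)
  ultimately show ?thesis using flds.star_subalgebra_generated(2)[OF gens_fields] by blast
qed

text \<open>The induction principle for the algebra of the net: stability under functions, existence
  of the morphism and its uniqueness are all reduced to generators by it.\<close>

lemma alg_induct:
  assumes S: "star_subalgebra fields S" and cl: "norm_closure fields S \<subseteq> S"
    and g: "\<And>Y f t. \<lbrakk>Y \<in> K; f \<in> C0_on X Y; t \<in> cs_carrier (A Y)\<rbrakk> \<Longrightarrow> gen f Y t \<in> S"
  shows "cs_carrier alg \<subseteq> S"
proof -
  have "gens \<subseteq> S" using g by (auto simp: gens_def)
  then have "generated_star_subalgebra fields gens \<subseteq> S"
    using S unfolding generated_star_subalgebra_def by blast
  then have "cs_carrier alg \<subseteq> norm_closure fields S"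
    unfolding alg_carrier by (fastforce simp: norm_closure_def)
  then show ?thesis using cl by blast
qed

lemma field_mult_closed:
  assumes f: "f \<in> C0_functions X" and a: "a \<in> cs_carrier fields"
  shows "field_mult X F f a \<in> cs_carrier fields"
proof -
  obtain M where M: "M \<ge> 0" "\<And>x. cmod (f x) \<le> M" using C0_bounded[OF Hausdorff_X f] by blast
  show ?thesis
    by (rule family.fieldI[where c="M * cs_norm fields a"])
      (auto simp: field_mult_def family.fam_closed family.field_closed[OF a] cstar_algebra.norm_scale[OF fam]
        intro!: mult_mono M family.field_norm_le a
          cstar_algebra.norm_nonneg[OF fam family.field_closed[OF a]])
qed

lemma field_mult_apply: "x \<in> topspace X \<Longrightarrow> field_mult X F f a x = f x \<odot>\<^bsub>F x\<^esub> a x"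
  by (simp add: field_mult_def)

lemma field_mult_ops:
  assumes f: "f \<in> C0_functions X" and a: "a \<in> cs_carrier fields"
  shows "b \<in> cs_carrier fields \<Longrightarrow>
      field_mult X F f (a \<oplus>\<^bsub>fields\<^esub> b) = field_mult X F f a \<oplus>\<^bsub>fields\<^esub> field_mult X F f b"
    and "field_mult X F f (c \<odot>\<^bsub>fields\<^esub> a) = c \<odot>\<^bsub>fields\<^esub> field_mult X F f a"
    and "b \<in> cs_carrier fields \<Longrightarrow>
      field_mult X F f (a \<otimes>\<^bsub>fields\<^esub> b) = field_mult X F f a \<otimes>\<^bsub>fields\<^esub> b"
    and "field_mult X F f (cs_star fields a) = cs_star fields (field_mult X F (\<lambda>x. cnj (f x)) a)"
  using f a
  by (auto simp: field_mult_def family.field_ops family.field_closed family.fam_closed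
      cstar_algebra.scale_add_right[OF fam] cstar_algebra.scale_scale[OF fam]
      cstar_algebra.mult_scale_left[OF fam] cstar_algebra.star_scale[OF fam] mult.commute
      intro!: restrict_ext)

lemma field_mult_gen:
  assumes Y: "Y \<in> K" and t: "t \<in> cs_carrier (A Y)"
  shows "field_mult X F f (gen g Y t) = gen (\<lambda>x. f x * g x) Y t"
proof
  fix x
  have "\<epsilon> x Y t \<in> cs_carrier (F x)" if "x \<in> Y"
    using star_morphismD(1)[OF eps_morphism[OF Y that] t] .
  then show "field_mult X F f (gen g Y t) x = gen (\<lambda>x. f x * g x) Y t x"
    by (cases "x \<in> topspace X")
      (auto simp: field_mult_apply gen_apply cstar_algebra.scale_scale[OF fam]
        cstar_algebra.scale_zero_right[OF fam], auto simp: field_mult_def gen_def)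
qed

lemma field_mult_alg:
  assumes f: "f \<in> C0_functions X" and a: "a \<in> cs_carrier alg"
  shows "field_mult X F f a \<in> cs_carrier alg"
proof -
  \<comment> \<open>All \<open>f\<close> are quantified at once because the step for adjoints passes
    from \<open>f\<close> to its conjugate.\<close>
  let ?S = "{a \<in> cs_carrier alg. \<forall>f\<in>C0_functions X. field_mult X F f a \<in> cs_carrier alg}"
  have "star_subalgebra fields ?S"
  proof -
    have "field_mult X F f \<zero>\<^bsub>fields\<^esub> = \<zero>\<^bsub>fields\<^esub>" for f
      by (auto simp: field_mult_def family.field_ops cstar_algebra.scale_zero_right[OF fam] intro!: restrict_ext)
    then show ?thesis
      using algebra.closed
      by (auto simp: star_subalgebra_def linear_subspace_def alg_subset field_mult_ops C0_cnj)
  qed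
  moreover have "norm_closure fields ?S \<subseteq> ?S"
  proof
    fix a assume a: "a \<in> norm_closure fields ?S"
    have "norm_closure fields ?S \<subseteq> norm_closure fields (cs_carrier alg)"
      by (fastforce simp: norm_closure_def)
    then have aA: "a \<in> cs_carrier alg" using a closure_alg by blast
    have "field_mult X F f a \<in> cs_carrier alg" if f: "f \<in> C0_functions X" for f
    proof -
      obtain M where M: "M \<ge> 0" "\<And>x. cmod (f x) \<le> M" using C0_bounded[OF Hausdorff_X f] by blast
      let ?T = "{a \<in> cs_carrier fields. field_mult X F f a \<in> cs_carrier alg}"
      have "norm_closure fields ?T \<subseteq> ?T"
      proof (rule norm_closure_lipschitz_preimage[OF _ _ M(1) closure_alg])
        fix x y assume xy: "x \<in> cs_carrier fields" "y \<in> cs_carrier fields"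
        have "field_mult X F f x \<ominus>\<^bsub>fields\<^esub> field_mult X F f y = field_mult X F f (x \<ominus>\<^bsub>fields\<^esub> y)"
          using f xy by (simp add: cs_diff_def field_mult_ops flds.closed)
        moreover have "cs_norm fields (field_mult X F f (x \<ominus>\<^bsub>fields\<^esub> y)) \<le> M * cs_norm fields (x \<ominus>\<^bsub>fields\<^esub> y)"
        proof (rule family.field_norm_least)
          have d: "x \<ominus>\<^bsub>fields\<^esub> y \<in> cs_carrier fields" using xy by (rule flds.diff_closed)
          then show "0 \<le> M * cs_norm fields (x \<ominus>\<^bsub>fields\<^esub> y)" using M flds.norm_nonneg by simp
          show "cs_norm (F z) (field_mult X F f (x \<ominus>\<^bsub>fields\<^esub> y) z) \<le> M * cs_norm fields (x \<ominus>\<^bsub>fields\<^esub> y)"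
            if z: "z \<in> topspace X" for z
            using family.field_closed[OF d z] z
            by (auto simp: field_mult_apply cstar_algebra.norm_scale[OF fam]
                intro!: mult_mono M family.field_norm_le d cstar_algebra.norm_nonneg[OF fam])
        qed
        ultimately show "cs_norm fields (field_mult X F f x \<ominus>\<^bsub>fields\<^esub> field_mult X F f y)
            \<le> M * cs_norm fields (x \<ominus>\<^bsub>fields\<^esub> y)" by simp
      qed (use f field_mult_closed in auto)
      moreover have "norm_closure fields ?S \<subseteq> norm_closure fields ?T"
        using f alg_subset by (fastforce simp: norm_closure_def)
      ultimately show ?thesis using a by blast
    qed
    then show "a \<in> ?S" using aA by simp
  qed
  moreover have "gen g Y t \<in> ?S" if g: "Y \<in> K" "g \<in> C0_on X Y" "t \<in> cs_carrier (A Y)" for Y g t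
  proof -
    have "(\<lambda>x. f x * g x) \<in> C0_on X Y" if f: "f \<in> C0_functions X" for f
      by (rule C0_onI[OF C0_mult[OF Hausdorff_X f C0_on_K[OF g(1,2)]] subset_K[OF g(1)]])
        (simp add: C0_on_zero[OF g(2)])
    then show ?thesis using g by (simp add: gen_alg field_mult_gen)
  qed
  ultimately have "cs_carrier alg \<subseteq> ?S" by (rule alg_induct)
  then show ?thesis using f a by blast
qed

lemma struct_act: "a \<in> cs_carrier alg \<Longrightarrow> C0_act struct f a = field_mult X F f a"
  by (simp add: net_C0_structure_def)

text \<open>Proved directly from the generators, since \<open>C0_module\<close> is instantiated for
  \<open>B\<close> only and not for the algebra of the net.\<close>

lemma closed_ideal_restriction_alg: "closed_ideal alg (restriction_ideal X alg struct Y)"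
proof -
  have "f \<in> C0_functions X" if "f \<in> C0_on X (topspace X - X closure_of Y)" for f
    using C0_on_imp_C0[OF Hausdorff_X _ that] by (simp add: openin_diff)
  then have "{C0_act struct f v | f v. f \<in> C0_on X (topspace X - X closure_of Y) \<and> v \<in> cs_carrier alg}
      \<subseteq> cs_carrier alg"
    using field_mult_alg by (auto simp: struct_act)
  then show ?thesis
    unfolding restriction_ideal_def C0_ideal_def by (rule algebra.closed_ideal_generated)
qed

end


section \<open>The universal property\<close>

locale net_heteromorphism = net_fields X K A j F \<epsilon> + C0_module B X \<theta>
  for X :: "'x topology" and K :: "'x set set" and A :: "'x set \<Rightarrow> 'a cstar"
    and j :: "'x set \<Rightarrow> 'x set \<Rightarrow> 'a \<Rightarrow> 'a" and F :: "'x \<Rightarrow> 'u cstar"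
    and \<epsilon> :: "'x \<Rightarrow> 'x set \<Rightarrow> 'a \<Rightarrow> 'u" and B :: "'b cstar" and \<theta> :: "('x, 'b) C0_structure" +
  fixes \<phi> :: "'x set \<Rightarrow> 'a \<Rightarrow> 'b set"
  assumes phi: "heteromorphism X K A j B \<theta> \<phi>"
begin

section \<open>From the heteromorphism to maps between fibres\<close>

interpretation fib: star_ideal B "fibre_ideal z" for z
  by (rule star_ideal_fibre)

interpretation res: star_ideal B "restriction_ideal X B \<theta> Y" for Y
  by (rule star_ideal_restriction)

abbreviation r where "r \<equiv> r_map X B \<theta>"

lemma phi_morphism: "Y \<in> K \<Longrightarrow> star_morphism (A Y) (S_algebra X B \<theta> Y) (\<phi> Y)"
  using phi by (simp add: heteromorphism_def)

lemma phi_lift: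
  assumes "Y \<in> K" "t \<in> cs_carrier (A Y)"
  obtains b where "b \<in> cs_carrier B" "\<phi> Y t = r Y b"
  using star_morphismD(1)[OF phi_morphism[OF assms(1)] assms(2)]
  by (auto simp: S_algebra_def res.quotient_carrier r_map_def)

lemma r_restrict_r:
  assumes "Y \<subseteq> Y'" "b \<in> cs_carrier B"
  shows "r_restrict X B \<theta> Y Y' (r Y' b) = r Y b"
  unfolding r_restrict_def r_map_def
  by (intro induced_coset cstar_algebra_axioms res.ideal assms(2))
    (use restriction_ideal_antimono[OF assms(1)] in \<open>auto simp: star_morphism_def\<close>)

text \<open>Compatibility in terms of lifts: adding the larger ideal turns the class of
  \<open>b\<close> over \<open>Y'\<close> into its class over \<open>Y\<close>, so one lift serves
  both sets.\<close>

lemma phi_compat: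
  assumes "Y \<in> K" "Y' \<in> K" "Y \<subseteq> Y'" "t \<in> cs_carrier (A Y)" "b \<in> cs_carrier B"
    and "\<phi> Y' (j Y' Y t) = r Y' b"
  shows "\<phi> Y t = r Y b"
proof -
  have "r_restrict X B \<theta> Y Y' (\<phi> Y' (j Y' Y t)) = \<phi> Y t"
    using phi assms unfolding heteromorphism_def by blast
  then show ?thesis using assms by (simp add: r_restrict_r)
qed

text \<open>The map from \<open>S_algebra X B \<theta> Y\<close> to the fibre at a point
  \<open>x\<close> of \<open>Y\<close>. It enlarges a coset by the fibre ideal, and since
  \<open>Y\<close> does not occur in this formula one map serves all \<open>Y\<close> around
  \<open>x\<close>.\<close>

definition germ :: "'x \<Rightarrow> 'b set \<Rightarrow> 'b set" where
  "germ x = induced_map B (fibre_ideal (Some x)) (\<lambda>b. b)"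

lemma germ_r:
  assumes "Y \<in> K" "x \<in> Y" "b \<in> cs_carrier B"
  shows "germ x (r Y b) = ev (Some x) b"
proof -
  have "x \<in> X closure_of Y" using closure_of_subset[OF subset_K[OF assms(1)]] assms(2) by blast
  then show ?thesis
    unfolding germ_def r_map_def
    by (intro induced_coset cstar_algebra_axioms res.ideal fib.ideal assms(3))
      (use restriction_ideal_fibre in \<open>auto simp: star_morphism_def\<close>)
qed

lemma fibre_factorization:
  assumes x: "x \<in> topspace X"
  obtains \<psi> where "star_morphism (F x) (fibre (Some x)) \<psi>"
    "\<And>Y t. \<lbrakk>Y \<in> K; x \<in> Y; t \<in> cs_carrier (A Y)\<rbrakk> \<Longrightarrow> germ x (\<phi> Y t) = \<psi> (\<epsilon> x Y t)"
proof -
  let ?K = "fibre_index K x"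
  have "star_morphism (A Y) (fibre (Some x)) (\<lambda>t. germ x (\<phi> Y t))" if Y: "Y \<in> ?K" for Y
  proof -
    have Y': "Y \<in> K" "x \<in> Y" using Y by (auto simp: fibre_index_def)
    then have "x \<in> X closure_of Y" using closure_of_subset[OF subset_K] by blast
    then have "star_morphism (S_algebra X B \<theta> Y) (fibre (Some x)) (germ x)"
      unfolding S_algebra_def germ_def
      by (intro star_morphism_induced star_ideal_fibre star_ideal_restriction)
        (use restriction_ideal_fibre in \<open>auto simp: star_morphism_def\<close>)
    then show ?thesis by (rule star_morphism_comp[OF phi_morphism[OF Y'(1)]])
  qed
  moreover have "germ x (\<phi> Y' (j Y' Y t)) = germ x (\<phi> Y t)"
    if Y: "Y \<in> ?K" "Y' \<in> ?K" "Y \<subseteq> Y'" and t: "t \<in> cs_carrier (A Y)" for Y Y' t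
  proof -
    have K: "Y \<in> K" "Y' \<in> K" "x \<in> Y" "x \<in> Y'" using Y by (auto simp: fibre_index_def)
    obtain b where b: "b \<in> cs_carrier B" "\<phi> Y' (j Y' Y t) = r Y' b"
      using phi_lift[OF K(2) j_closed[OF K(1,2) Y(3) t]] by blast
    then show ?thesis using phi_compat[OF K(1,2) Y(3) t b] K by (simp add: germ_r)
  qed
  ultimately have m: "net_morphism ?K A j (fibre (Some x)) (\<lambda>Y t. germ x (\<phi> Y t))"
    by (simp add: net_morphism_def)
  have "cstar_net ?K A j" using net by (auto simp: cstar_net_def fibre_index_def)
  then obtain \<psi> where "star_morphism (F x) (fibre (Some x)) \<psi>"
    "\<forall>Y\<in>?K. \<forall>t\<in>cs_carrier (A Y). germ x (\<phi> Y t) = \<psi> (\<epsilon> x Y t)"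
    \<comment> \<open>The fibre is carried by the type \<open>'b set\<close>, which the test
      algebras in \<open>is_universal_algebra\<close> do not cover directly; the factorization for
      arbitrary targets needs it to be a C*-algebra.\<close>
    using universal_factorization[OF fibres[OF x] _ fibre_cstar m] by blast
  then show ?thesis using that by (auto simp: fibre_index_def)
qed

definition fibre_map :: "'x \<Rightarrow> 'u \<Rightarrow> 'b set" where
  "fibre_map x = (SOME \<psi>. star_morphism (F x) (fibre (Some x)) \<psi> \<and>
     (\<forall>Y\<in>K. x \<in> Y \<longrightarrow> (\<forall>t\<in>cs_carrier (A Y). germ x (\<phi> Y t) = \<psi> (\<epsilon> x Y t))))"

lemma fibre_map:
  assumes x: "x \<in> topspace X"
  shows "star_morphism (F x) (fibre (Some x)) (fibre_map x)"
    and "\<lbrakk>Y \<in> K; x \<in> Y; t \<in> cs_carrier (A Y)\<rbrakk> \<Longrightarrow> fibre_map x (\<epsilon> x Y t) = germ x (\<phi> Y t)"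
proof -
  have "\<exists>\<psi>. star_morphism (F x) (fibre (Some x)) \<psi> \<and>
     (\<forall>Y\<in>K. x \<in> Y \<longrightarrow> (\<forall>t\<in>cs_carrier (A Y). germ x (\<phi> Y t) = \<psi> (\<epsilon> x Y t)))"
    using fibre_factorization[OF x] by metis
  from someI_ex[OF this, folded fibre_map_def]
  show "star_morphism (F x) (fibre (Some x)) (fibre_map x)"
    "\<lbrakk>Y \<in> K; x \<in> Y; t \<in> cs_carrier (A Y)\<rbrakk> \<Longrightarrow> fibre_map x (\<epsilon> x Y t) = germ x (\<phi> Y t)" by auto
qed

section \<open>Fields of values of elements of \<open>B\<close>\<close>

definition represents :: "'b \<Rightarrow> ('x \<Rightarrow> 'u) \<Rightarrow> bool" where
  "represents b a \<longleftrightarrow> b \<in> cs_carrier B \<and>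
     (\<forall>x\<in>topspace X. ev (Some x) b = fibre_map x (a x))"

lemma representsD:
  assumes "represents b a"
  shows "b \<in> cs_carrier B" "x \<in> topspace X \<Longrightarrow> ev (Some x) b = fibre_map x (a x)"
  using assms by (auto simp: represents_def)

text \<open>The fibre maps are contractive and the fibre norms control the norm of \<open>b\<close>.
  Applied to differences, the estimate yields both \<open>represents_unique\<close> and the Cauchy
  condition in \<open>represents_exists\<close>.\<close>

lemma represents_norm:
  assumes a: "a \<in> cs_carrier fields" and ba: "represents b a"
  shows "cs_norm B b \<le> cs_norm fields a"
proof (rule norm_le_of_fibres[OF representsD(1)[OF ba] flds.norm_nonneg[OF a]])
  fix x assume x: "x \<in> topspace X"
  have "cs_norm (fibre (Some x)) (fibre_map x (a x)) \<le> cs_norm (F x) (a x)"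
    using star_morphism_contractive[OF fam[OF x] fibre_cstar fibre_map(1)[OF x] family.field_closed[OF a x]] .
  then show "cs_norm (fibre (Some x)) (ev (Some x) b) \<le> cs_norm fields a"
    using family.field_norm_le[OF a x] representsD(2)[OF ba x] by simp
qed

lemma represents_ops:
  assumes a: "a \<in> cs_carrier fields" and ba: "represents b a"
  shows "\<lbrakk>a' \<in> cs_carrier fields; represents b' a'\<rbrakk> \<Longrightarrow> represents (b \<oplus>\<^bsub>B\<^esub> b') (a \<oplus>\<^bsub>fields\<^esub> a')"
    and "represents (c \<odot>\<^bsub>B\<^esub> b) (c \<odot>\<^bsub>fields\<^esub> a)"
    and "\<lbrakk>a' \<in> cs_carrier fields; represents b' a'\<rbrakk> \<Longrightarrow> represents (b \<otimes>\<^bsub>B\<^esub> b') (a \<otimes>\<^bsub>fields\<^esub> a')"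
    and "represents (cs_star B b) (cs_star fields a)"
    and "f \<in> C0_functions X \<Longrightarrow> represents (C0_act \<theta> f b) (field_mult X F f a)"
proof -
  note m = star_morphismD[OF fibre_map(1)] and e = star_morphismD[OF star_morphism_ev]
  note [simp] = representsD[OF ba] family.field_closed[OF a]
  show "represents (c \<odot>\<^bsub>B\<^esub> b) (c \<odot>\<^bsub>fields\<^esub> a)"
    by (simp add: represents_def closed family.field_ops m e)
  show "represents (cs_star B b) (cs_star fields a)"
    by (simp add: represents_def closed family.field_ops m e)
  show "represents (C0_act \<theta> f b) (field_mult X F f a)" if f: "f \<in> C0_functions X"
    using ev_act[OF extend_C0_C1[OF Hausdorff_X f]] f
    by (simp add: represents_def C0_act_linear field_mult_apply m act_extend)
  assume a': "a' \<in> cs_carrier fields" and ba': "represents b' a'"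
  note [simp] = representsD[OF ba'] family.field_closed[OF a']
  show "represents (b \<oplus>\<^bsub>B\<^esub> b') (a \<oplus>\<^bsub>fields\<^esub> a')"
    by (simp add: represents_def closed family.field_ops m e)
  show "represents (b \<otimes>\<^bsub>B\<^esub> b') (a \<otimes>\<^bsub>fields\<^esub> a')"
    by (simp add: represents_def closed family.field_ops m e)
qed

lemma represents_diff:
  "\<lbrakk>a \<in> cs_carrier fields; represents b a; a' \<in> cs_carrier fields; represents b' a'\<rbrakk>
    \<Longrightarrow> represents (b \<ominus>\<^bsub>B\<^esub> b') (a \<ominus>\<^bsub>fields\<^esub> a')"
  unfolding cs_diff_def by (intro represents_ops flds.closed)

lemma represents_unique:
  assumes a: "a \<in> cs_carrier fields" and b: "represents b a" and b': "represents b' a"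
  shows "b = b'"
proof -
  have "cs_norm B (b \<ominus>\<^bsub>B\<^esub> b') \<le> cs_norm fields (a \<ominus>\<^bsub>fields\<^esub> a)"
    using a b b' by (intro represents_norm represents_diff flds.closed)
  then have "cs_norm B (b \<ominus>\<^bsub>B\<^esub> b') = 0"
    using a representsD(1)[OF b] representsD(1)[OF b']
      norm_nonneg[of "b \<ominus>\<^bsub>B\<^esub> b'"] by (simp add: flds.diff_self flds.norm_zero closed)
  then show ?thesis
    using representsD(1)[OF b] representsD(1)[OF b'] norm_eq_zero[of "b \<ominus>\<^bsub>B\<^esub> b'"] diff_eq_zero
    by (simp add: closed)
qed

text \<open>On \<open>Y\<close> both sides have the value \<open>f x\<close> times the germ of
  \<open>\<phi> Y t\<close>, and off \<open>Y\<close> the function vanishes. The lift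
  \<open>b\<close> is not unique, but by \<open>represents_unique\<close> the element
  \<open>f b\<close> does not depend on it.\<close>

lemma represents_gen:
  assumes Y: "Y \<in> K" and f: "f \<in> C0_on X Y" and t: "t \<in> cs_carrier (A Y)"
    and b: "b \<in> cs_carrier B" "\<phi> Y t = r Y b"
  shows "represents (C0_act \<theta> f b) (gen f Y t)"
  unfolding represents_def
proof (intro conjI ballI)
  note fC = C0_on_K[OF Y f]
  show "C0_act \<theta> f b \<in> cs_carrier B" using fC b by (simp add: C0_act_linear)
  fix x assume x: "x \<in> topspace X"
  have ev: "ev (Some x) (C0_act \<theta> f b) = f x \<odot>\<^bsub>fibre (Some x)\<^esub> ev (Some x) b"
    using ev_act[OF extend_C0_C1[OF Hausdorff_X fC] b(1), of "Some x"] fC b by (simp add: act_extend)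
  show "ev (Some x) (C0_act \<theta> f b) = fibre_map x (gen f Y t x)"
  proof (cases "x \<in> Y")
    case True
    have eps: "\<epsilon> x Y t \<in> cs_carrier (F x)" using star_morphismD(1)[OF eps_morphism[OF Y True] t] .
    have "fibre_map x (\<epsilon> x Y t) = ev (Some x) b"
      using fibre_map(2)[OF x Y True t] b germ_r[OF Y True] by simp
    then show ?thesis
      using True x ev star_morphismD(3)[OF fibre_map(1)[OF x] eps] by (simp add: gen_apply)
  next
    case False
    then have "f x = 0" by (rule C0_on_zero[OF f])
    moreover have "ev (Some x) b \<in> cs_carrier (fibre (Some x))"
      using b by (simp add: fib.quotient_carrier)
    ultimately show ?thesis
      using False x ev star_morphism_zero[OF fam[OF x] fibre_cstar fibre_map(1)[OF x]]
      by (simp add: gen_apply cstar_algebra.scale_zero_left[OF fibre_cstar])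
  qed
qed

lemma represents_exists:
  assumes "a \<in> cs_carrier alg"
  obtains b where "represents b a"
proof -
  let ?S = "{a \<in> cs_carrier fields. \<exists>b. represents b a}"
  have zero: "represents \<zero>\<^bsub>B\<^esub> \<zero>\<^bsub>fields\<^esub>"
    using star_morphism_zero[OF fam fibre_cstar fibre_map(1)]
      star_morphism_zero[OF cstar_algebra_axioms fibre_cstar star_morphism_ev]
    by (simp add: represents_def closed family.field_ops)
  have "a \<oplus>\<^bsub>fields\<^esub> a' \<in> ?S" "a \<otimes>\<^bsub>fields\<^esub> a' \<in> ?S" "c \<odot>\<^bsub>fields\<^esub> a \<in> ?S"
    "cs_star fields a \<in> ?S" if a: "a \<in> ?S" and a': "a' \<in> ?S" for a a' c
  proof -
    obtain b b' where "a \<in> cs_carrier fields" "represents b a"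
      "a' \<in> cs_carrier fields" "represents b' a'" using a a' by blast
    note ops = represents_ops[OF this(1,2)] represents_ops(1,3)[OF this]
    show "a \<oplus>\<^bsub>fields\<^esub> a' \<in> ?S" "a \<otimes>\<^bsub>fields\<^esub> a' \<in> ?S" "c \<odot>\<^bsub>fields\<^esub> a \<in> ?S"
      "cs_star fields a \<in> ?S"
      using a a' ops by (auto simp: flds.closed)
  qed
  then have "star_subalgebra fields ?S"
    using zero by (auto simp: star_subalgebra_def linear_subspace_def flds.zero_closed)
  moreover have "norm_closure fields ?S \<subseteq> ?S"
  proof
    fix a assume a: "a \<in> norm_closure fields ?S"
    have aC: "a \<in> cs_carrier fields" using a by (simp add: norm_closure_def)
    obtain s where s: "\<And>n::nat. s n \<in> ?S" "cs_tendsto fields s a"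
      using flds.closure_memD[OF a] by blast
    then obtain b where b: "\<And>n. represents (b n) (s n)" by simp metis
    have sC: "s n \<in> cs_carrier fields" for n using s(1) by simp
    have bC: "b n \<in> cs_carrier B" for n using representsD(1)[OF b] .
    \<comment> \<open>Representation respects differences, so the distance of \<open>b m\<close> and
      \<open>b n\<close> is at most that of the fields \<open>s m\<close> and \<open>s n\<close>,
      and completeness of \<open>B\<close> supplies the limit.\<close>
    have "\<exists>N. \<forall>m\<ge>N. \<forall>n\<ge>N. cs_norm B (b m \<ominus>\<^bsub>B\<^esub> b n) < e" if e: "e > 0" for e
    proof -
      have "\<forall>\<^sub>F n in sequentially. cs_norm fields (s n \<ominus>\<^bsub>fields\<^esub> a) < e/2"
        using order_tendstoD(2)[OF s(2), of "e/2"] e by simp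
      then obtain N where N: "\<And>n. n \<ge> N \<Longrightarrow> cs_norm fields (s n \<ominus>\<^bsub>fields\<^esub> a) < e/2"
        by (auto simp: eventually_sequentially)
      have "cs_norm B (b m \<ominus>\<^bsub>B\<^esub> b n) < e" if "m \<ge> N" "n \<ge> N" for m n
      proof -
        have "cs_norm B (b m \<ominus>\<^bsub>B\<^esub> b n) \<le> cs_norm fields (s m \<ominus>\<^bsub>fields\<^esub> s n)"
          by (intro represents_norm represents_diff flds.closed sC b)
        also have "\<dots> \<le> cs_norm fields (s m \<ominus>\<^bsub>fields\<^esub> a) + cs_norm fields (s n \<ominus>\<^bsub>fields\<^esub> a)"
          using flds.norm_diff_triangle[OF sC aC sC, of m n] flds.norm_diff_commute[OF aC sC, of n] by simp
        also have "\<dots> < e" using N[OF that(1)] N[OF that(2)] by simp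
        finally show ?thesis .
      qed
      then show ?thesis by blast
    qed
    then have "\<exists>l\<in>cs_carrier B. cs_tendsto B b l" by (rule complete[OF bC])
    then obtain l where l: "l \<in> cs_carrier B" "cs_tendsto B b l" by blast
    \<comment> \<open>Evaluation and the fibre map are both contractive, so
      \<open>ev (Some x) (b n)\<close>, which is also \<open>fibre_map x (s n x)\<close>, converges
      to both sides.\<close>
    have "ev (Some x) l = fibre_map x (a x)" if x: "x \<in> topspace X" for x
    proof (rule cstar_algebra.limit_unique[OF fibre_cstar])
      interpret Fx: cstar_algebra "F x" by (rule fam[OF x])
      note evm = star_morphism_ev[of "Some x"] and mx = fibre_map(1)[OF x]
      have aF: "a x \<in> cs_carrier (F x)" "s n x \<in> cs_carrier (F x)" for n
        using family.field_closed[OF aC x] family.field_closed[OF sC x] by auto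
      show "ev (Some x) (b n) \<in> cs_carrier (fibre (Some x))" for n
        using star_morphismD(1)[OF evm bC] .
      show "ev (Some x) l \<in> cs_carrier (fibre (Some x))" using star_morphismD(1)[OF evm l(1)] .
      show "fibre_map x (a x) \<in> cs_carrier (fibre (Some x))" using star_morphismD(1)[OF mx aF(1)] .
      show "cs_tendsto (fibre (Some x)) (\<lambda>n. ev (Some x) (b n)) (ev (Some x) l)"
      proof (rule tendsto_lipschitz_seq[OF bC l fibre_cstar, where c=1])
        show "cs_norm (fibre (Some x)) (ev (Some x) y \<ominus>\<^bsub>fibre (Some x)\<^esub> ev (Some x) l)
            \<le> 1 * cs_norm B (y \<ominus>\<^bsub>B\<^esub> l)" if "y \<in> cs_carrier B" for y
          using star_morphism_contractive[OF cstar_algebra_axioms fibre_cstar evm diff_closed[OF that l(1)]]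
          by (simp add: star_morphism_diff[OF cstar_algebra_axioms evm that l(1)])
      qed (use star_morphismD(1)[OF evm] in auto)
      have "cs_tendsto (F x) (\<lambda>n. s n x) (a x)"
      proof (rule Fx.tendsto_bound[OF aF(2) aF(1) _ s(2)])
        show "cs_norm (F x) (s n x \<ominus>\<^bsub>F x\<^esub> a x) \<le> cs_norm fields (s n \<ominus>\<^bsub>fields\<^esub> a)" for n
          using family.field_norm_le[OF flds.diff_closed[OF sC aC] x, of n] x
          by (simp add: family.field_diff)
      qed
      then have "cs_tendsto (fibre (Some x)) (\<lambda>n. fibre_map x (s n x)) (fibre_map x (a x))"
      proof (rule Fx.tendsto_lipschitz_seq[OF aF(2) aF(1) _ fibre_cstar, where c=1])
        show "cs_norm (fibre (Some x)) (fibre_map x y \<ominus>\<^bsub>fibre (Some x)\<^esub> fibre_map x (a x))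
            \<le> 1 * cs_norm (F x) (y \<ominus>\<^bsub>F x\<^esub> a x)" if "y \<in> cs_carrier (F x)" for y
          using star_morphism_contractive[OF fam[OF x] fibre_cstar mx Fx.diff_closed[OF that aF(1)]]
          by (simp add: star_morphism_diff[OF fam[OF x] mx that aF(1)])
      qed (use star_morphismD(1)[OF mx] in auto)
      then show "cs_tendsto (fibre (Some x)) (\<lambda>n. ev (Some x) (b n)) (fibre_map x (a x))"
        by (simp add: representsD(2)[OF b x])
    qed
    then have "represents l a" using l by (simp add: represents_def)
    then show "a \<in> ?S" using aC by blast
  qed
  moreover have "gen f Y t \<in> ?S" if g: "Y \<in> K" "f \<in> C0_on X Y" "t \<in> cs_carrier (A Y)" for Y f t
  proof -
    obtain b where "b \<in> cs_carrier B" "\<phi> Y t = r Y b" using phi_lift[OF g(1,3)] .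
    then show ?thesis using represents_gen[OF g] gen_closed[OF g(1) C0_on_K[OF g(1,2)] g(3)] by blast
  qed
  ultimately have "cs_carrier alg \<subseteq> ?S" by (rule alg_induct)
  then show ?thesis using assms that by blast
qed

text \<open>Compatibility with functions makes \<open>\<eta>\<close> send generators of one
  restriction ideal to generators of the other. The preimage of a closed ideal being a closed ideal,
  the whole ideal follows, so the induced map is computed on representatives.\<close>

lemma S_morphism_r:
  assumes \<eta>: "C0_morphism X alg struct B \<theta> \<eta>" and a: "a \<in> cs_carrier alg"
  shows "S_morphism X B \<theta> \<eta> Y (r_map X alg struct Y a) = r Y (\<eta> a)"
proof -
  have m: "star_morphism alg B \<eta>" using \<eta> by (simp add: C0_morphism_def)
  have "restriction_ideal X alg struct Y \<subseteq> {a \<in> cs_carrier alg. \<eta> a \<in> restriction_ideal X B \<theta> Y}"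
    unfolding restriction_ideal_def[of X alg] C0_ideal_def[of X alg]
  proof (rule algebra.generated_closed_ideal_least)
    show "closed_ideal alg {a \<in> cs_carrier alg. \<eta> a \<in> restriction_ideal X B \<theta> Y}"
      by (rule closed_ideal_morphism_preimage[OF algebra.cstar_algebra_axioms cstar_algebra_axioms m res.ideal])
    show "{C0_act struct f v | f v. f \<in> C0_on X (topspace X - X closure_of Y) \<and> v \<in> cs_carrier alg}
        \<subseteq> {a \<in> cs_carrier alg. \<eta> a \<in> restriction_ideal X B \<theta> Y}"
    proof clarify
      fix f v assume f: "f \<in> C0_on X (topspace X - X closure_of Y)" and v: "v \<in> cs_carrier alg"
      note fC = restriction_generator(1)[OF f]
      have "C0_act struct f v \<in> cs_carrier alg" using field_mult_alg[OF fC v] v by (simp add: struct_act)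
      moreover have "\<eta> (C0_act struct f v) = C0_act \<theta> f (\<eta> v)" using \<eta> fC v by (simp add: C0_morphism_def)
      moreover have "C0_act \<theta> f (\<eta> v) \<in> restriction_ideal X B \<theta> Y"
        using star_morphismD(1)[OF m v] by (rule restriction_idealI[OF f])
      ultimately show "C0_act struct f v \<in> cs_carrier alg \<and> \<eta> (C0_act struct f v) \<in> restriction_ideal X B \<theta> Y"
        by simp
    qed
  qed
  then have "\<eta> ` restriction_ideal X alg struct Y \<subseteq> restriction_ideal X B \<theta> Y" by blast
  then show ?thesis
    unfolding S_morphism_def r_map_def
    by (intro induced_coset algebra.cstar_algebra_axioms cstar_algebra_axioms
        closed_ideal_restriction_alg res.ideal m a)
qed

section \<open>The induced morphism and its uniqueness\<close>

definition factor :: "('x \<Rightarrow> 'u) \<Rightarrow> 'b" where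
  "factor = (\<lambda>a\<in>cs_carrier alg. THE b. represents b a)"

lemma factorI:
  assumes "a \<in> cs_carrier alg" "represents b a"
  shows "factor a = b"
proof -
  have "(THE b. represents b a) = b"
    using assms represents_unique[OF alg_subset[OF assms(1)]] by blast
  then show ?thesis using assms by (simp add: factor_def)
qed

lemma represents_factor: "a \<in> cs_carrier alg \<Longrightarrow> represents (factor a) a"
  using represents_exists factorI by metis

lemma C0_morphism_factor: "C0_morphism X alg struct B \<theta> factor"
  unfolding C0_morphism_def star_morphism_def
proof (intro conjI ballI allI)
  show "factor \<in> cs_carrier alg \<rightarrow> cs_carrier B"
    using representsD(1)[OF represents_factor] by blast
  fix a assume a: "a \<in> cs_carrier alg"
  note ra = alg_subset[OF a] represents_factor[OF a]
  show "factor (c \<odot>\<^bsub>alg\<^esub> a) = c \<odot>\<^bsub>B\<^esub> factor a" for c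
    using represents_ops(2)[OF ra] algebra.scale_closed[OF a] by (intro factorI) simp_all
  show "factor (cs_star alg a) = cs_star B (factor a)"
    using represents_ops(4)[OF ra] algebra.star_closed[OF a] by (intro factorI) simp_all
  show "factor (C0_act struct f a) = C0_act \<theta> f (factor a)" if f: "f \<in> C0_functions X" for f
    using represents_ops(5)[OF ra f] field_mult_alg[OF f a] a by (intro factorI) (simp_all add: struct_act)
  fix a' assume a': "a' \<in> cs_carrier alg"
  note ra' = alg_subset[OF a'] represents_factor[OF a']
  show "factor (a \<oplus>\<^bsub>alg\<^esub> a') = factor a \<oplus>\<^bsub>B\<^esub> factor a'"
    using represents_ops(1)[OF ra ra'] algebra.add_closed[OF a a'] by (intro factorI) simp_all
  show "factor (a \<otimes>\<^bsub>alg\<^esub> a') = factor a \<otimes>\<^bsub>B\<^esub> factor a'"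
    using represents_ops(3)[OF ra ra'] algebra.mult_closed[OF a a'] by (intro factorI) simp_all
qed

text \<open>The lift is taken over the larger set \<open>U\<close>, where the generator lives. Since
  \<open>g = 1\<close> on \<open>Y\<close>, the element \<open>g b\<close> agrees with
  \<open>b\<close> modulo the restriction ideal of \<open>Y\<close>, and \<open>b\<close> lifts
  \<open>\<phi> Y t\<close> as well.\<close>

lemma factor_gen:
  assumes Y: "Y \<in> K" and U: "U \<in> K" "Y \<subseteq> U" and g: "g \<in> C0_on X U" "\<And>x. x \<in> Y \<Longrightarrow> g x = 1"
    and t: "t \<in> cs_carrier (A Y)"
  shows "r Y (factor (gen g U (j U Y t))) = \<phi> Y t"
proof -
  note jt = j_closed[OF Y U t]
  obtain b where b: "b \<in> cs_carrier B" "\<phi> U (j U Y t) = r U b" using phi_lift[OF U(1) jt] .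
  have "factor (gen g U (j U Y t)) = C0_act \<theta> g b"
    by (rule factorI[OF gen_alg[OF U(1) g(1) jt] represents_gen[OF U(1) g(1) jt b]])
  moreover have "r Y (C0_act \<theta> g b) = r Y b"
    unfolding r_map_def
    using C0_act_diff_restriction_ideal[OF subset_K[OF Y] C0_on_K[OF U(1) g(1)] g(2) b(1)] b(1)
      C0_act_linear(1)[OF C0_on_K[OF U(1) g(1)] b(1)] by (simp add: res.coset_eq_iff)
  ultimately show ?thesis using phi_compat[OF Y U t b] by simp
qed

text \<open>Links the generators to the elements that define \<open>\<tau>\<close>: multiplication
  by \<open>f\<close> removes everything outside \<open>Y\<close>, and on \<open>Y\<close> the
  function \<open>g\<close> is 1 while the canonical morphisms identify \<open>t\<close> with
  \<open>j U Y t\<close>.\<close>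

lemma gen_localize:
  assumes Y: "Y \<in> K" and U: "U \<in> K" "Y \<subseteq> U" and g: "\<And>x. x \<in> Y \<Longrightarrow> g x = 1"
    and f: "f \<in> C0_on X Y" and t: "t \<in> cs_carrier (A Y)"
  shows "gen f Y t = field_mult X F f (gen g U (j U Y t))"
proof
  fix x
  have eps: "\<epsilon> x U (j U Y t) \<in> cs_carrier (F x)" if "x \<in> U"
    using star_morphismD(1)[OF eps_morphism[OF U(1) that] j_closed[OF Y U t]] .
  show "gen f Y t x = field_mult X F f (gen g U (j U Y t)) x"
  proof (cases "x \<in> topspace X")
    case x: True
    then show ?thesis
    proof (cases "x \<in> Y")
      case True
      then have "x \<in> U" using U by blast
      then show ?thesis
        using x True eps g[OF True] eps_compat[OF Y U True t]
        by (simp add: field_mult_apply gen_apply cstar_algebra.scale_one[OF fam])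
    next
      case False
      then have "f x = 0" by (rule C0_on_zero[OF f])
      then show ?thesis
        using x False eps
        by (simp add: field_mult_apply gen_apply cstar_algebra.scale_zero_left[OF fam] family.fam_closed)
    qed
  qed (simp add: gen_def field_mult_def)
qed

lemma factor_unique:
  assumes tau: "canonical_heteromorphism X K A j F \<epsilon> \<tau>"
    and \<eta>: "C0_morphism X alg struct B \<theta> \<eta>"
      "\<And>Y t. \<lbrakk>Y \<in> K; t \<in> cs_carrier (A Y)\<rbrakk> \<Longrightarrow> \<phi> Y t = S_morphism X B \<theta> \<eta> Y (\<tau> Y t)"
    and \<zeta>: "C0_morphism X alg struct B \<theta> \<zeta>"
      "\<And>Y t. \<lbrakk>Y \<in> K; t \<in> cs_carrier (A Y)\<rbrakk> \<Longrightarrow> \<phi> Y t = S_morphism X B \<theta> \<zeta> Y (\<tau> Y t)"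
    and a: "a \<in> cs_carrier alg"
  shows "\<eta> a = \<zeta> a"
proof -
  have m: "star_morphism alg B \<eta>" "star_morphism alg B \<zeta>" using \<eta>(1) \<zeta>(1) by (auto simp: C0_morphism_def)
  note m1 = star_morphismD[OF m(1)] and m2 = star_morphismD[OF m(2)]
  let ?S = "{a \<in> cs_carrier alg. \<eta> a = \<zeta> a}"
  have "star_subalgebra fields ?S"
    using m1 m2 algebra.closed star_morphism_zero[OF algebra.cstar_algebra_axioms cstar_algebra_axioms m(1)]
      star_morphism_zero[OF algebra.cstar_algebra_axioms cstar_algebra_axioms m(2)]
    by (auto simp: star_subalgebra_def linear_subspace_def alg_subset)
  moreover have "norm_closure fields ?S \<subseteq> ?S"
  proof
    fix a assume a: "a \<in> norm_closure fields ?S"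
    have "norm_closure fields ?S \<subseteq> norm_closure fields (cs_carrier alg)"
      by (fastforce simp: norm_closure_def)
    then have aA: "a \<in> cs_carrier alg" using a closure_alg by blast
    have "cs_norm B (\<eta> a \<ominus>\<^bsub>B\<^esub> \<zeta> a) \<le> e" if e: "e > 0" for e
    proof -
      obtain s where s: "s \<in> cs_carrier alg" "\<eta> s = \<zeta> s" "cs_norm fields (a \<ominus>\<^bsub>fields\<^esub> s) < e/2"
        using a e half_gt_zero unfolding norm_closure_def by blast
      have le: "cs_norm B (\<xi> a \<ominus>\<^bsub>B\<^esub> \<xi> s) \<le> cs_norm fields (a \<ominus>\<^bsub>fields\<^esub> s)"
        if "star_morphism alg B \<xi>" for \<xi>
        using star_morphism_contractive[OF algebra.cstar_algebra_axioms cstar_algebra_axioms that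
            algebra.diff_closed[OF aA s(1)]]
          star_morphism_diff[OF algebra.cstar_algebra_axioms that aA s(1)] by simp
      have "cs_norm B (\<eta> a \<ominus>\<^bsub>B\<^esub> \<zeta> a) \<le> cs_norm B (\<eta> a \<ominus>\<^bsub>B\<^esub> \<eta> s) + cs_norm B (\<zeta> a \<ominus>\<^bsub>B\<^esub> \<zeta> s)"
        using norm_diff_triangle[of "\<eta> a" "\<eta> s" "\<zeta> a"] norm_diff_commute[of "\<zeta> a" "\<zeta> s"]
          m1(1) m2(1) aA s by simp
      then show ?thesis using le[OF m(1)] le[OF m(2)] s(3) by simp
    qed
    then have "cs_norm B (\<eta> a \<ominus>\<^bsub>B\<^esub> \<zeta> a) \<le> 0" by (rule field_le_epsilon[of _ 0, simplified])
    then have "\<eta> a = \<zeta> a"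
      using norm_nonneg[OF diff_closed[OF m1(1)[OF aA] m2(1)[OF aA]]]
        norm_eq_zero[OF diff_closed[OF m1(1)[OF aA] m2(1)[OF aA]]] diff_eq_zero[OF m1(1)[OF aA] m2(1)[OF aA]]
      by simp
    then show "a \<in> ?S" using aA by simp
  qed
  moreover have "gen f Y t \<in> ?S" if g: "Y \<in> K" "f \<in> C0_on X Y" "t \<in> cs_carrier (A Y)" for Y f t
  proof -
    obtain U g' where U: "U \<in> K" "g' \<in> C0_on X U" "X closure_of Y \<subseteq> U" "\<And>x. x \<in> Y \<Longrightarrow> g' x = 1"
      and tau_eq: "\<tau> Y t = r_map X alg struct Y (gen g' U (j U Y t))"
      using tau g unfolding canonical_heteromorphism_def gen_def by metis
    have YU: "Y \<subseteq> U" using closure_of_subset[OF subset_K[OF g(1)]] U(3) by blast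
    \<comment> \<open>The class of \<open>?h\<close> is \<open>\<tau> Y t\<close>, so
      \<open>\<eta>\<close> and \<open>\<zeta>\<close> differ on it only within the restriction
      ideal of \<open>Y\<close>; \<open>f ?h\<close> is the generator itself.\<close>
    let ?h = "gen g' U (j U Y t)"
    have h: "?h \<in> cs_carrier alg" using gen_alg[OF U(1,2) j_closed[OF g(1) U(1) YU g(3)]] .
    have "r Y (\<eta> ?h) = r Y (\<zeta> ?h)"
      using \<eta>(2)[OF g(1,3)] \<zeta>(2)[OF g(1,3)] S_morphism_r[OF \<eta>(1) h, of Y] S_morphism_r[OF \<zeta>(1) h, of Y]
      by (simp add: tau_eq)
    then have "\<eta> ?h \<ominus>\<^bsub>B\<^esub> \<zeta> ?h \<in> restriction_ideal X B \<theta> Y"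
      using m1(1)[OF h] m2(1)[OF h] by (simp add: r_map_def res.coset_eq_iff)
    then have "C0_act \<theta> f (\<eta> ?h \<ominus>\<^bsub>B\<^esub> \<zeta> ?h) = \<zero>\<^bsub>B\<^esub>"
      by (rule C0_act_restriction_ideal[OF open_K[OF g(1)] g(2)])
    then have "C0_act \<theta> f (\<eta> ?h) \<ominus>\<^bsub>B\<^esub> C0_act \<theta> f (\<zeta> ?h) = \<zero>\<^bsub>B\<^esub>"
      using m1(1)[OF h] m2(1)[OF h] C0_act_linear[OF C0_on_K[OF g(1,2)]]
      by (simp add: cs_diff_def closed)
    then have "C0_act \<theta> f (\<eta> ?h) = C0_act \<theta> f (\<zeta> ?h)"
      using m1(1)[OF h] m2(1)[OF h] C0_act_linear(1)[OF C0_on_K[OF g(1,2)]] diff_eq_zero by blast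
    moreover have "\<xi> (gen f Y t) = C0_act \<theta> f (\<xi> ?h)" if "C0_morphism X alg struct B \<theta> \<xi>" for \<xi>
    proof -
      have "\<xi> (C0_act struct f ?h) = C0_act \<theta> f (\<xi> ?h)"
        using that C0_on_K[OF g(1,2)] h by (simp add: C0_morphism_def)
      then show ?thesis
        using gen_localize[OF g(1) U(1) YU U(4) g(2,3)] struct_act[OF h] by simp
    qed
    ultimately show ?thesis using \<eta>(1) \<zeta>(1) gen_alg[OF g] by simp
  qed
  ultimately have "cs_carrier alg \<subseteq> ?S" by (rule alg_induct)
  then show ?thesis using a by blast
qed

lemma factor_tau:
  assumes tau: "canonical_heteromorphism X K A j F \<epsilon> \<tau>" and Y: "Y \<in> K" and t: "t \<in> cs_carrier (A Y)"
  shows "\<phi> Y t = S_morphism X B \<theta> factor Y (\<tau> Y t)"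
proof -
  obtain U g where U: "U \<in> K" "g \<in> C0_on X U" "X closure_of Y \<subseteq> U" "\<And>x. x \<in> Y \<Longrightarrow> g x = 1"
    and tau_eq: "\<tau> Y t = r_map X alg struct Y (gen g U (j U Y t))"
    using tau Y t unfolding canonical_heteromorphism_def gen_def by metis
  have YU: "Y \<subseteq> U" using closure_of_subset[OF subset_K[OF Y]] U(3) by blast
  show ?thesis
    using S_morphism_r[OF C0_morphism_factor gen_alg[OF U(1,2) j_closed[OF Y U(1) YU t]], of Y]
      factor_gen[OF Y U(1) YU U(2,4) t] by (simp add: tau_eq)
qed

end

theorem theorem4p4:
  fixes X :: "'x topology"
    and K :: "'x set set"
    and A :: "'x set \<Rightarrow> 'a cstar"
    and j :: "'x set \<Rightarrow> 'x set \<Rightarrow> 'a \<Rightarrow> 'a"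
    and F :: "'x \<Rightarrow> 'u cstar"
    and \<epsilon> :: "'x \<Rightarrow> 'x set \<Rightarrow> 'a \<Rightarrow> 'u"
    and \<tau> :: "'x set \<Rightarrow> 'a \<Rightarrow> ('x \<Rightarrow> 'u) set"
    and B :: "'b cstar"
    and \<theta> :: "('x, 'b) C0_structure"
    and \<phi> :: "'x set \<Rightarrow> 'a \<Rightarrow> 'b set"
  defines "\<A> \<equiv> net_C0_algebra X K A F \<epsilon>"
    and "\<theta>\<A> \<equiv> net_C0_structure X K A F \<epsilon>"
  assumes "locally_compact_space X" and "Hausdorff_space X" and "path_connected_space X"
    and base: "openin X = arbitrary union_of (\<lambda>Y. Y \<in> K)"
    and rel_compact: "\<And>Y. Y \<in> K \<Longrightarrow> compactin X (X closure_of Y)"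
    and net: "cstar_net K A j"
    and fibres: "\<And>x. x \<in> topspace X \<Longrightarrow>
          is_universal_algebra (fibre_index K x) A j (F x) (\<epsilon> x)"
    and tau: "canonical_heteromorphism X K A j F \<epsilon> \<tau>"
    and B: "is_C0_algebra X B \<theta>"
    and phi: "heteromorphism X K A j B \<theta> \<phi>"
  shows "\<exists>!\<phi>'. \<phi>' \<in> extensional (cs_carrier \<A>) \<and>
           C0_morphism X \<A> \<theta>\<A> B \<theta> \<phi>' \<and>
           (\<forall>Y\<in>K. \<forall>t\<in>cs_carrier (A Y). \<phi> Y t = S_morphism X B \<theta> \<phi>' Y (\<tau> Y t))"
proof -
  have cB: "cstar_algebra B" using B by (simp add: is_C0_algebra_def)
  interpret cstar_algebra B by (rule cB)
  interpret H: net_heteromorphism X K A j F \<epsilon> B \<theta> \<phi>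
  proof unfold_locales
    show "openin X Y" if "Y \<in> K" for Y
      unfolding base using that by (rule arbitrary_union_of_inc)
  qed (use assms in auto)
  show ?thesis
    unfolding \<A>_def \<theta>\<A>_def
  proof (intro ex1I conjI ballI)
    show "H.factor \<in> extensional (cs_carrier H.alg)" by (simp add: H.factor_def)
    show "C0_morphism X H.alg H.struct B \<theta> H.factor" by (rule H.C0_morphism_factor)
    show "\<phi> Y t = S_morphism X B \<theta> H.factor Y (\<tau> Y t)" if "Y \<in> K" "t \<in> cs_carrier (A Y)" for Y t
      using H.factor_tau[OF tau that] .
    fix \<eta>
    assume \<eta>: "\<eta> \<in> extensional (cs_carrier H.alg) \<and> C0_morphism X H.alg H.struct B \<theta> \<eta> \<and>
      (\<forall>Y\<in>K. \<forall>t\<in>cs_carrier (A Y). \<phi> Y t = S_morphism X B \<theta> \<eta> Y (\<tau> Y t))"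
    show "\<eta> = H.factor"
    proof (rule extensionalityI)
      show "\<eta> \<in> extensional (cs_carrier H.alg)" using \<eta> by blast
      show "H.factor \<in> extensional (cs_carrier H.alg)" by (simp add: H.factor_def)
      show "\<eta> a = H.factor a" if "a \<in> cs_carrier H.alg" for a
        using \<eta> that H.factor_tau[OF tau] by (intro H.factor_unique[OF tau _ _ H.C0_morphism_factor]) auto
    qed
  qed
qed

end
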